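(* Let $I$ be an object of the topos of trees $\mathcal{S}$ and let $F:((\mathcal{S}/I)^{op}\times\mathcal{S}/I)^{n+1}\to\mathcal{S}/I$ be strong and locally contractive in the $(n+1)$th variable pair. Then there exists a unique (up to isomorphism) $\mathrm{Fix}\,F:((\mathcal{S}/I)^{op}\times\mathcal{S}/I)^n\to\mathcal{S}/I$ such that $F\circ\langle\mathrm{id},\widetilde{\mathrm{Fix}\,F}\rangle\cong\mathrm{Fix}\,F$. Moreover, if $F$ is locally contractive in all variables, so is $\mathrm{Fix}\,F$.
   Context: $\mathcal{S}$ is the category of presheaves on $\omega=\{1,2,3,\dots\}$ (objects: sets $X(n)$ with restriction maps $X(n+1)\to X(n)$). The later functor: $(\blacktriangleright X)(1)=\{\star\}$, $(\blacktriangleright X)(n+1)=X(n)$, with $\mathrm{next}_X:X\to\blacktriangleright X$ given by the unique map at stage 1 and the restriction $X(n+1)\to X(n)$ at stage $n+1$. On $\mathcal{S}/I$, $\blacktriangleright_I(p_Y:Y\to I)$ is the pullback of $\blacktriangleright p_Y$ along $\mathrm{next}_I:I\to\blacktriangleright I$, and $\mathrm{next}$ on the slice is induced by $p_Y$ and $\mathrm{next}_Y$. $\mathcal{S}/I$ is cartesian closed, hence self-enriched with hom-objects the exponentials $Y^X$ of $\mathcal{S}/I$. A functor is strong if it is enriched in this sense (hom-maps $Y^X\to (FY)^{FX}$ in $\mathcal{S}/I$ whose composite with the name $\ulcorner f\urcorner$ of a morphism is $\ulcorner Ff\urcorner$, respecting composition and identities); for several mixed-variance arguments the hom-object of $(\mathcal{S}/I)^{op}\times\mathcal{S}/I$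 from $(X,Y)$ to $(X',Y')$ is $X^{X'}\times Y'^{Y}$. $F$ is locally contractive in a variable pair if its enriched hom-action factors, as an enriched functor, through $\mathrm{next}$ applied to the hom-objects of that variable pair (i.e. through the category with hom-objects $\blacktriangleright_I$ of the original ones, composition $\blacktriangleright_I(\mathrm{comp})$ and identities $\mathrm{next}\circ\ulcorner\mathrm{id}\urcorner$). The symmetrization of $G:((\mathcal{S}/I)^{op}\times\mathcal{S}/I)^n\to\mathcal{S}/I$ is $\widetilde{G}(\vec X,\vec Y)=(G(\vec Y,\vec X),G(\vec X,\vec Y))$. *)

theory Defs
  imports "HOL-Library.FuncSet" "HOL-Library.Equipollence"
begin

section \<open>The category of sets\<close>

text \<open>HOL has no type of all sets. ``Set'' is rendered as a collection \<open>U\<close> of sets over some type,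
  closed under everything equipollent to a subset, under products and under power sets, up to
  bijection (so that presheaves on \<open>\<omega>\<close> with values in \<open>U\<close> form a topos). Both \<open>U\<close> and the type are
  arbitrary: nothing bounds the size of the sets in \<open>U\<close>.\<close>

definition set_universe :: "'u set set \<Rightarrow> bool" where
  "set_universe U \<longleftrightarrow> U \<noteq> {} \<and>
     (\<forall>A\<in>U. \<forall>B::'u set. B \<lesssim> A \<longrightarrow> B \<in> U) \<and>
     (\<forall>A\<in>U. \<forall>B\<in>U. \<exists>C\<in>U. C \<approx> A \<times> B) \<and>
     (\<forall>A\<in>U. \<exists>C\<in>U. C \<approx> Pow A)"

lemma set_universe_finite: "set_universe {A :: nat set. finite A}"
proof -
  have ex: "\<exists>C::nat set. finite C \<and> C \<approx> S" if "finite S" for S :: "'b set"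
    using that by (metis eqpoll_iff_card finite_lessThan card_lessThan)
  have "finite B" if "B \<lesssim> A" "finite A" for A B :: "nat set"
    using that by (metis finite_lepoll_infinite lepoll_trans lepoll_iff finite_surj)
  then show ?thesis
    unfolding set_universe_def by (auto intro: ex)
qed

section \<open>The topos of trees\<close>

text \<open>Stages are numbered from 0: the index \<open>n\<close> stands for the stage \<open>n + 1\<close> of \<open>\<omega> = {1,2,3,\<dots>}\<close>.
  \<open>res X n\<close> is the restriction from index \<open>n + 1\<close> to index \<open>n\<close>. All maps are extensional, so that
  equality of objects and of morphisms is HOL equality.\<close>

record 'a tree =
  car :: "nat \<Rightarrow> 'a set"
  res :: "nat \<Rightarrow> 'a \<Rightarrow> 'a"

definition is_tree :: "('a, 'z) tree_scheme \<Rightarrow> bool" where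
  "is_tree X \<longleftrightarrow> (\<forall>n. res X n \<in> car X (Suc n) \<rightarrow>\<^sub>E car X n)"

definition in_universe :: "'u set set \<Rightarrow> ('u, 'z) tree_scheme \<Rightarrow> bool" where
  "in_universe U X \<longleftrightarrow> (\<forall>n. car X n \<in> U)"

definition tree_hom ::
    "('a, 'y) tree_scheme \<Rightarrow> ('b, 'z) tree_scheme \<Rightarrow> (nat \<Rightarrow> 'a \<Rightarrow> 'b) set" where
  "tree_hom X Y = {f. (\<forall>n. f n \<in> car X n \<rightarrow>\<^sub>E car Y n) \<and>
     (\<forall>n. \<forall>x\<in>car X (Suc n). f n (res X n x) = res Y n (f (Suc n) x))}"

text \<open>\<open>rst X m n\<close> is the restriction from index \<open>n\<close> down to index \<open>m \<le> n\<close>.\<close>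

fun rst :: "('a, 'z) tree_scheme \<Rightarrow> nat \<Rightarrow> nat \<Rightarrow> 'a \<Rightarrow> 'a" where
  "rst X m 0 x = x"
| "rst X m (Suc n) x = (if Suc n \<le> m then x else rst X m n (res X n x))"

definition later :: "('a, 'z) tree_scheme \<Rightarrow> 'a option tree" where
  "later X =
     (let c = (\<lambda>n. case n of 0 \<Rightarrow> {None} | Suc m \<Rightarrow> Some ` car X m)
      in \<lparr>car = c,
          res = (\<lambda>n. \<lambda>x\<in>c (Suc n). case n of 0 \<Rightarrow> None | Suc m \<Rightarrow> map_option (res X m) x)\<rparr>)"

definition later_map ::
    "('a, 'z) tree_scheme \<Rightarrow> (nat \<Rightarrow> 'a \<Rightarrow> 'b) \<Rightarrow> nat \<Rightarrow> 'a option \<Rightarrow> 'b option" where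
  "later_map X f n = (\<lambda>x\<in>car (later X) n. case n of 0 \<Rightarrow> None | Suc m \<Rightarrow> map_option (f m) x)"

definition next_tree :: "('a, 'z) tree_scheme \<Rightarrow> nat \<Rightarrow> 'a \<Rightarrow> 'a option" where
  "next_tree X n = (\<lambda>x\<in>car X n. case n of 0 \<Rightarrow> None | Suc m \<Rightarrow> Some (res X m x))"

section \<open>Slices\<close>

record ('a, 'i) slice = "'a tree" +
  prj :: "nat \<Rightarrow> 'a \<Rightarrow> 'i"

definition is_slice :: "'i tree \<Rightarrow> ('a, 'i) slice \<Rightarrow> bool" where
  "is_slice I Y \<longleftrightarrow> is_tree Y \<and> prj Y \<in> tree_hom Y I"

definition slice_hom :: "('a, 'i) slice \<Rightarrow> ('b, 'i) slice \<Rightarrow> (nat \<Rightarrow> 'a \<Rightarrow> 'b) set" where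
  "slice_hom X Y = {f \<in> tree_hom X Y. \<forall>n. \<forall>x\<in>car X n. prj Y n (f n x) = prj X n x}"

definition fibre :: "('a, 'i) slice \<Rightarrow> nat \<Rightarrow> 'i \<Rightarrow> 'a set" where
  "fibre X n i = {x \<in> car X n. prj X n x = i}"

text \<open>The pullback of \<open>f : A \<rightarrow> C\<close> along \<open>g : B \<rightarrow> C\<close>, as an object over \<open>B\<close>.\<close>

definition pullback ::
    "('b, 'y) tree_scheme \<Rightarrow> (nat \<Rightarrow> 'b \<Rightarrow> 'c) \<Rightarrow> ('a, 'z) tree_scheme \<Rightarrow> (nat \<Rightarrow> 'a \<Rightarrow> 'c)
      \<Rightarrow> ('b \<times> 'a, 'b) slice" where
  "pullback B g A f =
     (let c = (\<lambda>n. {(b, a). b \<in> car B n \<and> a \<in> car A n \<and> f n a = g n b})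
      in \<lparr>car = c,
          res = (\<lambda>n. \<lambda>(b, a)\<in>c (Suc n). (res B n b, res A n a)),
          prj = (\<lambda>n. restrict fst (c n))\<rparr>)"

definition later_slice :: "'i tree \<Rightarrow> ('a, 'i) slice \<Rightarrow> ('i \<times> 'a option, 'i) slice" where
  "later_slice I Y = pullback I (next_tree I) (later Y) (later_map Y (prj Y))"

definition later_slice_map ::
    "'i tree \<Rightarrow> ('a, 'i) slice \<Rightarrow> (nat \<Rightarrow> 'a \<Rightarrow> 'b) \<Rightarrow> nat \<Rightarrow> 'i \<times> 'a option \<Rightarrow> 'i \<times> 'b option" where
  "later_slice_map I Y f n = (\<lambda>(i, y)\<in>car (later_slice I Y) n. (i, later_map Y f n y))"

definition next_slice :: "('a, 'i) slice \<Rightarrow> nat \<Rightarrow> 'a \<Rightarrow> 'i \<times> 'a option" where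
  "next_slice Y n = (\<lambda>y\<in>car Y n. (prj Y n y, next_tree Y n y))"

text \<open>Products in the slice are fibre products over \<open>I\<close>. The base point is recorded explicitly in
  a product of a family, which makes the empty product the terminal object \<open>id : I \<rightarrow> I\<close>.\<close>

definition prod_slice :: "('a, 'i) slice \<Rightarrow> ('b, 'i) slice \<Rightarrow> ('a \<times> 'b, 'i) slice" where
  "prod_slice X Y =
     (let c = (\<lambda>n. {(x, y). x \<in> car X n \<and> y \<in> car Y n \<and> prj X n x = prj Y n y})
      in \<lparr>car = c,
          res = (\<lambda>n. \<lambda>(x, y)\<in>c (Suc n). (res X n x, res Y n y)),
          prj = (\<lambda>n. \<lambda>(x, y)\<in>c n. prj X n x)\<rparr>)"

definition prod_family ::
    "'i tree \<Rightarrow> nat set \<Rightarrow> (nat \<Rightarrow> ('a, 'i) slice) \<Rightarrow> ('i \<times> (nat \<Rightarrow> 'a), 'i) slice" where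
  "prod_family I J Y =
     (let c = (\<lambda>n. {(i, h). i \<in> car I n \<and> h \<in> (\<Pi>\<^sub>E j\<in>J. fibre (Y j) n i)})
      in \<lparr>car = c,
          res = (\<lambda>n. \<lambda>(i, h)\<in>c (Suc n). (res I n i, \<lambda>j\<in>J. res (Y j) n (h j))),
          prj = (\<lambda>n. restrict fst (c n))\<rparr>)"

text \<open>The exponential \<open>Y\<^sup>X\<close> of the slice over \<open>I\<close>. By Yoneda, an element at index \<open>n\<close> over \<open>i \<in> I(n)\<close>
  is a morphism over \<open>I\<close> from \<open>y(n) \<times>\<^sub>I X\<close> to \<open>Y\<close>, where \<open>y(n)\<close> lies over \<open>I\<close> by \<open>i\<close>: a
  family of maps between the fibres over the restrictions of \<open>i\<close> to the indices \<open>m \<le> n\<close>,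
  commuting with restriction.\<close>

type_synonym ('a, 'b, 'i) expel = "'i \<times> (nat \<Rightarrow> 'a \<Rightarrow> 'b)"

definition exp_slice ::
    "'i tree \<Rightarrow> ('a, 'i) slice \<Rightarrow> ('b, 'i) slice \<Rightarrow> (('a, 'b, 'i) expel, 'i) slice" where
  "exp_slice I X Y =
     (let c = (\<lambda>n. {(i, f). i \<in> car I n \<and>
                 f \<in> (\<Pi>\<^sub>E m\<in>{..n}. fibre X m (rst I m n i) \<rightarrow>\<^sub>E fibre Y m (rst I m n i)) \<and>
                 (\<forall>m<n. \<forall>x\<in>fibre X (Suc m) (rst I (Suc m) n i).
                    f m (res X m x) = res Y m (f (Suc m) x))})
      in \<lparr>car = c,
          res = (\<lambda>n. \<lambda>(i, f)\<in>c (Suc n). (res I n i, restrict f {..n})),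
          prj = (\<lambda>n. restrict fst (c n))\<rparr>)"

text \<open>The name \<open>1 \<rightarrow> Y\<^sup>X\<close> of a morphism \<open>f : X \<rightarrow> Y\<close>, where \<open>1\<close> is \<open>id : I \<rightarrow> I\<close>.\<close>

definition exp_name ::
    "'i tree \<Rightarrow> ('a, 'i) slice \<Rightarrow> (nat \<Rightarrow> 'a \<Rightarrow> 'b) \<Rightarrow> nat \<Rightarrow> 'i \<Rightarrow> ('a, 'b, 'i) expel" where
  "exp_name I X f n =
     (\<lambda>i\<in>car I n. (i, \<lambda>m\<in>{..n}. \<lambda>x\<in>fibre X m (rst I m n i). f m x))"

definition exp_comp ::
    "'i tree \<Rightarrow> ('a, 'i) slice \<Rightarrow> ('b, 'i) slice \<Rightarrow> ('c, 'i) slice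
      \<Rightarrow> nat \<Rightarrow> ('b, 'c, 'i) expel \<times> ('a, 'b, 'i) expel \<Rightarrow> ('a, 'c, 'i) expel" where
  "exp_comp I X Y Z n =
     (\<lambda>((i, g), (i', f))\<in>car (prod_slice (exp_slice I Y Z) (exp_slice I X Y)) n.
        (i, \<lambda>m\<in>{..n}. \<lambda>x\<in>fibre X m (rst I m n i). g m (f m x)))"

section \<open>Categories and functors\<close>

text \<open>\<open>cmp C A B D g f\<close> is the composite of \<open>f : A \<rightarrow> B\<close> and \<open>g : B \<rightarrow> D\<close>.\<close>

record ('o, 'm) category =
  Obj :: "'o set"
  Arr :: "'o \<Rightarrow> 'o \<Rightarrow> 'm set"
  cmp :: "'o \<Rightarrow> 'o \<Rightarrow> 'o \<Rightarrow> 'm \<Rightarrow> 'm \<Rightarrow> 'm"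
  idn :: "'o \<Rightarrow> 'm"

definition op_cat :: "('o, 'm) category \<Rightarrow> ('o, 'm) category" where
  "op_cat C = \<lparr>Obj = Obj C, Arr = (\<lambda>A B. Arr C B A),
     cmp = (\<lambda>A B D g f. cmp C D B A f g), idn = idn C\<rparr>"

definition prod_cat ::
    "('o, 'm) category \<Rightarrow> ('p, 'n) category \<Rightarrow> ('o \<times> 'p, 'm \<times> 'n) category" where
  "prod_cat C D = \<lparr>Obj = Obj C \<times> Obj D,
     Arr = (\<lambda>A B. Arr C (fst A) (fst B) \<times> Arr D (snd A) (snd B)),
     cmp = (\<lambda>A B E g f. (cmp C (fst A) (fst B) (fst E) (fst g) (fst f),
                          cmp D (snd A) (snd B) (snd E) (snd g) (snd f))),
     idn = (\<lambda>A. (idn C (fst A), idn D (snd A)))\<rparr>"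

definition pow_cat :: "nat set \<Rightarrow> ('o, 'm) category \<Rightarrow> (nat \<Rightarrow> 'o, nat \<Rightarrow> 'm) category" where
  "pow_cat J C = \<lparr>Obj = (\<Pi>\<^sub>E j\<in>J. Obj C),
     Arr = (\<lambda>p q. \<Pi>\<^sub>E j\<in>J. Arr C (p j) (q j)),
     cmp = (\<lambda>p q r g f. \<lambda>j\<in>J. cmp C (p j) (q j) (r j) (g j) (f j)),
     idn = (\<lambda>p. \<lambda>j\<in>J. idn C (p j))\<rparr>"

text \<open>Categories enriched over the slice over \<open>I\<close>, with its cartesian structure:
  \<open>Comp C A B D\<close> is a morphism \<open>Hom C B D \<times>\<^sub>I Hom C A B \<rightarrow> Hom C A D\<close> and \<open>Id C A\<close> is a morphism
  \<open>1 \<rightarrow> Hom C A A\<close>.\<close>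

record ('o, 'h, 'i) ecategory =
  Ob :: "'o set"
  Hom :: "'o \<Rightarrow> 'o \<Rightarrow> ('h, 'i) slice"
  Comp :: "'o \<Rightarrow> 'o \<Rightarrow> 'o \<Rightarrow> nat \<Rightarrow> 'h \<times> 'h \<Rightarrow> 'h"
  Id :: "'o \<Rightarrow> nat \<Rightarrow> 'i \<Rightarrow> 'h"

definition op_ecat :: "('o, 'h, 'i) ecategory \<Rightarrow> ('o, 'h, 'i) ecategory" where
  "op_ecat C = \<lparr>Ob = Ob C, Hom = (\<lambda>A B. Hom C B A),
     Comp = (\<lambda>A B D n. \<lambda>(g, f)\<in>car (prod_slice (Hom C D B) (Hom C B A)) n. Comp C D B A n (f, g)),
     Id = Id C\<rparr>"

definition prod_ecat ::
    "('o, 'h, 'i) ecategory \<Rightarrow> ('p, 'k, 'i) ecategory \<Rightarrow> ('o \<times> 'p, 'h \<times> 'k, 'i) ecategory" where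
  "prod_ecat C D =
     (let H = (\<lambda>A B. prod_slice (Hom C (fst A) (fst B)) (Hom D (snd A) (snd B)))
      in \<lparr>Ob = Ob C \<times> Ob D, Hom = H,
          Comp = (\<lambda>A B E n. \<lambda>(g, f)\<in>car (prod_slice (H B E) (H A B)) n.
                    (Comp C (fst A) (fst B) (fst E) n (fst g, fst f),
                     Comp D (snd A) (snd B) (snd E) n (snd g, snd f))),
          Id = (\<lambda>A n i. (Id C (fst A) n i, Id D (snd A) n i))\<rparr>)"

definition pow_ecat ::
    "'i tree \<Rightarrow> nat set \<Rightarrow> ('o, 'h, 'i) ecategory \<Rightarrow> (nat \<Rightarrow> 'o, 'i \<times> (nat \<Rightarrow> 'h), 'i) ecategory" where
  "pow_ecat I J C =
     (let H = (\<lambda>p q. prod_family I J (\<lambda>j. Hom C (p j) (q j)))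
      in \<lparr>Ob = (\<Pi>\<^sub>E j\<in>J. Ob C), Hom = H,
          Comp = (\<lambda>p q r n. \<lambda>((i, g), (i', f))\<in>car (prod_slice (H q r) (H p q)) n.
                    (i, \<lambda>j\<in>J. Comp C (p j) (q j) (r j) n (g j, f j))),
          Id = (\<lambda>p n. \<lambda>i\<in>car I n. (i, \<lambda>j\<in>J. Id C (p j) n i))\<rparr>)"

text \<open>\<open>later_pair\<close> is the canonical isomorphism from the product of two laters to the later of the
  product.\<close>

fun later_pair :: "('i \<times> 'a option) \<times> ('i \<times> 'b option) \<Rightarrow> 'i \<times> ('a \<times> 'b) option" where
  "later_pair ((i, Some a), (i', Some b)) = (i, Some (a, b))"
| "later_pair ((i, _), (i', _)) = (i, None)"

definition later_ecat ::
    "'i tree \<Rightarrow> ('o, 'h, 'i) ecategory \<Rightarrow> ('o, 'i \<times> 'h option, 'i) ecategory" where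
  "later_ecat I C =
     (let H = (\<lambda>A B. later_slice I (Hom C A B))
      in \<lparr>Ob = Ob C, Hom = H,
          Comp = (\<lambda>A B D n. \<lambda>gf\<in>car (prod_slice (H B D) (H A B)) n.
                    later_slice_map I (prod_slice (Hom C B D) (Hom C A B)) (Comp C A B D) n
                      (later_pair gf)),
          Id = (\<lambda>A n. \<lambda>i\<in>car I n. next_slice (Hom C A A) n (Id C A n i))\<rparr>)"

record ('o, 'p, 'h, 'k) efunctor =
  fob :: "'o \<Rightarrow> 'p"
  fhom :: "'o \<Rightarrow> 'o \<Rightarrow> nat \<Rightarrow> 'h \<Rightarrow> 'k"

definition is_efunctor ::
    "'i tree \<Rightarrow> ('o, 'h, 'i) ecategory \<Rightarrow> ('p, 'k, 'i) ecategory
      \<Rightarrow> ('o, 'p, 'h, 'k, 'z) efunctor_scheme \<Rightarrow> bool" where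
  "is_efunctor I C D F \<longleftrightarrow>
     (\<forall>A\<in>Ob C. fob F A \<in> Ob D) \<and>
     (\<forall>A\<in>Ob C. \<forall>B\<in>Ob C. fhom F A B \<in> slice_hom (Hom C A B) (Hom D (fob F A) (fob F B))) \<and>
     (\<forall>A\<in>Ob C. \<forall>B\<in>Ob C. \<forall>E\<in>Ob C. \<forall>n. \<forall>(g, f)\<in>car (prod_slice (Hom C B E) (Hom C A B)) n.
        fhom F A E n (Comp C A B E n (g, f)) =
        Comp D (fob F A) (fob F B) (fob F E) n (fhom F B E n g, fhom F A B n f)) \<and>
     (\<forall>A\<in>Ob C. \<forall>n. \<forall>i\<in>car I n. fhom F A A n (Id C A n i) = Id D (fob F A) n i)"

text \<open>The data of a strong functor: the action on objects, on hom-objects and on morphisms. For a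
  functor that is not claimed to be strong, the field \<open>fhom\<close> carries no meaning.\<close>

record ('o, 'p, 'h, 'k, 'm, 'n) sfunctor = "('o, 'p, 'h, 'k) efunctor" +
  fmor :: "'o \<Rightarrow> 'o \<Rightarrow> 'm \<Rightarrow> 'n"

definition is_functor ::
    "('o, 'm) category \<Rightarrow> ('p, 'n) category \<Rightarrow> ('o, 'p, 'h, 'k, 'm, 'n) sfunctor \<Rightarrow> bool" where
  "is_functor C D F \<longleftrightarrow>
     (\<forall>A\<in>Obj C. fob F A \<in> Obj D) \<and>
     (\<forall>A\<in>Obj C. \<forall>B\<in>Obj C. \<forall>f\<in>Arr C A B. fmor F A B f \<in> Arr D (fob F A) (fob F B)) \<and>
     (\<forall>A\<in>Obj C. \<forall>B\<in>Obj C. \<forall>E\<in>Obj C. \<forall>f\<in>Arr C A B. \<forall>g\<in>Arr C B E.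
        fmor F A E (cmp C A B E g f) =
        cmp D (fob F A) (fob F B) (fob F E) (fmor F B E g) (fmor F A B f)) \<and>
     (\<forall>A\<in>Obj C. fmor F A A (idn C A) = idn D (fob F A))"

definition comp_fun ::
    "('p, 'q, 'k, 'l, 'n, 'r) sfunctor \<Rightarrow> ('o, 'p, 'h, 'k, 'm, 'n) sfunctor
      \<Rightarrow> ('o, 'q, 'h, 'l, 'm, 'r) sfunctor" where
  "comp_fun G F = \<lparr>fob = (\<lambda>A. fob G (fob F A)),
     fhom = (\<lambda>A B n h. fhom G (fob F A) (fob F B) n (fhom F A B n h)),
     fmor = (\<lambda>A B f. fmor G (fob F A) (fob F B) (fmor F A B f))\<rparr>"

definition natural_iso ::
    "('o, 'm) category \<Rightarrow> ('p, 'n) category \<Rightarrow> ('o, 'p, 'h, 'k, 'm, 'n) sfunctor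
      \<Rightarrow> ('o, 'p, 'h, 'k, 'm, 'n) sfunctor \<Rightarrow> ('o \<Rightarrow> 'n) \<Rightarrow> bool" where
  "natural_iso C D F G \<alpha> \<longleftrightarrow>
     (\<forall>A\<in>Obj C. \<alpha> A \<in> Arr D (fob F A) (fob G A) \<and>
        (\<exists>\<beta>\<in>Arr D (fob G A) (fob F A).
           cmp D (fob F A) (fob G A) (fob F A) \<beta> (\<alpha> A) = idn D (fob F A) \<and>
           cmp D (fob G A) (fob F A) (fob G A) (\<alpha> A) \<beta> = idn D (fob G A))) \<and>
     (\<forall>A\<in>Obj C. \<forall>B\<in>Obj C. \<forall>f\<in>Arr C A B.
        cmp D (fob F A) (fob F B) (fob G B) (\<alpha> B) (fmor F A B f) =
        cmp D (fob F A) (fob G A) (fob G B) (fmor G A B f) (\<alpha> A))"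

section \<open>The slice as an ordinary and as a self-enriched category\<close>

type_synonym 'u obj = "('u, 'u) slice"
type_synonym 'u mor = "nat \<Rightarrow> 'u \<Rightarrow> 'u"
type_synonym 'u el = "('u, 'u, 'u) expel"

definition slice_objects :: "'u set set \<Rightarrow> 'u tree \<Rightarrow> 'u obj set" where
  "slice_objects U I = {Y. is_slice I Y \<and> in_universe U Y}"

definition slice_cat :: "'u set set \<Rightarrow> 'u tree \<Rightarrow> ('u obj, 'u mor) category" where
  "slice_cat U I = \<lparr>Obj = slice_objects U I, Arr = slice_hom,
     cmp = (\<lambda>X Y Z g f n. \<lambda>x\<in>car X n. g n (f n x)),
     idn = (\<lambda>X n. \<lambda>x\<in>car X n. x)\<rparr>"

definition slice_ecat :: "'u set set \<Rightarrow> 'u tree \<Rightarrow> ('u obj, 'u el, 'u) ecategory" where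
  "slice_ecat U I = \<lparr>Ob = slice_objects U I, Hom = exp_slice I, Comp = exp_comp I,
     Id = (\<lambda>X. exp_name I X (idn (slice_cat U I) X))\<rparr>"

text \<open>A tuple in the \<open>N\<close>-fold power of \<open>(S/I)\<^sup>o\<^sup>p \<times> S/I\<close> is a function on the indices \<open>{..<N}\<close>;
  the \<open>j\<close>th pair consists of the contravariant argument followed by the covariant one.\<close>

type_synonym 'u mixed = "'u obj \<times> 'u obj"
type_synonym 'u tuple = "nat \<Rightarrow> 'u mixed"

definition mixed_cat :: "'u set set \<Rightarrow> 'u tree \<Rightarrow> ('u mixed, 'u mor \<times> 'u mor) category" where
  "mixed_cat U I = prod_cat (op_cat (slice_cat U I)) (slice_cat U I)"

definition mixed_ecat :: "'u set set \<Rightarrow> 'u tree \<Rightarrow> ('u mixed, 'u el \<times> 'u el, 'u) ecategory" where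
  "mixed_ecat U I = prod_ecat (op_ecat (slice_ecat U I)) (slice_ecat U I)"

definition dom_cat ::
    "'u set set \<Rightarrow> 'u tree \<Rightarrow> nat \<Rightarrow> ('u tuple, nat \<Rightarrow> 'u mor \<times> 'u mor) category" where
  "dom_cat U I N = pow_cat {..<N} (mixed_cat U I)"

definition dom_ecat ::
    "'u set set \<Rightarrow> 'u tree \<Rightarrow> nat \<Rightarrow> ('u tuple, 'u \<times> (nat \<Rightarrow> 'u el \<times> 'u el), 'u) ecategory" where
  "dom_ecat U I N = pow_ecat I {..<N} (mixed_ecat U I)"

definition dom_name ::
    "'u tree \<Rightarrow> nat \<Rightarrow> 'u tuple \<Rightarrow> 'u tuple \<Rightarrow> (nat \<Rightarrow> 'u mor \<times> 'u mor)
      \<Rightarrow> nat \<Rightarrow> 'u \<Rightarrow> 'u \<times> (nat \<Rightarrow> 'u el \<times> 'u el)" where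
  "dom_name I N p q f n =
     (\<lambda>i\<in>car I n. (i, \<lambda>j\<in>{..<N}. (exp_name I (fst (q j)) (fst (f j)) n i,
                                   exp_name I (snd (p j)) (snd (f j)) n i)))"

type_synonym 'u mfunctor =
  "('u tuple, 'u obj, 'u \<times> (nat \<Rightarrow> 'u el \<times> 'u el), 'u el, nat \<Rightarrow> 'u mor \<times> 'u mor, 'u mor) sfunctor"

definition strong_functor :: "'u set set \<Rightarrow> 'u tree \<Rightarrow> nat \<Rightarrow> 'u mfunctor \<Rightarrow> bool" where
  "strong_functor U I N F \<longleftrightarrow>
     is_functor (dom_cat U I N) (slice_cat U I) F \<and>
     is_efunctor I (dom_ecat U I N) (slice_ecat U I) F \<and>
     (\<forall>p\<in>Obj (dom_cat U I N). \<forall>q\<in>Obj (dom_cat U I N). \<forall>f\<in>Arr (dom_cat U I N) p q.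
        \<forall>n. \<forall>i\<in>car I n.
          fhom F p q n (dom_name I N p q f n i) = exp_name I (fob F p) (fmor F p q f) n i)"

text \<open>Natural isomorphism of strong functors: natural also with respect to the hom-objects.\<close>

definition strong_natural_iso ::
    "'u set set \<Rightarrow> 'u tree \<Rightarrow> nat \<Rightarrow> 'u mfunctor \<Rightarrow> 'u mfunctor \<Rightarrow> ('u tuple \<Rightarrow> 'u mor) \<Rightarrow> bool" where
  "strong_natural_iso U I N F G \<alpha> \<longleftrightarrow>
     natural_iso (dom_cat U I N) (slice_cat U I) F G \<alpha> \<and>
     (\<forall>p\<in>Ob (dom_ecat U I N). \<forall>q\<in>Ob (dom_ecat U I N).
        \<forall>n. \<forall>h\<in>car (Hom (dom_ecat U I N) p q) n.
          let i = prj (Hom (dom_ecat U I N) p q) n h in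
          exp_comp I (fob F p) (fob F q) (fob G q) n
            (exp_name I (fob F q) (\<alpha> q) n i, fhom F p q n h) =
          exp_comp I (fob F p) (fob G p) (fob G q) n
            (fhom G p q n h, exp_name I (fob F p) (\<alpha> p) n i))"

section \<open>Local contractiveness\<close>

text \<open>\<open>contr_ecat U I N k\<close> has the objects of the \<open>N\<close>-fold power, split into the \<open>k\<close>th pair and the
  others, and the original hom-objects except for later applied to those of the \<open>k\<close>th pair.\<close>

definition contr_ecat ::
    "'u set set \<Rightarrow> 'u tree \<Rightarrow> nat \<Rightarrow> nat
      \<Rightarrow> ('u tuple \<times> 'u mixed,
          ('u \<times> (nat \<Rightarrow> 'u el \<times> 'u el)) \<times> ('u \<times> ('u el \<times> 'u el) option), 'u) ecategory" where
  "contr_ecat U I N k =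
     prod_ecat (pow_ecat I ({..<N} - {k}) (mixed_ecat U I)) (later_ecat I (mixed_ecat U I))"

definition next_efunctor ::
    "'u set set \<Rightarrow> 'u tree \<Rightarrow> nat \<Rightarrow> nat
      \<Rightarrow> ('u tuple, 'u tuple \<times> 'u mixed, 'u \<times> (nat \<Rightarrow> 'u el \<times> 'u el),
          ('u \<times> (nat \<Rightarrow> 'u el \<times> 'u el)) \<times> ('u \<times> ('u el \<times> 'u el) option)) efunctor" where
  "next_efunctor U I N k = \<lparr>fob = (\<lambda>p. (restrict p ({..<N} - {k}), p k)),
     fhom = (\<lambda>p q n. \<lambda>(i, h)\<in>car (Hom (dom_ecat U I N) p q) n.
               ((i, restrict h ({..<N} - {k})),
                next_slice (Hom (mixed_ecat U I) (p k) (q k)) n (h k)))\<rparr>"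

definition locally_contractive ::
    "'u set set \<Rightarrow> 'u tree \<Rightarrow> nat \<Rightarrow> nat \<Rightarrow> 'u mfunctor \<Rightarrow> bool" where
  "locally_contractive U I N k F \<longleftrightarrow>
     (\<exists>G. is_efunctor I (contr_ecat U I N k) (slice_ecat U I) (G :: (_, _, _, _) efunctor) \<and>
        (\<forall>p\<in>Ob (dom_ecat U I N). fob F p = fob G (fob (next_efunctor U I N k) p)) \<and>
        (\<forall>p\<in>Ob (dom_ecat U I N). \<forall>q\<in>Ob (dom_ecat U I N).
           \<forall>n. \<forall>h\<in>car (Hom (dom_ecat U I N) p q) n.
             fhom F p q n h =
             fhom G (fob (next_efunctor U I N k) p) (fob (next_efunctor U I N k) q) n
               (fhom (next_efunctor U I N k) p q n h)))"

section \<open>Symmetrization and fixed points\<close>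

definition swap_tuple :: "nat \<Rightarrow> (nat \<Rightarrow> 'a \<times> 'a) \<Rightarrow> nat \<Rightarrow> 'a \<times> 'a" where
  "swap_tuple N p = (\<lambda>j\<in>{..<N}. prod.swap (p j))"

text \<open>A morphism \<open>p \<rightarrow> q\<close> of the \<open>N\<close>-fold power, with its components swapped, is a morphism from
  the swap of \<open>q\<close> to the swap of \<open>p\<close>; the same applies to elements of hom-objects.\<close>

definition symmetrization ::
    "nat \<Rightarrow> 'u mfunctor \<Rightarrow>
      ('u tuple, 'u mixed, 'u \<times> (nat \<Rightarrow> 'u el \<times> 'u el), 'u el \<times> 'u el,
       nat \<Rightarrow> 'u mor \<times> 'u mor, 'u mor \<times> 'u mor) sfunctor" where
  "symmetrization N G =
     \<lparr>fob = (\<lambda>p. (fob G (swap_tuple N p), fob G p)),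
      fhom = (\<lambda>p q n (i, h).
                (fhom G (swap_tuple N q) (swap_tuple N p) n (i, swap_tuple N h),
                 fhom G p q n (i, h))),
      fmor = (\<lambda>p q f.
                (fmor G (swap_tuple N q) (swap_tuple N p) (swap_tuple N f), fmor G p q f))\<rparr>"

text \<open>The functor \<open>\<langle>id, K\<rangle>\<close> from the \<open>N\<close>-fold to the \<open>(N+1)\<close>-fold power; \<open>K\<close> supplies the last
  pair, which has the index \<open>N\<close>.\<close>

definition graph_functor ::
    "nat \<Rightarrow> ('u tuple, 'u mixed, 'u \<times> (nat \<Rightarrow> 'u el \<times> 'u el), 'u el \<times> 'u el,
       nat \<Rightarrow> 'u mor \<times> 'u mor, 'u mor \<times> 'u mor) sfunctor \<Rightarrow>
      ('u tuple, 'u tuple, 'u \<times> (nat \<Rightarrow> 'u el \<times> 'u el), 'u \<times> (nat \<Rightarrow> 'u el \<times> 'u el),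
       nat \<Rightarrow> 'u mor \<times> 'u mor, nat \<Rightarrow> 'u mor \<times> 'u mor) sfunctor" where
  "graph_functor N K =
     \<lparr>fob = (\<lambda>p. p(N := fob K p)),
      fhom = (\<lambda>p q n (i, h). (i, h(N := fhom K p q n (i, h)))),
      fmor = (\<lambda>p q f. f(N := fmor K p q f))\<rparr>"

definition fix_functional :: "nat \<Rightarrow> 'u mfunctor \<Rightarrow> 'u mfunctor \<Rightarrow> 'u mfunctor" where
  "fix_functional N F G = comp_fun F (graph_functor N (symmetrization N G))"

end

theory Submission
  imports Defs
begin

text \<open>An element of a hom-object at index \<open>m\<close> over \<open>i \<in> I(m)\<close> is a morphism defined up to index \<open>m\<close>. A
  locally contractive action sends an element given only at index \<open>m\<close> to one at index \<open>m + 1\<close>, so an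
  equation \<open>e = \<Phi>(e', e)\<close>, \<open>e' = \<Phi>(e, e')\<close> between elements of hom-objects, the second element accounting
  for the contravariant arguments, has exactly one solution, found index by index. The action of
  \<open>Fix F\<close> on hom-objects, its functoriality, and the isomorphism with any other solution are all
  instances of this one principle. On objects, the iterates of \<open>F\<close> starting from the terminal object
  stabilise at every index, and \<open>Fix F\<close> is read off on the diagonal. For local contractiveness in a
  further variable the principle is applied once more, to \<open>F\<close> regarded as a functor on the category
  in which that variable is delayed; there \<open>F\<close> is still contractive in the last variable, since the
  two delays can be applied one after the other.\<close>

text \<open>The unknowns are elements over a point \<open>i\<close>, not morphisms: the recursion
  must stop at a finite index, while a morphism has content at all of them. The laws of the action
  are required only at arguments that come from undelayed elements, because a solution is always fed
  back through \<open>next_tree\<close>. This weakening decides local contractiveness in a further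
  variable \<open>k\<close>. The hypotheses give two factorizations of \<open>F\<close>, each with
  one variable delayed, but no joint one. An action on elements delayed in both can be composed from
  them, yet nothing makes it functorial; where its last argument comes from an undelayed element,
  however, it agrees with one of the two factorizations and inherits the laws of that one. For
  uniqueness the index objects are doubled, one copy for each solution. The comparison is then the
  value of the action at an identity between the two copies of a tuple, and both its invertibility
  and its naturality are functoriality. This works for a solution without strength as well, because
  the strength of \<open>F\<close> expresses everything through names of morphisms.\<close>

lemma rst_self [simp]: "rst X m m x = x"
  by (cases m) auto

lemma rst_Suc [simp]: "m \<le> n \<Longrightarrow> rst X m (Suc n) x = rst X m n (res X n x)"
  by simp

text \<open>The defining equation would turn every \<open>rst\<close> at a successor into a
  conditional; \<open>rst_Suc\<close> replaces it where the order of the indices is known.\<close>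

declare rst.simps(2) [simp del]

lemma tree_res_in: "is_tree X \<Longrightarrow> x \<in> car X (Suc m) \<Longrightarrow> res X m x \<in> car X m"
  by (auto simp: is_tree_def)

lemma rst_in: "is_tree X \<Longrightarrow> x \<in> car X n \<Longrightarrow> m \<le> n \<Longrightarrow> rst X m n x \<in> car X m"
proof (induction n arbitrary: x)
  case (Suc n)
  then show ?case
    by (cases "m = Suc n") (auto simp: tree_res_in)
qed auto

lemma res_rst: "m < n \<Longrightarrow> res X m (rst X (Suc m) n x) = rst X m n x"
proof (induction n arbitrary: x)
  case (Suc n)
  then show ?case
    by (cases "m = n") auto
qed auto

section \<open>Objects and morphisms over \<open>I\<close>, fibre by fibre\<close>

lemma is_sliceD:
  assumes "is_slice I Y"
  shows "is_tree Y" "x \<in> car Y m \<Longrightarrow> prj Y m x \<in> car I m"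
    "x \<in> car Y (Suc m) \<Longrightarrow> prj Y m (res Y m x) = res I m (prj Y (Suc m) x)"
  using assms by (auto simp: is_slice_def tree_hom_def)

lemma fibre_res:
  "is_slice I Y \<Longrightarrow> x \<in> fibre Y (Suc m) i \<Longrightarrow> res Y m x \<in> fibre Y m (res I m i)"
  by (auto simp: fibre_def is_sliceD tree_res_in)

lemma fibre_base: "is_slice I Y \<Longrightarrow> x \<in> fibre Y m i \<Longrightarrow> i \<in> car I m"
  by (auto simp: fibre_def is_sliceD)

lemma slice_hom_fibre: "f \<in> slice_hom X Y \<Longrightarrow> x \<in> fibre X m i \<Longrightarrow> f m x \<in> fibre Y m i"
  by (auto simp: slice_hom_def tree_hom_def fibre_def)

lemma slice_hom_res:
  "f \<in> slice_hom X Y \<Longrightarrow> x \<in> car X (Suc m) \<Longrightarrow> f m (res X m x) = res Y m (f (Suc m) x)"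
  by (auto simp: slice_hom_def tree_hom_def)

section \<open>Elements of exponentials\<close>

text \<open>Membership in a fibre, rather than in a carrier, is the working form throughout: the
  base point \<open>i\<close> becomes an explicit parameter, and two elements over the same
  \<open>i\<close> form an element of the fibre product without a side condition.\<close>

lemma exp_fibre:
  "z \<in> fibre (exp_slice I X Y) m i \<longleftrightarrow> i \<in> car I m \<and> fst z = i \<and>
     snd z \<in> (\<Pi>\<^sub>E k\<in>{..m}. fibre X k (rst I k m i) \<rightarrow>\<^sub>E fibre Y k (rst I k m i)) \<and>
     (\<forall>k<m. \<forall>x\<in>fibre X (Suc k) (rst I (Suc k) m i).
        snd z k (res X k x) = res Y k (snd z (Suc k) x))"
  by (cases z) (auto simp: fibre_def exp_slice_def)

lemma exp_base: "z \<in> fibre (exp_slice I A B) m i \<Longrightarrow> i \<in> car I m"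
  by (simp add: exp_fibre)

text \<open>Restriction only forgets the top component. The components that stay lie over the right
  points because \<open>rst\<close> from \<open>Suc m\<close> factors through
  \<open>res I m\<close>.\<close>

lemma exp_slice_is_slice:
  assumes "is_tree I"
  shows "is_slice I (exp_slice I X Y)"
proof -
  have R: "res (exp_slice I X Y) m z \<in> car (exp_slice I X Y) m"
    if "z \<in> car (exp_slice I X Y) (Suc m)" for m z
  proof -
    obtain i f where z: "z = (i, f)" by (cases z)
    have "i \<in> car I (Suc m)"
      and F: "f \<in> (\<Pi>\<^sub>E k\<in>{..Suc m}. fibre X k (rst I k (Suc m) i) \<rightarrow>\<^sub>E fibre Y k (rst I k (Suc m) i))"
      and C: "\<forall>k<Suc m. \<forall>x\<in>fibre X (Suc k) (rst I (Suc k) (Suc m) i).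
                 f k (res X k x) = res Y k (f (Suc k) x)"
      using that by (auto simp: z exp_slice_def Let_def)
    have "f k \<in> fibre X k (rst I k m (res I m i)) \<rightarrow>\<^sub>E fibre Y k (rst I k m (res I m i))"
      if "k \<le> m" for k
      using PiE_mem[OF F, of k] that by simp
    moreover have "f k (res X k x) = res Y k (f (Suc k) x)"
      if "k < m" "x \<in> fibre X (Suc k) (rst I (Suc k) m (res I m i))" for k x
      using C that by simp
    ultimately show ?thesis
      using that tree_res_in[OF assms \<open>i \<in> car I (Suc m)\<close>]
      by (auto simp: z exp_slice_def Let_def)
  qed
  have "res (exp_slice I X Y) m \<in> extensional (car (exp_slice I X Y) (Suc m))" for m
    by (simp add: exp_slice_def Let_def)
  moreover have "prj (exp_slice I X Y) m \<in> extensional (car (exp_slice I X Y) m)" for m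
    by (simp add: exp_slice_def Let_def)
  moreover have "prj (exp_slice I X Y) m z \<in> car I m" if "z \<in> car (exp_slice I X Y) m" for m z
    using that by (auto simp: exp_slice_def Let_def)
  moreover have "prj (exp_slice I X Y) m (res (exp_slice I X Y) m z)
      = res I m (prj (exp_slice I X Y) (Suc m) z)"
    if "z \<in> car (exp_slice I X Y) (Suc m)" for m z
    using that R[OF that] by (auto simp: exp_slice_def Let_def)
  ultimately show ?thesis
    using R by (auto simp: is_slice_def is_tree_def tree_hom_def PiE_iff)
qed

lemma exp_ap:
  "z \<in> fibre (exp_slice I X Y) m i \<Longrightarrow> k \<le> m \<Longrightarrow> x \<in> fibre X k (rst I k m i)
   \<Longrightarrow> snd z k x \<in> fibre Y k (rst I k m i)"
  by (auto simp: exp_fibre PiE_iff)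

lemma exp_comm:
  "z \<in> fibre (exp_slice I X Y) m i \<Longrightarrow> k < m \<Longrightarrow> x \<in> fibre X (Suc k) (rst I (Suc k) m i)
   \<Longrightarrow> snd z k (res X k x) = res Y k (snd z (Suc k) x)"
  by (auto simp: exp_fibre)

text \<open>Elements are extensional both in the index and in the argument, so equations between
  them can be checked on points. The laws of composition below come down to this.\<close>

lemma exp_ext:
  assumes "z \<in> fibre (exp_slice I X Y) m i" "w \<in> fibre (exp_slice I X Y) m i"
    and "\<And>k x. k \<le> m \<Longrightarrow> x \<in> fibre X k (rst I k m i) \<Longrightarrow> snd z k x = snd w k x"
  shows "z = w"
proof -
  have "snd z = snd w"
  proof (rule PiE_ext[where k="{..m}" and s="\<lambda>k. fibre X k (rst I k m i) \<rightarrow>\<^sub>E fibre Y k (rst I k m i)"])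
    show "snd z k = snd w k" if "k \<in> {..m}" for k
      by (rule PiE_ext[where k="fibre X k (rst I k m i)" and s="\<lambda>_. fibre Y k (rst I k m i)"])
        (use that assms in \<open>auto simp: exp_fibre\<close>)
  qed (use assms in \<open>auto simp: exp_fibre\<close>)
  then show ?thesis
    using assms by (auto simp: exp_fibre prod_eq_iff)
qed

text \<open>The two restrictions supply extensionality, so \<open>f\<close> may be any function. The
  fibre condition on \<open>res X k x\<close> is part of the last premise because it makes the
  restricted function agree with \<open>f\<close> at that point.\<close>

lemma expI:
  assumes "is_tree I" "i \<in> car I m"
    and "\<And>k x. k \<le> m \<Longrightarrow> x \<in> fibre X k (rst I k m i) \<Longrightarrow> f k x \<in> fibre Y k (rst I k m i)"
    and "\<And>k x. k < m \<Longrightarrow> x \<in> fibre X (Suc k) (rst I (Suc k) m i)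
      \<Longrightarrow> res X k x \<in> fibre X k (rst I k m i) \<and> f k (res X k x) = res Y k (f (Suc k) x)"
  shows "(i, \<lambda>k\<in>{..m}. \<lambda>x\<in>fibre X k (rst I k m i). f k x) \<in> fibre (exp_slice I X Y) m i"
  using assms by (auto simp: exp_fibre)

lemma fibre_res_rst:
  assumes "is_slice I X" "k < m" "x \<in> fibre X (Suc k) (rst I (Suc k) m i)"
  shows "res X k x \<in> fibre X k (rst I k m i)"
  using fibre_res[OF assms(1,3)] assms(2) by (simp add: res_rst)

lemma exp_res_snd:
  "z \<in> fibre (exp_slice I X Y) (Suc m) i \<Longrightarrow> k \<le> m \<Longrightarrow> snd (res (exp_slice I X Y) m z) k = snd z k"
  by (cases z) (auto simp: fibre_def exp_slice_def Let_def)

lemma exp_res_in: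
  "is_tree I \<Longrightarrow> z \<in> fibre (exp_slice I X Y) (Suc m) i
    \<Longrightarrow> res (exp_slice I X Y) m z \<in> fibre (exp_slice I X Y) m (res I m i)"
  by (rule fibre_res[OF exp_slice_is_slice])

lemma exp_comp_eq:
  assumes "g \<in> fibre (exp_slice I Y Z) m i" "f \<in> fibre (exp_slice I X Y) m i"
  shows "exp_comp I X Y Z m (g, f) =
    (i, \<lambda>k\<in>{..m}. \<lambda>x\<in>fibre X k (rst I k m i). snd g k (snd f k x))"
  using assms by (cases g; cases f)
    (auto simp: exp_comp_def prod_slice_def fibre_def exp_slice_def Let_def)

lemma exp_comp_in:
  assumes "is_tree I" "is_slice I X"
    and "g \<in> fibre (exp_slice I Y Z) m i" "f \<in> fibre (exp_slice I X Y) m i"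
  shows "exp_comp I X Y Z m (g, f) \<in> fibre (exp_slice I X Z) m i"
  unfolding exp_comp_eq[OF assms(3,4)]
proof (rule expI)
  show "i \<in> car I m" using assms(3) by (simp add: exp_fibre)
  show "snd g k (snd f k x) \<in> fibre Z k (rst I k m i)" if "k \<le> m" "x \<in> fibre X k (rst I k m i)" for k x
    using that by (intro exp_ap[OF assms(3)] exp_ap[OF assms(4)])
  show "res X k x \<in> fibre X k (rst I k m i) \<and>
       snd g k (snd f k (res X k x)) = res Z k (snd g (Suc k) (snd f (Suc k) x))"
    if "k < m" "x \<in> fibre X (Suc k) (rst I (Suc k) m i)" for k x
    using that fibre_res_rst[OF assms(2)] exp_comm[OF assms(4) that]
      exp_comm[OF assms(3) that(1) exp_ap[OF assms(4) _ that(2)]] by auto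
qed fact

lemma exp_comp_snd:
  assumes "g \<in> fibre (exp_slice I Y Z) m i" "f \<in> fibre (exp_slice I X Y) m i"
    and "k \<le> m" "x \<in> fibre X k (rst I k m i)"
  shows "snd (exp_comp I X Y Z m (g, f)) k x = snd g k (snd f k x)"
  using assms by (simp add: exp_comp_eq)

lemma exp_comp_res:
  assumes "is_tree I" "is_slice I X"
    and "g \<in> fibre (exp_slice I Y Z) (Suc m) i" "f \<in> fibre (exp_slice I X Y) (Suc m) i"
  shows "res (exp_slice I X Z) m (exp_comp I X Y Z (Suc m) (g, f)) =
    exp_comp I X Y Z m (res (exp_slice I Y Z) m g, res (exp_slice I X Y) m f)"
proof (rule exp_ext)
  note R = exp_res_in[OF assms(1)]
  note C = exp_comp_in[OF assms(1,2)]
  show "res (exp_slice I X Z) m (exp_comp I X Y Z (Suc m) (g, f)) \<in> fibre (exp_slice I X Z) m (res I m i)"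
    by (intro R C assms)
  show "exp_comp I X Y Z m (res (exp_slice I Y Z) m g, res (exp_slice I X Y) m f)
      \<in> fibre (exp_slice I X Z) m (res I m i)"
    by (intro R C assms)
  fix k x assume "k \<le> m" "x \<in> fibre X k (rst I k m (res I m i))"
  then show "snd (res (exp_slice I X Z) m (exp_comp I X Y Z (Suc m) (g, f))) k x =
      snd (exp_comp I X Y Z m (res (exp_slice I Y Z) m g, res (exp_slice I X Y) m f)) k x"
    using exp_comp_snd[OF R[OF assms(3)] R[OF assms(4)]] exp_comp_snd[OF assms(3,4)]
    by (simp add: exp_res_snd[OF C[OF assms(3,4)]] exp_res_snd[OF assms(3)] exp_res_snd[OF assms(4)])
qed

lemma exp_comp_assoc:
  assumes "is_tree I" "is_slice I X" "is_slice I Y"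
    and "h \<in> fibre (exp_slice I Z W) m i" "g \<in> fibre (exp_slice I Y Z) m i"
    and "f \<in> fibre (exp_slice I X Y) m i"
  shows "exp_comp I X Z W m (h, exp_comp I X Y Z m (g, f)) =
    exp_comp I X Y W m (exp_comp I Y Z W m (h, g), f)"
proof -
  note C = exp_comp_in[OF assms(1,2)] exp_comp_in[OF assms(1,3)]
  show ?thesis
    by (rule exp_ext[of _ I X W m i]; (intro C assms)?)
      (use assms in \<open>auto simp: exp_comp_snd[of _ I _ _ m i] C exp_ap\<close>)
qed

section \<open>Names\<close>

lemma exp_name_in:
  assumes "is_tree I" "is_slice I X" "f \<in> slice_hom X Y" "i \<in> car I m"
  shows "exp_name I X f m i \<in> fibre (exp_slice I X Y) m i"
proof -
  have "(i, \<lambda>k\<in>{..m}. \<lambda>x\<in>fibre X k (rst I k m i). f k x) \<in> fibre (exp_slice I X Y) m i"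
    by (rule expI[OF assms(1,4)])
      (auto intro!: slice_hom_fibre[OF assms(3)] fibre_res_rst[OF assms(2)] slice_hom_res[OF assms(3)],
       auto simp: fibre_def)
  then show ?thesis
    using assms(4) by (simp add: exp_name_def)
qed

lemma exp_name_snd:
  "i \<in> car I m \<Longrightarrow> k \<le> m \<Longrightarrow> x \<in> fibre X k (rst I k m i) \<Longrightarrow> snd (exp_name I X f m i) k x = f k x"
  by (simp add: exp_name_def)

lemma exp_name_res:
  assumes "is_tree I" "is_slice I X" "f \<in> slice_hom X Y" "i \<in> car I (Suc m)"
  shows "res (exp_slice I X Y) m (exp_name I X f (Suc m) i) = exp_name I X f m (res I m i)"
  using assms
  by (intro exp_ext[of _ I X Y m "res I m i"])
    (auto simp: exp_res_in exp_name_in exp_name_snd tree_res_in exp_res_snd[OF exp_name_in])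

text \<open>Composition and identities of \<open>slice_cat\<close> without reference to a universe,
  for slices over any types.\<close>

definition hcomp :: "('a, 'i) slice \<Rightarrow> (nat \<Rightarrow> 'b \<Rightarrow> 'c) \<Rightarrow> (nat \<Rightarrow> 'a \<Rightarrow> 'b) \<Rightarrow> nat \<Rightarrow> 'a \<Rightarrow> 'c" where
  "hcomp X g f = (\<lambda>n. \<lambda>x\<in>car X n. g n (f n x))"

definition hid :: "('a, 'i) slice \<Rightarrow> nat \<Rightarrow> 'a \<Rightarrow> 'a" where
  "hid X = (\<lambda>n. \<lambda>x\<in>car X n. x)"

lemma hid_in: "is_slice I X \<Longrightarrow> hid X \<in> slice_hom X X"
  by (auto simp: hid_def slice_hom_def tree_hom_def is_sliceD tree_res_in)

lemma hcomp_in: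
  assumes "is_slice I X" "f \<in> slice_hom X Y" "g \<in> slice_hom Y Z"
  shows "hcomp X g f \<in> slice_hom X Z"
proof -
  have "g m (f m x) \<in> car Z m" "f m x \<in> car Y m" if "x \<in> car X m" for m x
    using assms that by (auto simp: slice_hom_def tree_hom_def PiE_iff)
  with assms show ?thesis
    by (auto simp: hcomp_def slice_hom_def tree_hom_def is_sliceD tree_res_in)
qed

abbreviation eid :: "'i tree \<Rightarrow> ('a, 'i) slice \<Rightarrow> nat \<Rightarrow> 'i \<Rightarrow> ('a, 'a, 'i) expel" where
  "eid I X \<equiv> exp_name I X (hid X)"

lemma eid_in: "is_tree I \<Longrightarrow> is_slice I X \<Longrightarrow> i \<in> car I m \<Longrightarrow> eid I X m i \<in> fibre (exp_slice I X X) m i"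
  by (intro exp_name_in hid_in)

lemma eid_res:
  "is_tree I \<Longrightarrow> is_slice I X \<Longrightarrow> i \<in> car I (Suc m) \<Longrightarrow>
    res (exp_slice I X X) m (eid I X (Suc m) i) = eid I X m (res I m i)"
  by (intro exp_name_res hid_in)

lemma exp_comp_id:
  assumes "is_tree I" "is_slice I X" "is_slice I Y" "f \<in> fibre (exp_slice I X Y) m i"
  shows "exp_comp I X Y Y m (eid I Y m i, f) = f" "exp_comp I X X Y m (f, eid I X m i) = f"
proof -
  have i: "i \<in> car I m" using assms(4) by (simp add: exp_fibre)
  note E = eid_in[OF assms(1,2) i] eid_in[OF assms(1,3) i]
  have H: "hid Y k y = y" if "y \<in> fibre Y k j" for Y :: "('e, 'd) slice" and k y j
    using that by (simp add: hid_def fibre_def)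
  show "exp_comp I X Y Y m (eid I Y m i, f) = f"
    by (rule exp_ext[of _ I X Y m i])
      (use assms E i in \<open>auto simp: exp_comp_in exp_comp_snd[of _ I _ _ m i] exp_name_snd
        exp_ap H[OF exp_ap[OF assms(4)]]\<close>)
  show "exp_comp I X X Y m (f, eid I X m i) = f"
    by (rule exp_ext[of _ I X Y m i])
      (use assms E i in \<open>auto simp: exp_comp_in exp_comp_snd[of _ I _ _ m i] exp_name_snd H\<close>)
qed

lemma exp_name_comp:
  assumes "is_tree I" "is_slice I X" "is_slice I Y" "f \<in> slice_hom X Y" "g \<in> slice_hom Y Z" "i \<in> car I m"
  shows "exp_name I X (hcomp X g f) m i =
    exp_comp I X Y Z m (exp_name I Y g m i, exp_name I X f m i)"
proof -
  note N = exp_name_in[OF assms(1,2,4,6)] exp_name_in[OF assms(1,3,5,6)]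
    exp_name_in[OF assms(1,2) hcomp_in[OF assms(2,4,5)] assms(6)]
  show ?thesis
    by (rule exp_ext[of _ I X Z m i]; (intro exp_comp_in N assms)?)
      (use assms(6) in \<open>auto simp: exp_comp_snd[OF N(2,1)] exp_name_snd hcomp_def
        slice_hom_fibre[OF assms(4)]; auto simp: fibre_def\<close>)
qed

text \<open>The name over the point \<open>prj X m x\<close> has the value \<open>f m x\<close> at
  its top index, so a morphism is determined by its names. Laws for ordinary morphisms are reduced
  to laws for elements in this way.\<close>

lemma exp_name_inj:
  assumes "is_slice I X" "f \<in> slice_hom X Y" "g \<in> slice_hom X Y"
    and "\<And>m i. i \<in> car I m \<Longrightarrow> exp_name I X f m i = exp_name I X g m i"
  shows "f = g"
proof (rule ext)
  fix m
  have "f m x = g m x" if "x \<in> car X m" for x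
  proof -
    have i: "prj X m x \<in> car I m" using that assms(1) by (simp add: is_sliceD)
    show ?thesis
      using assms(4)[OF i] exp_name_snd[OF i, of m x X f] exp_name_snd[OF i, of m x X g] that
      by (simp add: fibre_def)
  qed
  then show "f m = g m"
    using assms(2,3) by (intro PiE_ext[of _ "car X m" "\<lambda>_. car Y m"]) (auto simp: slice_hom_def
        tree_hom_def)
qed

section \<open>Compatible families of elements are morphisms\<close>

text \<open>A global element of the exponential, that is, a morphism to it from the terminal object
  \<open>id : I \<rightarrow> I\<close>, with values outside \<open>I\<close> left open. Morphisms
  correspond to such families by \<open>exp_name\<close> in one direction and \<open>mor_of\<close>
  in the other.\<close>

definition compatible :: "'i tree \<Rightarrow> ('a, 'i) slice \<Rightarrow> ('b, 'i) slice
    \<Rightarrow> (nat \<Rightarrow> 'i \<Rightarrow> ('a, 'b, 'i) expel) \<Rightarrow> bool" where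
  "compatible I X Y a \<longleftrightarrow> (\<forall>m. \<forall>i\<in>car I m. a m i \<in> fibre (exp_slice I X Y) m i) \<and>
     (\<forall>m. \<forall>i\<in>car I (Suc m). res (exp_slice I X Y) m (a (Suc m) i) = a m (res I m i))"

definition mor_of :: "('a, 'i) slice \<Rightarrow> (nat \<Rightarrow> 'i \<Rightarrow> ('a, 'b, 'i) expel) \<Rightarrow> nat \<Rightarrow> 'a \<Rightarrow> 'b" where
  "mor_of X a = (\<lambda>m. \<lambda>x\<in>car X m. snd (a m (prj X m x)) m x)"

lemma compatible_name:
  "is_tree I \<Longrightarrow> is_slice I X \<Longrightarrow> f \<in> slice_hom X Y \<Longrightarrow> compatible I X Y (exp_name I X f)"
  by (simp add: compatible_def exp_name_in exp_name_res)

text \<open>Each step down from \<open>m\<close> to \<open>k\<close> is a restriction of elements,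
  which leaves component \<open>l\<close> as it is.\<close>

lemma compatible_rst:
  assumes "is_tree I" "compatible I X Y a" "k \<le> m" "i \<in> car I m" "l \<le> k"
  shows "snd (a k (rst I k m i)) l = snd (a m i) l"
  using assms(3,4)
proof (induction m arbitrary: i)
  case (Suc m)
  have a: "a (Suc m) i \<in> fibre (exp_slice I X Y) (Suc m) i" "res (exp_slice I X Y) m (a (Suc m) i) = a
      m (res I m i)"
    using assms(2) Suc by (auto simp: compatible_def)
  show ?case
  proof (cases "k = Suc m")
    case False
    then have "snd (a k (rst I k (Suc m) i)) l = snd (a m (res I m i)) l"
      using Suc tree_res_in[OF assms(1)] by auto
    also have "\<dots> = snd (a (Suc m) i) l"
      using exp_res_snd[OF a(1), of l] a(2) Suc False assms(5) by simp
    finally show ?thesis .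
  qed simp
qed auto

lemma mor_of:
  assumes "is_tree I" "is_slice I X" "compatible I X Y a"
  shows "mor_of X a \<in> slice_hom X Y"
    and "i \<in> car I m \<Longrightarrow> exp_name I X (mor_of X a) m i = a m i"
proof -
  have A: "a m i \<in> fibre (exp_slice I X Y) m i" if "i \<in> car I m" for m i
    using assms(3) that by (simp add: compatible_def)
  have in': "snd (a m (prj X m x)) m x \<in> fibre Y m (prj X m x)" if "x \<in> car X m" for m x
    using exp_ap[OF A[OF is_sliceD(2)[OF assms(2) that]], of m x] that by (simp add: fibre_def)
  have rs: "snd (a m (prj X m (res X m x))) m (res X m x) = res Y m (snd (a (Suc m) (prj X (Suc m) x))
      (Suc m) x)"
    if x: "x \<in> car X (Suc m)" for m x
  proof -
    define i where "i = prj X (Suc m) x"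
    have i: "i \<in> car I (Suc m)" "prj X m (res X m x) = res I m i" and xf: "x \<in> fibre X (Suc m) i"
      using x assms(2) by (auto simp: i_def is_sliceD fibre_def)
    \<comment> \<open>The two elements have different base points, but the lower one is the
      restriction of the upper one and shares its component \<open>m\<close>. Commutation with
      restriction inside the upper element then gives the claim.\<close>
    have "snd (a m (res I m i)) m = snd (a (Suc m) i) m"
      using compatible_rst[OF assms(1,3), of m "Suc m" i m] i by simp
    then show ?thesis
      using exp_comm[OF A[OF i(1)], of m x] xf i by (simp flip: i_def)
  qed
  show H: "mor_of X a \<in> slice_hom X Y"
    using in' rs by (auto simp: mor_of_def slice_hom_def tree_hom_def fibre_def is_sliceD[OF assms(2)]
        tree_res_in)
  show "exp_name I X (mor_of X a) m i = a m i" if i: "i \<in> car I m"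
  proof (rule exp_ext[OF exp_name_in[OF assms(1,2) H i] A[OF i]])
    fix k x assume k: "k \<le> m" "x \<in> fibre X k (rst I k m i)"
    then have "mor_of X a k x = snd (a k (rst I k m i)) k x"
      by (auto simp: mor_of_def fibre_def)
    then show "snd (exp_name I X (mor_of X a) m i) k x = snd (a m i) k x"
      using k i compatible_rst[OF assms(1,3), of k m i k] by (simp add: exp_name_snd)
  qed
qed

section \<open>Fibre products over \<open>I\<close> and the map \<open>next\<close>\<close>

lemma fibre_prod:
  "z \<in> fibre (prod_slice A B) m i \<longleftrightarrow> fst z \<in> fibre A m i \<and> snd z \<in> fibre B m i"
  by (cases z) (auto simp: fibre_def prod_slice_def)

lemma car_prod:
  "z \<in> car (prod_slice A B) m \<longleftrightarrow> fst z \<in> car A m \<and> snd z \<in> car B m \<and> prj A m (fst z) = prj B m (snd z)"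
  by (cases z) (auto simp: prod_slice_def)

lemma res_prod:
  "z \<in> car (prod_slice A B) (Suc m) \<Longrightarrow> res (prod_slice A B) m z = (res A m (fst z), res B m (snd z))"
  by (cases z) (auto simp: prod_slice_def)

lemma res_prod_fibre:
  "z \<in> fibre (prod_slice A B) (Suc m) i \<Longrightarrow> res (prod_slice A B) m z = (res A m (fst z), res B m (snd z))"
  by (rule res_prod) (simp add: fibre_def)

lemma is_sliceI:
  assumes "\<And>m. res Y m \<in> extensional (car Y (Suc m))" "\<And>m. prj Y m \<in> extensional (car Y m)"
    and "\<And>m x. x \<in> car Y m \<Longrightarrow> prj Y m x \<in> car I m"
    and "\<And>m x. x \<in> car Y (Suc m) \<Longrightarrow> res Y m x \<in> fibre Y m (res I m (prj Y (Suc m) x))"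
  shows "is_slice I Y"
  using assms by (auto simp: is_slice_def is_tree_def tree_hom_def PiE_iff fibre_def)

lemma prod_slice_is_slice:
  assumes "is_slice I A" "is_slice I B"
  shows "is_slice I (prod_slice A B)"
proof (rule is_sliceI)
  show "res (prod_slice A B) m \<in> extensional (car (prod_slice A B) (Suc m))"
       "prj (prod_slice A B) m \<in> extensional (car (prod_slice A B) m)" for m
    by (auto simp: prod_slice_def Let_def extensional_def)
  show "prj (prod_slice A B) m z \<in> car I m" if "z \<in> car (prod_slice A B) m" for m z
    using that assms by (auto simp: prod_slice_def Let_def is_sliceD)
  show "res (prod_slice A B) m z \<in> fibre (prod_slice A B) m (res I m (prj (prod_slice A B) (Suc m) z))"
    if z: "z \<in> car (prod_slice A B) (Suc m)" for m z
  proof -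
    have "prj (prod_slice A B) (Suc m) z = prj A (Suc m) (fst z)"
      using z by (auto simp: prod_slice_def Let_def)
    then show ?thesis
      using z fibre_res[OF assms(1)] fibre_res[OF assms(2)]
      by (simp add: fibre_prod res_prod) (auto simp: car_prod fibre_def)
  qed
qed

lemma next_tree_eq:
  assumes "P \<in> fibre Y m i"
  shows "next_tree Y m P = (case m of 0 \<Rightarrow> None | Suc k \<Rightarrow> Some (res Y k P))"
  using assms by (simp add: next_tree_def fibre_def)

section \<open>Fixed points of contractive actions on hom-objects\<close>

text \<open>\<open>KO p\<close> stands for \<open>F(p, X(s p), X p)\<close> and \<open>KP\<close> for the action of \<open>F\<close> on hom-objects. The last
  argument of \<open>KP\<close> is the second component of an element of \<open>later_slice I (PP p q)\<close>; hence it is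
  \<open>None\<close> at index 0, and an element of \<open>PP p q\<close> at index \<open>m\<close> if \<open>KP\<close> is taken at index \<open>m + 1\<close>.\<close>

locale contractive_system =
  fixes I :: "'i tree" and Obs :: "'o set" and DH :: "'o \<Rightarrow> 'o \<Rightarrow> ('h, 'i) slice"
    and DC :: "'o \<Rightarrow> 'o \<Rightarrow> 'o \<Rightarrow> nat \<Rightarrow> 'h \<times> 'h \<Rightarrow> 'h" and DI :: "'o \<Rightarrow> nat \<Rightarrow> 'i \<Rightarrow> 'h"
    and s :: "'o \<Rightarrow> 'o" and \<sigma> :: "'h \<Rightarrow> 'h"
    and X :: "'o \<Rightarrow> ('a, 'i) slice" and KO :: "'o \<Rightarrow> ('b, 'i) slice"
    and KP :: "'o \<Rightarrow> 'o \<Rightarrow> nat \<Rightarrow> 'h \<Rightarrow> (('a, 'a, 'i) expel \<times> ('a, 'a, 'i) expel) option \<Rightarrow> ('b, 'b, 'i) expel"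
    and a :: "'o \<Rightarrow> nat \<Rightarrow> 'i \<Rightarrow> ('b, 'a, 'i) expel" and a' :: "'o \<Rightarrow> nat \<Rightarrow> 'i \<Rightarrow> ('a, 'b, 'i) expel"
    and PP :: "'o \<Rightarrow> 'o \<Rightarrow> (('a, 'a, 'i) expel \<times> ('a, 'a, 'i) expel, 'i) slice"
  defines "PP \<equiv> \<lambda>p q. prod_slice (exp_slice I (X (s q)) (X (s p))) (exp_slice I (X p) (X q))"
  assumes I: "is_tree I"
    and s: "p \<in> Obs \<Longrightarrow> s p \<in> Obs" "p \<in> Obs \<Longrightarrow> s (s p) = p"
    and X: "p \<in> Obs \<Longrightarrow> is_slice I (X p)"
    and KO: "p \<in> Obs \<Longrightarrow> is_slice I (KO p)"
    and a: "p \<in> Obs \<Longrightarrow> compatible I (KO p) (X p) (a p)"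
    and a': "p \<in> Obs \<Longrightarrow> compatible I (X p) (KO p) (a' p)"
    and aa': "p \<in> Obs \<Longrightarrow> i \<in> car I m \<Longrightarrow>
      exp_comp I (X p) (KO p) (X p) m (a p m i, a' p m i) = eid I (X p) m i"
    and a'a: "p \<in> Obs \<Longrightarrow> i \<in> car I m \<Longrightarrow>
      exp_comp I (KO p) (X p) (KO p) m (a' p m i, a p m i) = eid I (KO p) m i"
    and DH: "p \<in> Obs \<Longrightarrow> q \<in> Obs \<Longrightarrow> is_slice I (DH p q)"
    and DC: "p \<in> Obs \<Longrightarrow> q \<in> Obs \<Longrightarrow> r \<in> Obs \<Longrightarrow> g \<in> fibre (DH q r) m i \<Longrightarrow> f \<in> fibre (DH p q) m i
      \<Longrightarrow> DC p q r m (g, f) \<in> fibre (DH p r) m i"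
    and DI: "p \<in> Obs \<Longrightarrow> i \<in> car I m \<Longrightarrow> DI p m i \<in> fibre (DH p p) m i"
    and \<sigma>: "p \<in> Obs \<Longrightarrow> q \<in> Obs \<Longrightarrow> h \<in> fibre (DH p q) m i \<Longrightarrow> \<sigma> h \<in> fibre (DH (s q) (s p)) m i"
    and \<sigma>\<sigma>: "p \<in> Obs \<Longrightarrow> q \<in> Obs \<Longrightarrow> h \<in> fibre (DH p q) m i \<Longrightarrow> \<sigma> (\<sigma> h) = h"
    and \<sigma>_res: "p \<in> Obs \<Longrightarrow> q \<in> Obs \<Longrightarrow> h \<in> fibre (DH p q) (Suc m) i \<Longrightarrow>
      res (DH (s q) (s p)) m (\<sigma> h) = \<sigma> (res (DH p q) m h)"
    and \<sigma>_comp: "p \<in> Obs \<Longrightarrow> q \<in> Obs \<Longrightarrow> r \<in> Obs \<Longrightarrow> g \<in> fibre (DH q r) m i \<Longrightarrow> f \<in> fibre (DH p q) m i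
      \<Longrightarrow> \<sigma> (DC p q r m (g, f)) = DC (s r) (s q) (s p) m (\<sigma> f, \<sigma> g)"
    and \<sigma>_id: "p \<in> Obs \<Longrightarrow> i \<in> car I m \<Longrightarrow> \<sigma> (DI p m i) = DI (s p) m i"
    and KP_None: "p \<in> Obs \<Longrightarrow> q \<in> Obs \<Longrightarrow> h \<in> fibre (DH p q) 0 i \<Longrightarrow>
      KP p q 0 h None \<in> fibre (exp_slice I (KO p) (KO q)) 0 i"
    and KP_Some: "p \<in> Obs \<Longrightarrow> q \<in> Obs \<Longrightarrow> h \<in> fibre (DH p q) (Suc m) i \<Longrightarrow> P \<in> fibre (PP p q) m (res I m i)
      \<Longrightarrow> KP p q (Suc m) h (Some P) \<in> fibre (exp_slice I (KO p) (KO q)) (Suc m) i"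
    and KP_res: "p \<in> Obs \<Longrightarrow> q \<in> Obs \<Longrightarrow> h \<in> fibre (DH p q) (Suc m) i \<Longrightarrow> P \<in> fibre (PP p q) m (res I m i)
      \<Longrightarrow> res (exp_slice I (KO p) (KO q)) m (KP p q (Suc m) h (Some P)) =
          KP p q m (res (DH p q) m h) (next_tree (PP p q) m P)"
    and KP_comp: "p \<in> Obs \<Longrightarrow> q \<in> Obs \<Longrightarrow> r \<in> Obs \<Longrightarrow> g \<in> fibre (DH q r) m i \<Longrightarrow> f \<in> fibre (DH p q) m i
      \<Longrightarrow> (g2, g1) \<in> fibre (PP q r) m i \<Longrightarrow> (f2, f1) \<in> fibre (PP p q) m i
      \<Longrightarrow> KP p r m (DC p q r m (g, f)) (next_tree (PP p r) m
            (exp_comp I (X (s r)) (X (s q)) (X (s p)) m (f2, g2), exp_comp I (X p) (X q) (X r) m (g1,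
                f1))) =
          exp_comp I (KO p) (KO q) (KO r) m
            (KP q r m g (next_tree (PP q r) m (g2, g1)), KP p q m f (next_tree (PP p q) m (f2, f1)))"
    and KP_id: "p \<in> Obs \<Longrightarrow> i \<in> car I m \<Longrightarrow>
      KP p p m (DI p m i) (next_tree (PP p p) m (eid I (X (s p)) m i, eid I (X p) m i)) = eid I (KO p)
          m i"
begin

text \<open>Conjugation by the isomorphisms, \<open>a q\<close> after \<open>z\<close> after
  \<open>a' p\<close>: it carries the values of \<open>KP\<close>, which act between the objects
  \<open>KO\<close>, over to the objects \<open>X\<close>, where the unknown lives.\<close>

definition cj :: "'o \<Rightarrow> 'o \<Rightarrow> nat \<Rightarrow> 'i \<Rightarrow> ('b, 'b, 'i) expel \<Rightarrow> ('a, 'a, 'i) expel" where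
  "cj p q m i z = exp_comp I (X p) (KO q) (X q) m
     (a q m i, exp_comp I (X p) (KO p) (KO q) m (z, a' p m i))"

lemma a_in: "p \<in> Obs \<Longrightarrow> i \<in> car I m \<Longrightarrow> a p m i \<in> fibre (exp_slice I (KO p) (X p)) m i"
  and a'_in: "p \<in> Obs \<Longrightarrow> i \<in> car I m \<Longrightarrow> a' p m i \<in> fibre (exp_slice I (X p) (KO p)) m i"
  and a_res: "p \<in> Obs \<Longrightarrow> i \<in> car I (Suc m) \<Longrightarrow>
    res (exp_slice I (KO p) (X p)) m (a p (Suc m) i) = a p m (res I m i)"
  and a'_res: "p \<in> Obs \<Longrightarrow> i \<in> car I (Suc m) \<Longrightarrow>
    res (exp_slice I (X p) (KO p)) m (a' p (Suc m) i) = a' p m (res I m i)"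
  using a a' by (auto simp: compatible_def)

lemmas cin = exp_comp_in[OF I]

lemma cj_in:
  "p \<in> Obs \<Longrightarrow> q \<in> Obs \<Longrightarrow> z \<in> fibre (exp_slice I (KO p) (KO q)) m i \<Longrightarrow>
    cj p q m i z \<in> fibre (exp_slice I (X p) (X q)) m i"
  unfolding cj_def by (intro cin X a_in a'_in exp_base)

lemma cj_res:
  assumes "p \<in> Obs" "q \<in> Obs" "z \<in> fibre (exp_slice I (KO p) (KO q)) (Suc m) i"
  shows "res (exp_slice I (X p) (X q)) m (cj p q (Suc m) i z) =
    cj p q m (res I m i) (res (exp_slice I (KO p) (KO q)) m z)"
proof -
  have i: "i \<in> car I (Suc m)" using assms by (simp add: exp_base)
  show ?thesis
    unfolding cj_def
    by (simp add: assms i exp_comp_res[OF I, of _ _ _ _ _ i] X cin a_in a'_in a_res a'_res)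
qed

text \<open>The inner factors \<open>a' q\<close> and \<open>a q\<close> cancel.\<close>

lemma cj_comp:
  assumes "p \<in> Obs" "q \<in> Obs" "r \<in> Obs"
    and g: "g \<in> fibre (exp_slice I (KO q) (KO r)) m i" and f: "f \<in> fibre (exp_slice I (KO p) (KO q)) m i"
  shows "exp_comp I (X p) (X q) (X r) m (cj q r m i g, cj p q m i f) =
    cj p r m i (exp_comp I (KO p) (KO q) (KO r) m (g, f))"
proof -
  have i: "i \<in> car I m" using g by (simp add: exp_base)
  note T = assms i X KO cin a_in a'_in
  note A = exp_comp_assoc[OF I, of _ _ _ _ _ m i]
  have *: "exp_comp I (X p) (KO q) (KO q) m
      (exp_comp I (KO q) (X q) (KO q) m (a' q m i, a q m i),
       exp_comp I (X p) (KO p) (KO q) m (f, a' p m i)) = exp_comp I (X p) (KO p) (KO q) m (f, a' p m i)"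
    by (simp add: a'a T exp_comp_id[OF I, of _ _ _ m i])
  have "exp_comp I (X p) (X q) (X r) m (cj q r m i g, cj p q m i f) =
    exp_comp I (X p) (KO r) (X r) m (a r m i, exp_comp I (X p) (KO q) (KO r) m (g,
     exp_comp I (X p) (KO q) (KO q) m
      (exp_comp I (KO q) (X q) (KO q) m (a' q m i, a q m i),
       exp_comp I (X p) (KO p) (KO q) m (f, a' p m i))))"
    unfolding cj_def by (simp add: T A[symmetric])
  also have "\<dots> = cj p r m i (exp_comp I (KO p) (KO q) (KO r) m (g, f))"
    unfolding * unfolding cj_def by (simp add: T A)
  finally show ?thesis .
qed

lemma cj_id: "p \<in> Obs \<Longrightarrow> i \<in> car I m \<Longrightarrow> cj p p m i (eid I (KO p) m i) = eid I (X p) m i"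
  unfolding cj_def by (simp add: exp_comp_id[OF I, of _ _ _ m i] X KO a'_in aa')

text \<open>The solution, by recursion on the index. At index 0 the delayed argument is
  \<open>None\<close>, so nothing has to be known beforehand. At \<open>Suc m\<close> it is a pair
  of solutions at index \<open>m\<close>, the first of which belongs to the swapped element from
  \<open>s q\<close> to \<open>s p\<close>; hence the recursion yields functions of
  \<open>p\<close>, \<open>q\<close> and \<open>h\<close>.\<close>

primrec fx :: "nat \<Rightarrow> 'o \<Rightarrow> 'o \<Rightarrow> 'h \<Rightarrow> ('a, 'a, 'i) expel" where
  "fx 0 = (\<lambda>p q h. cj p q 0 (prj (DH p q) 0 h) (KP p q 0 h None))"
| "fx (Suc m) = (\<lambda>p q h. cj p q (Suc m) (prj (DH p q) (Suc m) h) (KP p q (Suc m) h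
     (Some (fx m (s q) (s p) (\<sigma> (res (DH p q) m h)), fx m p q (res (DH p q) m h)))))"

text \<open>Membership of the solutions is a premise, so that the lemma can be applied to the
  induction hypothesis of \<open>fx_in\<close>.\<close>

lemma fx_pair:
  assumes "\<And>p q h i. p \<in> Obs \<Longrightarrow> q \<in> Obs \<Longrightarrow> h \<in> fibre (DH p q) m i \<Longrightarrow>
      fx m p q h \<in> fibre (exp_slice I (X p) (X q)) m i"
    and "p \<in> Obs" "q \<in> Obs" "h \<in> fibre (DH p q) m i"
  shows "(fx m (s q) (s p) (\<sigma> h), fx m p q h) \<in> fibre (PP p q) m i"
  using assms by (simp add: PP_def fibre_prod s \<sigma>)

lemma fx_in:
  "p \<in> Obs \<Longrightarrow> q \<in> Obs \<Longrightarrow> h \<in> fibre (DH p q) m i \<Longrightarrow> fx m p q h \<in> fibre (exp_slice I (X p) (X q)) m i"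
proof (induction m arbitrary: p q h i)
  case 0
  then show ?case
    using cj_in[OF 0(1,2) KP_None[OF 0]] by (simp add: fibre_def)
next
  case (Suc m)
  have "res (DH p q) m h \<in> fibre (DH p q) m (res I m i)"
    by (rule fibre_res[OF DH[OF Suc(2,3)] Suc(4)])
  from cj_in[OF Suc(2,3) KP_Some[OF Suc(2-4) fx_pair[OF Suc.IH Suc(2,3) this]]]
  show ?case
    using Suc(4) by (simp add: fibre_def)
qed

lemma fx_pair_in:
  "p \<in> Obs \<Longrightarrow> q \<in> Obs \<Longrightarrow> h \<in> fibre (DH p q) m i \<Longrightarrow>
    (fx m (s q) (s p) (\<sigma> h), fx m p q h) \<in> fibre (PP p q) m i"
  by (rule fx_pair) (rule fx_in)

text \<open>By \<open>KP_res\<close>, restricting replaces the argument \<open>Some P\<close> by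
  \<open>next_tree\<close> of the pair \<open>P\<close>. This consists of the restrictions of the
  two solutions in \<open>P\<close>, which the induction hypothesis identifies with the solutions
  one index further down.\<close>

lemma fx_res:
  "p \<in> Obs \<Longrightarrow> q \<in> Obs \<Longrightarrow> h \<in> fibre (DH p q) (Suc m) i \<Longrightarrow>
    res (exp_slice I (X p) (X q)) m (fx (Suc m) p q h) = fx m p q (res (DH p q) m h)"
proof (induction m arbitrary: p q h i)
  case 0
  let ?h = "res (DH p q) 0 h"
  have h: "?h \<in> fibre (DH p q) 0 (res I 0 i)"
    by (rule fibre_res[OF DH[OF 0(1,2)] 0(3)])
  have "res (exp_slice I (X p) (X q)) 0 (fx (Suc 0) p q h) =
    cj p q 0 (res I 0 i) (KP p q 0 ?h None)"
    using cj_res[OF 0(1,2) KP_Some[OF 0 fx_pair_in[OF 0(1,2) h]]] KP_res[OF 0 fx_pair_in[OF 0(1,2) h]]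
      0(3) next_tree_eq[OF fx_pair_in[OF 0(1,2) h]]
    by (simp add: fibre_def)
  then show ?case using h by (simp add: fibre_def)
next
  case (Suc m)
  let ?h = "res (DH p q) (Suc m) h"
  have h: "?h \<in> fibre (DH p q) (Suc m) (res I (Suc m) i)"
    by (rule fibre_res[OF DH[OF Suc(2,3)] Suc(4)])
  let ?P = "(fx (Suc m) (s q) (s p) (\<sigma> ?h), fx (Suc m) p q ?h)"
  have P: "?P \<in> fibre (PP p q) (Suc m) (res I (Suc m) i)"
    by (rule fx_pair_in[OF Suc(2,3) h])
  have "next_tree (PP p q) (Suc m) ?P = Some
     (fx m (s q) (s p) (\<sigma> (res (DH p q) m ?h)), fx m p q (res (DH p q) m ?h))"
    using P Suc.IH[OF Suc(2,3) h] Suc.IH[OF s(1)[OF Suc(3)] s(1)[OF Suc(2)] \<sigma>[OF Suc(2,3) h]]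
      \<sigma>_res[OF Suc(2,3) h]
    by (simp only: next_tree_eq[OF P] nat.case) (simp add: PP_def res_prod_fibre del: fx.simps)
  moreover have "res (exp_slice I (X p) (X q)) (Suc m) (fx (Suc (Suc m)) p q h) =
    cj p q (Suc m) (res I (Suc m) i) (KP p q (Suc m) ?h (next_tree (PP p q) (Suc m) ?P))"
    using cj_res[OF Suc(2,3) KP_Some[OF Suc(2-4) P]] KP_res[OF Suc(2-4) P] Suc(4)
    by (simp add: fibre_def fx.simps(2)[of "Suc m"] del: fx.simps)
  ultimately show ?case using h by (simp add: fibre_def fx.simps(2)[of m] del: fx.simps)
qed

text \<open>The recursion refers to solutions one index lower; by \<open>fx_res\<close> these are
  restrictions of the solutions at \<open>m\<close> themselves. So the recursion becomes a fixed
  point equation at a single index, the form in which uniqueness is applied.\<close>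

lemma fx_eq:
  assumes "p \<in> Obs" "q \<in> Obs" "h \<in> fibre (DH p q) m i"
  shows "fx m p q h = cj p q m i (KP p q m h (next_tree (PP p q) m (fx m (s q) (s p) (\<sigma> h), fx m p q h)))"
proof (cases m)
  case 0
  then show ?thesis
    using assms next_tree_eq[OF fx_pair_in[OF assms]] by (simp add: fibre_def)
next
  case (Suc k)
  have h: "h \<in> fibre (DH p q) (Suc k) i" using assms Suc by simp
  have "next_tree (PP p q) (Suc k) (fx (Suc k) (s q) (s p) (\<sigma> h), fx (Suc k) p q h) =
     Some (fx k (s q) (s p) (\<sigma> (res (DH p q) k h)), fx k p q (res (DH p q) k h))"
    using fx_pair_in[OF assms(1,2) h] fx_res[OF assms(1,2) h]
      fx_res[OF s(1)[OF assms(2)] s(1)[OF assms(1)] \<sigma>[OF assms(1,2) h]] \<sigma>_res[OF assms(1,2) h]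
    by (simp only: next_tree_eq[OF fx_pair_in[OF assms(1,2) h]] nat.case)
      (simp add: PP_def res_prod_fibre del: fx.simps)
  then show ?thesis using h Suc by (simp add: fibre_def)
qed

text \<open>An element solving the fixed point equation restricts to one, so uniqueness follows by
  induction on the stage.\<close>

lemma fx_unique:
  assumes "p \<in> Obs" "q \<in> Obs" "h \<in> fibre (DH p q) m i"
    and "e' \<in> fibre (exp_slice I (X (s q)) (X (s p))) m i" "e \<in> fibre (exp_slice I (X p) (X q)) m i"
    and "e = cj p q m i (KP p q m h (next_tree (PP p q) m (e', e)))"
    and "e' = cj (s q) (s p) m i (KP (s q) (s p) m (\<sigma> h) (next_tree (PP (s q) (s p)) m (e, e')))"
  shows "e = fx m p q h"
proof -
  \<comment> \<open>Each of the two equations contains both unknowns, so the two claims are proved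
    together.\<close>
  have "e = fx m p q h \<and> e' = fx m (s q) (s p) (\<sigma> h)"
    using assms
  proof (induction m arbitrary: i e e' h)
    case 0
    have P: "(e', e) \<in> fibre (PP p q) 0 i" "(e, e') \<in> fibre (PP (s q) (s p)) 0 i"
      using 0 by (auto simp: PP_def fibre_prod s)
    show ?case
      using 0(3) 0(6,7) \<sigma>[OF 0(1,2,3)] unfolding next_tree_eq[OF P(1)] next_tree_eq[OF P(2)]
      by (simp add: fibre_def)
  next
    case (Suc m)
    have P: "(e', e) \<in> fibre (PP p q) (Suc m) i" "(e, e') \<in> fibre (PP (s q) (s p)) (Suc m) i"
      using Suc by (auto simp: PP_def fibre_prod s)
    define d where "d = res (exp_slice I (X p) (X q)) m e"
    define d' where "d' = res (exp_slice I (X (s q)) (X (s p))) m e'"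
    have N: "next_tree (PP p q) (Suc m) (e', e) = Some (d', d)"
        "next_tree (PP (s q) (s p)) (Suc m) (e, e') = Some (d, d')"
      unfolding next_tree_eq[OF P(1)] next_tree_eq[OF P(2)]
      using P Suc(2,3) by (auto simp: PP_def res_prod_fibre d_def d'_def s)
    have d: "d \<in> fibre (exp_slice I (X p) (X q)) m (res I m i)"
        "d' \<in> fibre (exp_slice I (X (s q)) (X (s p))) m (res I m i)"
      unfolding d_def d'_def by (rule exp_res_in[OF I] Suc)+
    have Pd: "(d', d) \<in> fibre (PP p q) m (res I m i)" "(d, d') \<in> fibre (PP (s q) (s p)) m (res I m i)"
      using d Suc(2,3) by (auto simp: PP_def fibre_prod s)
    note sp = s(1)[OF Suc(2)] s(1)[OF Suc(3)]
    note sh = \<sigma>[OF Suc(2-4)]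
    have e: "e = cj p q (Suc m) i (KP p q (Suc m) h (Some (d', d)))"
        "e' = cj (s q) (s p) (Suc m) i (KP (s q) (s p) (Suc m) (\<sigma> h) (Some (d, d')))"
      using Suc(7,8) N by simp_all
    \<comment> \<open>The restrictions solve the equations one index lower. The delayed arguments at
      \<open>Suc m\<close> are exactly \<open>d\<close> and \<open>d'\<close>, so these determine
      \<open>e\<close> and \<open>e'\<close>.\<close>
    have "d = fx m p q (res (DH p q) m h) \<and> d' = fx m (s q) (s p) (\<sigma> (res (DH p q) m h))"
    proof (rule Suc.IH)
      show "res (DH p q) m h \<in> fibre (DH p q) m (res I m i)"
        by (rule fibre_res[OF DH[OF Suc(2,3)] Suc(4)])
      show "d = cj p q m (res I m i) (KP p q m (res (DH p q) m h) (next_tree (PP p q) m (d', d)))"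
        using cj_res[OF Suc(2,3) KP_Some[OF Suc(2,3,4) Pd(1)]] d_def
        unfolding KP_res[OF Suc(2,3,4) Pd(1)] e(1)[symmetric] by simp
      show "d' = cj (s q) (s p) m (res I m i)
          (KP (s q) (s p) m (\<sigma> (res (DH p q) m h)) (next_tree (PP (s q) (s p)) m (d, d')))"
        using cj_res[OF sp(2,1) KP_Some[OF sp(2,1) sh Pd(2)]] d'_def
        unfolding KP_res[OF sp(2,1) sh Pd(2)] \<sigma>_res[OF Suc(2-4)] e(2)[symmetric] by simp
    qed (use Suc d in auto)
    then show ?case
      using e Suc(2-4) sh \<sigma>_res[OF Suc(2-4)]
        \<sigma>\<sigma>[OF Suc(2,3) fibre_res[OF DH[OF Suc(2,3)] Suc(4)]] by (simp add: fibre_def s)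
  qed
  then show ?thesis by simp
qed

lemma KP_in:
  assumes "p \<in> Obs" "q \<in> Obs" "h \<in> fibre (DH p q) m i" "P \<in> fibre (PP p q) m i"
  shows "KP p q m h (next_tree (PP p q) m P) \<in> fibre (exp_slice I (KO p) (KO q)) m i"
proof (cases m)
  case 0
  then show ?thesis using assms KP_None next_tree_eq[OF assms(4)] by simp
next
  case (Suc k)
  have "is_slice I (PP p q)"
    unfolding PP_def by (intro prod_slice_is_slice exp_slice_is_slice I)
  from KP_Some[of p q h k i, OF _ _ _ fibre_res[OF this]] show ?thesis
    using assms next_tree_eq[OF assms(4)] Suc by simp
qed

text \<open>As \<open>a\<close> is invertible, conjugation can be cleared from the equation, which
  becomes a commuting square with sides \<open>a p\<close>, \<open>a q\<close>, \<open>z\<close> and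
  \<open>e\<close>. Solving the fixed point equation and making \<open>a\<close> natural are
  therefore one condition.\<close>

lemma cj_iff:
  assumes "p \<in> Obs" "q \<in> Obs" and z: "z \<in> fibre (exp_slice I (KO p) (KO q)) m i"
    and e: "e \<in> fibre (exp_slice I (X p) (X q)) m i"
  shows "e = cj p q m i z \<longleftrightarrow>
    exp_comp I (KO p) (KO q) (X q) m (a q m i, z) = exp_comp I (KO p) (X p) (X q) m (e, a p m i)"
proof -
  have i: "i \<in> car I m" using z by (simp add: exp_base)
  note A = a_in[OF assms(1) i] a_in[OF assms(2) i] a'_in[OF assms(1) i] a'_in[OF assms(2) i]
  note S = X[OF assms(1)] KO[OF assms(1)] KO[OF assms(2)] X[OF assms(2)]
  show ?thesis
  proof
    assume e: "e = cj p q m i z"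
    have "exp_comp I (KO p) (X p) (X q) m (e, a p m i) =
      exp_comp I (KO p) (KO q) (X q) m (a q m i, exp_comp I (KO p) (KO p) (KO q) m
        (z, exp_comp I (KO p) (X p) (KO p) m (a' p m i, a p m i)))"
      unfolding e cj_def
      exp_comp_assoc[OF I S(2,1) A(2) cin[OF S(1) z A(3)] A(1), symmetric]
      exp_comp_assoc[OF I S(2,1) z A(3) A(1), symmetric] ..
    then show "exp_comp I (KO p) (KO q) (X q) m (a q m i, z) = exp_comp I (KO p) (X p) (X q) m (e, a p
        m i)"
      unfolding a'a[OF assms(1) i] exp_comp_id(2)[OF I S(2,3) z] by simp
  next
    assume E: "exp_comp I (KO p) (KO q) (X q) m (a q m i, z) = exp_comp I (KO p) (X p) (X q) m (e, a p
        m i)"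
    have "cj p q m i z = exp_comp I (X p) (X p) (X q) m
      (e, exp_comp I (X p) (KO p) (X p) m (a p m i, a' p m i))"
      unfolding cj_def exp_comp_assoc[OF I S(1,2) A(2) z A(3)] E
      exp_comp_assoc[OF I S(1,2) e A(1) A(3), symmetric] ..
    then show "e = cj p q m i z"
      unfolding aa'[OF assms(1) i] exp_comp_id(2)[OF I S(1,4) e] by simp
  qed
qed

lemma fx_natural:
  assumes "p \<in> Obs" "q \<in> Obs" "h \<in> fibre (DH p q) m i"
  shows "exp_comp I (KO p) (KO q) (X q) m
      (a q m i, KP p q m h (next_tree (PP p q) m (fx m (s q) (s p) (\<sigma> h), fx m p q h))) =
    exp_comp I (KO p) (X p) (X q) m (fx m p q h, a p m i)"
  using cj_iff[OF assms(1,2) KP_in[OF assms fx_pair_in[OF assms]] fx_in[OF assms]] fx_eq[OF assms] by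
      blast

text \<open>The composite of two solutions solves the equation for the composite element, since
  \<open>KP\<close> and conjugation preserve composition; uniqueness does the rest.\<close>

lemma fx_comp:
  assumes "p \<in> Obs" "q \<in> Obs" "r \<in> Obs" "g \<in> fibre (DH q r) m i" "f \<in> fibre (DH p q) m i"
  shows "fx m p r (DC p q r m (g, f)) = exp_comp I (X p) (X q) (X r) m (fx m q r g, fx m p q f)"
proof -
  \<comment> \<open>Stated for arbitrary arguments, because uniqueness also asks for the equation of
    the swapped partner, where composition runs backwards through \<open>s r\<close>,
    \<open>s q\<close>, \<open>s p\<close>.\<close>
  have E: "exp_comp I (X p) (X q) (X r) m (fx m q r g, fx m p q f) =
      cj p r m i (KP p r m (DC p q r m (g, f)) (next_tree (PP p r) m
        (exp_comp I (X (s r)) (X (s q)) (X (s p)) m (fx m (s q) (s p) (\<sigma> f), fx m (s r) (s q) (\<sigma> g)),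
         exp_comp I (X p) (X q) (X r) m (fx m q r g, fx m p q f))))"
    if A: "p \<in> Obs" "q \<in> Obs" "r \<in> Obs" "g \<in> fibre (DH q r) m i" "f \<in> fibre (DH p q) m i"
    for p q r g f
  proof -
    note PI = fx_pair_in[OF A(2-4)] fx_pair_in[OF A(1,2,5)]
    show ?thesis
      unfolding KP_comp[OF A PI]
      using cj_comp[OF A(1-3) KP_in[OF A(2-4) PI(1)] KP_in[OF A(1,2,5) PI(2)]]
      by (simp only: fx_eq[OF A(2-4), symmetric] fx_eq[OF A(1,2,5), symmetric])
  qed
  note sp = s(1)[OF assms(1)] s(1)[OF assms(2)] s(1)[OF assms(3)]
  note sg = \<sigma>[OF assms(2,3,4)] and sf = \<sigma>[OF assms(1,2,5)]
  show ?thesis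
  proof (rule fx_unique[symmetric])
    show "exp_comp I (X (s r)) (X (s q)) (X (s p)) m (fx m (s q) (s p) (\<sigma> f), fx m (s r) (s q) (\<sigma> g)) =
      cj (s r) (s p) m i (KP (s r) (s p) m (\<sigma> (DC p q r m (g, f))) (next_tree (PP (s r) (s p)) m
         (exp_comp I (X p) (X q) (X r) m (fx m q r g, fx m p q f),
          exp_comp I (X (s r)) (X (s q)) (X (s p)) m (fx m (s q) (s p) (\<sigma> f), fx m (s r) (s q) (\<sigma> g)))))"
      using E[OF sp(3,2,1) sf sg] assms
      by (simp only: \<sigma>_comp[OF assms] s \<sigma>\<sigma>[OF assms(1,2,5)] \<sigma>\<sigma>[OF assms(2,3,4)])
  qed (intro E assms DC cin X fx_in sp sg sf)+
qed

text \<open>Identities solve the equation for the identity element; the partner of the identity at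
  \<open>p\<close> is the identity at \<open>s p\<close>.\<close>

lemma fx_id:
  assumes "p \<in> Obs" "i \<in> car I m"
  shows "fx m p p (DI p m i) = eid I (X p) m i"
proof (rule fx_unique[symmetric])
  show "eid I (X p) m i = cj p p m i (KP p p m (DI p m i) (next_tree (PP p p) m (eid I (X (s p)) m i,
      eid I (X p) m i)))"
    by (simp only: KP_id[OF assms] cj_id[OF assms])
  show "eid I (X (s p)) m i = cj (s p) (s p) m i (KP (s p) (s p) m (\<sigma> (DI p m i))
      (next_tree (PP (s p) (s p)) m (eid I (X p) m i, eid I (X (s p)) m i)))"
    using KP_id[OF s(1)[OF assms(1)] assms(2)] cj_id[OF s(1)[OF assms(1)] assms(2)] assms
    by (simp add: s \<sigma>_id)
qed (intro assms DI eid_in I X s)+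

end

section \<open>The enriched categories at hand\<close>

lemma fibre_family:
  "z \<in> fibre (prod_family I J Y) m i \<longleftrightarrow>
     i \<in> car I m \<and> fst z = i \<and> snd z \<in> (\<Pi>\<^sub>E j\<in>J. fibre (Y j) m i)"
  by (cases z) (auto simp: fibre_def prod_family_def Let_def)

lemma res_family:
  "z \<in> fibre (prod_family I J Y) (Suc m) i \<Longrightarrow>
     res (prod_family I J Y) m z = (res I m i, \<lambda>j\<in>J. res (Y j) m (snd z j))"
  by (cases z) (auto simp: fibre_def prod_family_def Let_def)

lemma prod_family_is_slice:
  assumes "is_tree I" "\<And>j. j \<in> J \<Longrightarrow> is_slice I (Y j)"
  shows "is_slice I (prod_family I J Y)"
proof (rule is_sliceI)
  show "res (prod_family I J Y) m \<in> extensional (car (prod_family I J Y) (Suc m))"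
       "prj (prod_family I J Y) m \<in> extensional (car (prod_family I J Y) m)" for m
    by (auto simp: prod_family_def Let_def extensional_def)
  show "prj (prod_family I J Y) m z \<in> car I m" if "z \<in> car (prod_family I J Y) m" for m z
    using that by (auto simp: prod_family_def Let_def)
  fix m z assume "z \<in> car (prod_family I J Y) (Suc m)"
  then have z: "z \<in> fibre (prod_family I J Y) (Suc m) (prj (prod_family I J Y) (Suc m) z)"
    by (simp add: fibre_def)
  show "res (prod_family I J Y) m z \<in> fibre (prod_family I J Y) m (res I m (prj (prod_family I J Y)
      (Suc m) z))"
    using z assms(1) unfolding res_family[OF z]
    by (auto simp: fibre_family tree_res_in intro!: fibre_res[OF assms(2)])
qed

text \<open>Pulling back along \<open>next_tree I\<close> shifts the base point too: the elements
  over \<open>i\<close> at index \<open>k + 1\<close> are those of \<open>Y\<close> over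
  \<open>res I k i\<close> at index \<open>k\<close>.\<close>

lemma fibre_later:
  "z \<in> fibre (later_slice I Y) m i \<longleftrightarrow> i \<in> car I m \<and> fst z = i \<and>
     snd z \<in> (case m of 0 \<Rightarrow> {None} | Suc k \<Rightarrow> Some ` fibre Y k (res I k i))"
  by (cases z) (auto simp: fibre_def later_slice_def pullback_def later_def later_map_def
      next_tree_def Let_def split: nat.split)

lemma later_cases:
  assumes "z \<in> fibre (later_slice I Y) m i"
  obtains "m = 0" "z = (i, None)"
  | k y where "m = Suc k" "z = (i, Some y)" "y \<in> fibre Y k (res I k i)"
  using assms by (cases z; cases m) (auto simp: fibre_later)

lemma later_some_in:
  "i \<in> car I (Suc m) \<Longrightarrow> y \<in> fibre Y m (res I m i) \<Longrightarrow> (i, Some y) \<in> fibre (later_slice I Y) (Suc m) i"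
  by (simp add: fibre_later)

lemma later_none_in: "i \<in> car I 0 \<Longrightarrow> (i, None) \<in> fibre (later_slice I Y) 0 i"
  by (simp add: fibre_later)

text \<open>Writing the result with \<open>next_tree\<close> covers the passage to index 0, where
  the element is lost, by the same formula.\<close>

lemma res_later:
  "(i, Some y) \<in> fibre (later_slice I Y) (Suc m) i \<Longrightarrow>
     res (later_slice I Y) m (i, Some y) = (res I m i, next_tree Y m y)"
  by (auto simp: fibre_def later_slice_def pullback_def later_def later_map_def
      next_tree_def Let_def split: nat.split)

lemma next_in_later:
  assumes "is_slice I Y" "y \<in> fibre Y m i"
  shows "(i, next_tree Y m y) \<in> fibre (later_slice I Y) m i"
  using assms fibre_base[OF assms]
  by (auto simp: fibre_later next_tree_eq[OF assms(2)] split: nat.split intro!: fibre_res)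

lemma later_slice_is_slice:
  assumes "is_tree I" "is_slice I Y"
  shows "is_slice I (later_slice I Y)"
proof (rule is_sliceI)
  show "res (later_slice I Y) m \<in> extensional (car (later_slice I Y) (Suc m))"
       "prj (later_slice I Y) m \<in> extensional (car (later_slice I Y) m)" for m
    by (auto simp: later_slice_def pullback_def Let_def extensional_def)
  show "prj (later_slice I Y) m z \<in> car I m" if "z \<in> car (later_slice I Y) m" for m z
    using that by (auto simp: later_slice_def pullback_def Let_def)
  fix m z assume "z \<in> car (later_slice I Y) (Suc m)"
  then obtain i where z: "z \<in> fibre (later_slice I Y) (Suc m) i" and i: "prj (later_slice I Y) (Suc m)
      z = i"
    by (simp add: fibre_def)
  then obtain y where y: "z = (i, Some y)" "y \<in> fibre Y m (res I m i)"
    by (cases z) (auto simp: fibre_later)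
  show "res (later_slice I Y) m z \<in> fibre (later_slice I Y) m (res I m (prj (later_slice I Y) (Suc m) z))"
    unfolding i using z next_in_later[OF assms(2) y(2)] by (simp add: y(1) res_later)
qed

lemma next_slice_eq: "y \<in> fibre Y m i \<Longrightarrow> next_slice Y m y = (i, next_tree Y m y)"
  by (auto simp: next_slice_def fibre_def)

section \<open>The self-enriched slice and its product with the opposite category\<close>

abbreviation SO :: "'u set set \<Rightarrow> 'u tree \<Rightarrow> ('u, 'u) slice set" where
  "SO U I \<equiv> slice_objects U I"

abbreviation powM where
  "powM U I J \<equiv> pow_ecat I J (mixed_ecat U I)"

abbreviation conM where
  "conM U I J \<equiv> prod_ecat (powM U I J) (later_ecat I (mixed_ecat U I))"

lemma SO_slice: "X \<in> SO U I \<Longrightarrow> is_slice I X"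
  by (simp add: slice_objects_def)

lemma slice_ecat_simps [simp]:
  "Ob (slice_ecat U I) = SO U I" "Hom (slice_ecat U I) = exp_slice I"
  "Comp (slice_ecat U I) = exp_comp I" "Id (slice_ecat U I) X = eid I X"
  by (simp_all add: slice_ecat_def slice_cat_def hid_def)

lemma mixed_ecat_simps [simp]:
  "Ob (mixed_ecat U I) = SO U I \<times> SO U I"
  "Hom (mixed_ecat U I) A B = prod_slice (exp_slice I (fst B) (fst A)) (exp_slice I (snd A) (snd B))"
  "Id (mixed_ecat U I) A m i = (eid I (fst A) m i, eid I (snd A) m i)"
  by (simp_all add: mixed_ecat_def prod_ecat_def op_ecat_def Let_def)

lemma mixed_comp:
  assumes "g \<in> fibre (Hom (mixed_ecat U I) B E) m i" "f \<in> fibre (Hom (mixed_ecat U I) A B) m i"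
  shows "Comp (mixed_ecat U I) A B E m (g, f) =
    (exp_comp I (fst E) (fst B) (fst A) m (fst f, fst g), exp_comp I (snd A) (snd B) (snd E) m (snd g,
        snd f))"
proof -
  have "(g, f) \<in> car (prod_slice (Hom (mixed_ecat U I) B E) (Hom (mixed_ecat U I) A B)) m"
      "(fst g, fst f) \<in> car (prod_slice (exp_slice I (fst E) (fst B)) (exp_slice I (fst B) (fst A))) m"
    using assms by (auto simp: car_prod fibre_prod) (auto simp: fibre_def prod_slice_def)
  then show ?thesis
    by (simp add: mixed_ecat_def prod_ecat_def op_ecat_def Let_def)
qed

lemma mixed_fibre:
  "h \<in> fibre (Hom (mixed_ecat U I) A B) m i \<longleftrightarrow>
    fst h \<in> fibre (exp_slice I (fst B) (fst A)) m i \<and> snd h \<in> fibre (exp_slice I (snd A) (snd B)) m i"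
  by (simp add: fibre_prod)

lemma mixed_slice: "is_tree I \<Longrightarrow> is_slice I (Hom (mixed_ecat U I) A B)"
  by (simp add: prod_slice_is_slice exp_slice_is_slice)

lemma mixed_comp_in:
  assumes "is_tree I" "A \<in> SO U I \<times> SO U I" "E \<in> SO U I \<times> SO U I"
    and "g \<in> fibre (Hom (mixed_ecat U I) B E) m i" "f \<in> fibre (Hom (mixed_ecat U I) A B) m i"
  shows "Comp (mixed_ecat U I) A B E m (g, f) \<in> fibre (Hom (mixed_ecat U I) A E) m i"
  unfolding mixed_comp[OF assms(4,5)] using assms
  by (auto simp: mixed_fibre SO_slice intro!: exp_comp_in simp del: mixed_ecat_simps(2))

lemma mixed_comp_res:
  assumes "is_tree I" "A \<in> SO U I \<times> SO U I" "B \<in> SO U I \<times> SO U I" "E \<in> SO U I \<times> SO U I"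
    and "g \<in> fibre (Hom (mixed_ecat U I) B E) (Suc m) i" "f \<in> fibre (Hom (mixed_ecat U I) A B) (Suc m) i"
  shows "res (Hom (mixed_ecat U I) A E) m (Comp (mixed_ecat U I) A B E (Suc m) (g, f)) =
    Comp (mixed_ecat U I) A B E m (res (Hom (mixed_ecat U I) B E) m g, res (Hom (mixed_ecat U I) A B)
        m f)"
proof -
  note gr = fibre_res[OF mixed_slice[OF assms(1)] assms(5)]
  note fr = fibre_res[OF mixed_slice[OF assms(1)] assms(6)]
  have S: "is_slice I (fst E)" "is_slice I (snd A)"
    using assms(2,4) by (auto simp: SO_slice)
  show ?thesis
    unfolding mixed_comp[OF gr fr]
    using mixed_comp_in[OF assms(1,2,4,5,6)] assms(5,6)
    by (simp add: mixed_comp[OF assms(5,6)] res_prod_fibre fibre_prod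
        exp_comp_res[OF assms(1) S(1), of _ _ _ _ i] exp_comp_res[OF assms(1) S(2), of _ _ _ _ i])
qed

lemma mixed_id_in:
  "is_tree I \<Longrightarrow> A \<in> SO U I \<times> SO U I \<Longrightarrow> i \<in> car I m \<Longrightarrow>
    Id (mixed_ecat U I) A m i \<in> fibre (Hom (mixed_ecat U I) A A) m i"
  by (auto simp: fibre_prod eid_in SO_slice)

lemma mixed_id_res:
  "is_tree I \<Longrightarrow> A \<in> SO U I \<times> SO U I \<Longrightarrow> i \<in> car I (Suc m) \<Longrightarrow>
    res (Hom (mixed_ecat U I) A A) m (Id (mixed_ecat U I) A (Suc m) i) = Id (mixed_ecat U I) A m (res
        I m i)"
  using res_prod_fibre[OF mixed_id_in[of I A U i "Suc m", unfolded mixed_ecat_simps(2)]]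
  by (auto simp: eid_res SO_slice)

lemma mixed_comp_id:
  assumes "is_tree I" "A \<in> SO U I \<times> SO U I" "B \<in> SO U I \<times> SO U I"
    and "f \<in> fibre (Hom (mixed_ecat U I) A B) m i"
  shows "Comp (mixed_ecat U I) A B B m (Id (mixed_ecat U I) B m i, f) = f"
    "Comp (mixed_ecat U I) A A B m (f, Id (mixed_ecat U I) A m i) = f"
proof -
  have i: "i \<in> car I m" by (rule fibre_base[OF mixed_slice[OF assms(1)] assms(4)])
  note f = assms(4)[unfolded mixed_fibre]
  have S: "is_slice I (fst A)" "is_slice I (snd A)" "is_slice I (fst B)" "is_slice I (snd B)"
    using assms(2,3) by (auto simp: SO_slice)
  show "Comp (mixed_ecat U I) A B B m (Id (mixed_ecat U I) B m i, f) = f"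
    using f exp_comp_id(2)[OF assms(1) S(3,1)] exp_comp_id(1)[OF assms(1) S(2,4)]
    unfolding mixed_comp[OF mixed_id_in[OF assms(1,3) i] assms(4)] by simp
  show "Comp (mixed_ecat U I) A A B m (f, Id (mixed_ecat U I) A m i) = f"
    using f exp_comp_id(1)[OF assms(1) S(3,1)] exp_comp_id(2)[OF assms(1) S(2,4)]
    unfolding mixed_comp[OF assms(4) mixed_id_in[OF assms(1,2) i]] by simp
qed

text \<open>Exchanging the two components identifies the mixed category with its opposite; the swap
  of tuples is built from this.\<close>

lemma mixed_swap_in:
  "f \<in> fibre (Hom (mixed_ecat U I) A B) m i \<Longrightarrow>
    prod.swap f \<in> fibre (Hom (mixed_ecat U I) (prod.swap B) (prod.swap A)) m i"
  by (simp add: fibre_prod)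

lemma mixed_swap_comp:
  assumes "g \<in> fibre (Hom (mixed_ecat U I) B E) m i" "f \<in> fibre (Hom (mixed_ecat U I) A B) m i"
  shows "prod.swap (Comp (mixed_ecat U I) A B E m (g, f)) =
      Comp (mixed_ecat U I) (prod.swap E) (prod.swap B) (prod.swap A) m (prod.swap f, prod.swap g)"
  unfolding mixed_comp[OF assms] mixed_comp[OF mixed_swap_in[OF assms(2)] mixed_swap_in[OF assms(1)]]
  by simp

lemma mixed_swap_res:
  "f \<in> fibre (Hom (mixed_ecat U I) A B) (Suc m) i \<Longrightarrow>
    res (Hom (mixed_ecat U I) (prod.swap B) (prod.swap A)) m (prod.swap f) =
    prod.swap (res (Hom (mixed_ecat U I) A B) m f)"
  using mixed_swap_in[of f U I A B "Suc m" i] by (simp add: res_prod_fibre)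

section \<open>Powers of the mixed category over a set of indices\<close>

lemma pow_simps [simp]:
  "Ob (pow_ecat I J C) = (\<Pi>\<^sub>E j\<in>J. Ob C)"
  "Hom (pow_ecat I J C) p q = prod_family I J (\<lambda>j. Hom C (p j) (q j))"
  by (simp_all add: pow_ecat_def Let_def)

lemma pow_id: "i \<in> car I m \<Longrightarrow> Id (pow_ecat I J C) p m i = (i, \<lambda>j\<in>J. Id C (p j) m i)"
  by (simp add: pow_ecat_def Let_def)

lemma car_prod_fibres: "x \<in> fibre A m i \<Longrightarrow> y \<in> fibre B m i \<Longrightarrow> (x, y) \<in> car (prod_slice A B) m"
  by (simp add: car_prod fibre_def)

lemma pow_comp:
  assumes "g \<in> fibre (Hom (pow_ecat I J C) q r) m i" "f \<in> fibre (Hom (pow_ecat I J C) p q) m i"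
  shows "Comp (pow_ecat I J C) p q r m (g, f) =
    (i, \<lambda>j\<in>J. Comp C (p j) (q j) (r j) m (snd g j, snd f j))"
  using car_prod_fibres[OF assms] assms
  by (cases g; cases f) (simp add: pow_ecat_def Let_def fibre_family)

lemma powM_slice: "is_tree I \<Longrightarrow> is_slice I (Hom (powM U I J) p q)"
  by (simp add: prod_family_is_slice prod_slice_is_slice exp_slice_is_slice)

lemma powM_fibre:
  "z \<in> fibre (Hom (powM U I J) p q) m i \<longleftrightarrow> i \<in> car I m \<and> fst z = i \<and>
    snd z \<in> (\<Pi>\<^sub>E j\<in>J. fibre (Hom (mixed_ecat U I) (p j) (q j)) m i)"
  by (simp add: fibre_family)

lemma powM_res:
  "z \<in> fibre (Hom (powM U I J) p q) (Suc m) i \<Longrightarrow> res (Hom (powM U I J) p q) m z =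
     (res I m i, \<lambda>j\<in>J. res (Hom (mixed_ecat U I) (p j) (q j)) m (snd z j))"
  using res_family by simp

lemma PiE_SO: "p \<in> Ob (powM U I J) \<Longrightarrow> j \<in> J \<Longrightarrow> p j \<in> SO U I \<times> SO U I"
  by (auto simp: PiE_iff)

lemma powM_fibre_mem:
  "z \<in> fibre (Hom (powM U I J) p q) m i \<Longrightarrow> j \<in> J \<Longrightarrow>
    snd z j \<in> fibre (Hom (mixed_ecat U I) (p j) (q j)) m i"
  unfolding powM_fibre by blast

lemma powM_comp_in:
  assumes "is_tree I" "p \<in> Ob (powM U I J)" "r \<in> Ob (powM U I J)"
    and "g \<in> fibre (Hom (powM U I J) q r) m i" "f \<in> fibre (Hom (powM U I J) p q) m i"
  shows "Comp (powM U I J) p q r m (g, f) \<in> fibre (Hom (powM U I J) p r) m i"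
  unfolding pow_comp[OF assms(4,5)] powM_fibre
  using assms(4) mixed_comp_in[OF assms(1) PiE_SO[OF assms(2)] PiE_SO[OF assms(3)]
      powM_fibre_mem[OF assms(4)] powM_fibre_mem[OF assms(5)]]
  by (auto simp: powM_fibre simp del: mixed_ecat_simps pow_simps)

lemma powM_id_in:
  assumes "is_tree I" "p \<in> Ob (powM U I J)" "i \<in> car I m"
  shows "Id (powM U I J) p m i \<in> fibre (Hom (powM U I J) p p) m i"
  unfolding pow_id[OF assms(3)] powM_fibre
  using assms mixed_id_in[OF assms(1) PiE_SO[OF assms(2)] assms(3)]
  by (auto simp del: mixed_ecat_simps pow_simps)

lemma powM_id_res:
  assumes "is_tree I" "p \<in> Ob (powM U I J)" "i \<in> car I (Suc m)"
  shows "res (Hom (powM U I J) p p) m (Id (powM U I J) p (Suc m) i) = Id (powM U I J) p m (res I m i)"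
  unfolding powM_res[OF powM_id_in[OF assms]]
  unfolding pow_id[OF assms(3)] pow_id[OF tree_res_in[OF assms(1,3)]]
  using mixed_id_res[OF assms(1) PiE_SO[OF assms(2)] assms(3)]
  by (auto simp del: mixed_ecat_simps pow_simps intro!: restrict_ext)

lemma powM_comp_id:
  assumes "is_tree I" "p \<in> Ob (powM U I J)" "q \<in> Ob (powM U I J)"
    and "f \<in> fibre (Hom (powM U I J) p q) m i"
  shows "Comp (powM U I J) p q q m (Id (powM U I J) q m i, f) = f"
    "Comp (powM U I J) p p q m (f, Id (powM U I J) p m i) = f"
proof -
  have i: "i \<in> car I m" using assms(4) by (simp add: powM_fibre del: pow_simps)
  have E: "f = (i, \<lambda>j\<in>J. snd f j)"
    using assms(4) by (cases f) (auto simp: powM_fibre PiE_iff extensional_restrict simp del: pow_simps)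
  note M = mixed_comp_id[OF assms(1) PiE_SO[OF assms(2)] PiE_SO[OF assms(3)] powM_fibre_mem[OF assms(4)]]
  show "Comp (powM U I J) p q q m (Id (powM U I J) q m i, f) = f"
    unfolding pow_comp[OF powM_id_in[OF assms(1,3) i] assms(4)]
    by (subst (2) E) (auto simp: pow_id[OF i] M simp del: mixed_ecat_simps intro!: restrict_ext)
  show "Comp (powM U I J) p p q m (f, Id (powM U I J) p m i) = f"
    unfolding pow_comp[OF assms(4) powM_id_in[OF assms(1,2) i]]
    by (subst (2) E) (auto simp: pow_id[OF i] M simp del: mixed_ecat_simps intro!: restrict_ext)
qed

text \<open>The swap over an arbitrary index set, because the set \<open>{..<n} - {k}\<close> occurs
  as well as \<open>{..<n}\<close>.\<close>

definition swp :: "nat set \<Rightarrow> (nat \<Rightarrow> 'a \<times> 'a) \<Rightarrow> nat \<Rightarrow> 'a \<times> 'a" where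
  "swp J p = (\<lambda>j\<in>J. prod.swap (p j))"

lemma swap_tuple_swp: "swap_tuple N = swp {..<N}"
  by (simp add: swap_tuple_def swp_def fun_eq_iff)

lemma swp_swp: "p \<in> extensional J \<Longrightarrow> swp J (swp J p) = p"
  by (auto simp: swp_def extensional_def)

lemma swp_Ob: "p \<in> Ob (powM U I J) \<Longrightarrow> swp J p \<in> Ob (powM U I J)"
  by (auto simp: swp_def PiE_iff)

lemma swp_Ob2: "p \<in> Ob (powM U I J) \<Longrightarrow> swp J (swp J p) = p"
  by (auto intro!: swp_swp simp: PiE_iff)

abbreviation swe :: "nat set \<Rightarrow> 'i \<times> (nat \<Rightarrow> 'a \<times> 'a) \<Rightarrow> 'i \<times> (nat \<Rightarrow> 'a \<times> 'a)" where
  "swe J h \<equiv> (fst h, swp J (snd h))"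

lemma powM_swap:
  assumes f: "f \<in> fibre (Hom (powM U I J) p q) m i"
  shows "swe J f \<in> fibre (Hom (powM U I J) (swp J q) (swp J p)) m i" "swe J (swe J f) = f"
  using f mixed_swap_in[OF powM_fibre_mem[OF f]]
  by (auto simp: powM_fibre swp_def PiE_iff extensional_restrict prod_eq_iff extensional_def
      simp del: mixed_ecat_simps pow_simps)

lemma powM_swap_res:
  assumes "f \<in> fibre (Hom (powM U I J) p q) (Suc m) i"
  shows "res (Hom (powM U I J) (swp J q) (swp J p)) m (swe J f) = swe J (res (Hom (powM U I J) p q) m f)"
proof -
  note mixed_swap_res[OF powM_fibre_mem[OF assms]]
  then show ?thesis
    unfolding powM_res[OF assms] powM_res[OF powM_swap(1)[OF assms]]
    by (auto simp: swp_def simp del: mixed_ecat_simps intro!: restrict_ext)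
qed

lemma powM_swap_comp:
  assumes "g \<in> fibre (Hom (powM U I J) q r) m i" "f \<in> fibre (Hom (powM U I J) p q) m i"
  shows "swe J (Comp (powM U I J) p q r m (g, f)) =
    Comp (powM U I J) (swp J r) (swp J q) (swp J p) m (swe J f, swe J g)"
  unfolding pow_comp[OF assms] pow_comp[OF powM_swap(1)[OF assms(2)] powM_swap(1)[OF assms(1)]]
  by (auto simp: swp_def mixed_swap_comp[OF powM_fibre_mem[OF assms(1)] powM_fibre_mem[OF assms(2)]]
      intro!: restrict_ext simp del: mixed_ecat_simps)

lemma powM_swap_id: "i \<in> car I m \<Longrightarrow> swe J (Id (powM U I J) p m i) = Id (powM U I J) (swp J p) m i"
  by (auto simp: pow_id swp_def)

section \<open>Adjoining one coordinate to a power\<close>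

abbreviation ext :: "nat \<Rightarrow> 'i \<times> (nat \<Rightarrow> 'a) \<Rightarrow> 'a \<Rightarrow> 'i \<times> (nat \<Rightarrow> 'a)" where
  "ext k h P \<equiv> (fst h, (snd h)(k := P))"

lemma ext_Ob:
  "p \<in> Ob (powM U I J) \<Longrightarrow> A \<in> SO U I \<times> SO U I \<Longrightarrow> p(k := A) \<in> Ob (powM U I (insert k J))"
  by (auto simp: PiE_iff extensional_def)

lemma ext_in:
  assumes "k \<notin> J" "h \<in> fibre (Hom (powM U I J) p q) m i" "P \<in> fibre (Hom (mixed_ecat U I) A B) m i"
  shows "ext k h P \<in> fibre (Hom (powM U I (insert k J)) (p(k := A)) (q(k := B))) m i"
  using assms by (auto simp: powM_fibre PiE_iff extensional_def simp del: mixed_ecat_simps pow_simps)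

lemma ext_res:
  assumes "k \<notin> J" "h \<in> fibre (Hom (powM U I J) p q) (Suc m) i" "P \<in> fibre (Hom (mixed_ecat U I) A B)
      (Suc m) i"
  shows "res (Hom (powM U I (insert k J)) (p(k := A)) (q(k := B))) m (ext k h P) =
    ext k (res (Hom (powM U I J) p q) m h) (res (Hom (mixed_ecat U I) A B) m P)"
  unfolding powM_res[OF ext_in[OF assms]] powM_res[OF assms(2)]
  using assms(1) by (auto simp: fun_eq_iff simp del: mixed_ecat_simps)

lemma ext_comp:
  assumes "k \<notin> J" "g \<in> fibre (Hom (powM U I J) q r) m i" "Q \<in> fibre (Hom (mixed_ecat U I) B E) m i"
    and "f \<in> fibre (Hom (powM U I J) p q) m i" "P \<in> fibre (Hom (mixed_ecat U I) A B) m i"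
  shows "Comp (powM U I (insert k J)) (p(k := A)) (q(k := B)) (r(k := E)) m (ext k g Q, ext k f P) =
    ext k (Comp (powM U I J) p q r m (g, f)) (Comp (mixed_ecat U I) A B E m (Q, P))"
  unfolding pow_comp[OF ext_in[OF assms(1,2,3)] ext_in[OF assms(1,4,5)]] pow_comp[OF assms(2,4)]
  using assms(1) by (auto simp: fun_eq_iff simp del: mixed_ecat_simps)

lemma ext_id:
  "k \<notin> J \<Longrightarrow> i \<in> car I m \<Longrightarrow> Id (powM U I (insert k J)) (p(k := A)) m i =
    ext k (Id (powM U I J) p m i) (Id (mixed_ecat U I) A m i)"
  by (auto simp: pow_id fun_eq_iff)

section \<open>Delayed hom-objects and products of enriched categories\<close>

lemma later_simps [simp]:
  "Ob (later_ecat I C) = Ob C" "Hom (later_ecat I C) A B = later_slice I (Hom C A B)"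
  by (simp_all add: later_ecat_def Let_def)

lemma later_id:
  "i \<in> car I m \<Longrightarrow> Id C A m i \<in> fibre (Hom C A A) m i \<Longrightarrow>
    Id (later_ecat I C) A m i = (i, next_tree (Hom C A A) m (Id C A m i))"
  by (simp add: later_ecat_def Let_def next_slice_eq)

lemma later_comp_0:
  assumes "i \<in> car I 0"
  shows "Comp (later_ecat I C) A B D 0 ((i, None), (i, None)) = (i, None)"
proof -
  have N: "(i, None) \<in> fibre (later_slice I Y) 0 i" for Y :: "('b, 'a) slice"
    using assms by (simp add: fibre_later)
  have "(i, None) \<in> car (later_slice I (prod_slice (Hom C B D) (Hom C A B))) 0"
    using assms by (simp add: later_slice_def pullback_def later_def later_map_def next_tree_def Let_def)
  then show ?thesis
    using car_prod_fibres[OF N N] assms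
    by (simp add: later_ecat_def Let_def later_slice_map_def later_map_def)
       (auto simp: later_def)
qed

lemma later_comp_Suc:
  assumes "i \<in> car I (Suc m)" "g \<in> fibre (Hom C B D) m (res I m i)" "f \<in> fibre (Hom C A B) m (res I m i)"
  shows "Comp (later_ecat I C) A B D (Suc m) ((i, Some g), (i, Some f)) = (i, Some (Comp C A B D m (g,
      f)))"
proof -
  have N: "(i, Some y) \<in> fibre (later_slice I Y) (Suc m) i" if "y \<in> fibre Y m (res I m i)"
    for y and Y :: "('e, 'a) slice"
    using assms(1) that by (simp add: fibre_later)
  have P: "(g, f) \<in> fibre (prod_slice (Hom C B D) (Hom C A B)) m (res I m i)"
    using assms by (simp add: fibre_prod)
  have "(i, Some (g, f)) \<in> car (later_slice I (prod_slice (Hom C B D) (Hom C A B))) (Suc m)"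
    using assms(1) P by (auto simp: fibre_def later_slice_def pullback_def later_def later_map_def
        next_tree_def Let_def)
  moreover have "Some (g, f) \<in> car (later (prod_slice (Hom C B D) (Hom C A B))) (Suc m)"
    using P by (simp add: later_def Let_def fibre_def)
  ultimately show ?thesis
    using car_prod_fibres[OF N[OF assms(2)] N[OF assms(3)]]
    by (simp add: later_ecat_def Let_def later_slice_map_def later_map_def)
qed

abbreviation (input) nx where
  "nx U I A B m P \<equiv> next_tree (Hom (mixed_ecat U I) A B) m P"

text \<open>Functoriality of \<open>next\<close>: at index 0 there is no information on either side,
  and above it composition commutes with restriction.\<close>

lemma later_comp_next:
  assumes "is_tree I" "A \<in> SO U I \<times> SO U I" "B \<in> SO U I \<times> SO U I" "E \<in> SO U I \<times> SO U I"
    and "g \<in> fibre (Hom (mixed_ecat U I) B E) m i" "f \<in> fibre (Hom (mixed_ecat U I) A B) m i"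
  shows "Comp (later_ecat I (mixed_ecat U I)) A B E m ((i, nx U I B E m g), (i, nx U I A B m f)) =
    (i, nx U I A E m (Comp (mixed_ecat U I) A B E m (g, f)))"
proof -
  have i: "i \<in> car I m" by (rule fibre_base[OF mixed_slice[OF assms(1)] assms(5)])
  note N = next_tree_eq[OF assms(5)] next_tree_eq[OF assms(6)] next_tree_eq[OF mixed_comp_in[OF
      assms(1,2,4,5,6)]]
  show ?thesis
  proof (cases m)
    case 0
    then show ?thesis unfolding N using i by (simp add: later_comp_0 del: mixed_ecat_simps)
  next
    case (Suc k)
    note gf = assms(5)[unfolded Suc] assms(6)[unfolded Suc]
    show ?thesis unfolding N unfolding Suc nat.case
      using later_comp_Suc[OF i[unfolded Suc], of _ "mixed_ecat U I"]
        fibre_res[OF mixed_slice[OF assms(1)] gf(1)] fibre_res[OF mixed_slice[OF assms(1)] gf(2)]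
        mixed_comp_res[OF assms(1-4) gf]
      by (simp del: mixed_ecat_simps)
  qed
qed

lemma prod_simps [simp]:
  "Ob (prod_ecat C D) = Ob C \<times> Ob D"
  "Hom (prod_ecat C D) A B = prod_slice (Hom C (fst A) (fst B)) (Hom D (snd A) (snd B))"
  "Id (prod_ecat C D) A m i = (Id C (fst A) m i, Id D (snd A) m i)"
  by (simp_all add: prod_ecat_def Let_def)

lemma prod_comp:
  assumes "g \<in> fibre (Hom (prod_ecat C D) B E) m i" "f \<in> fibre (Hom (prod_ecat C D) A B) m i"
  shows "Comp (prod_ecat C D) A B E m (g, f) =
    (Comp C (fst A) (fst B) (fst E) m (fst g, fst f), Comp D (snd A) (snd B) (snd E) m (snd g, snd f))"
  using car_prod_fibres[OF assms] unfolding prod_simps by (simp add: prod_ecat_def Let_def)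

section \<open>Enriched functors, fibre by fibre\<close>

lemma efunctorD:
  assumes "is_efunctor I C D G"
  shows "A \<in> Ob C \<Longrightarrow> fob G A \<in> Ob D"
    "A \<in> Ob C \<Longrightarrow> B \<in> Ob C \<Longrightarrow> h \<in> fibre (Hom C A B) m i \<Longrightarrow>
      fhom G A B m h \<in> fibre (Hom D (fob G A) (fob G B)) m i"
    "A \<in> Ob C \<Longrightarrow> B \<in> Ob C \<Longrightarrow> h \<in> fibre (Hom C A B) (Suc m) i \<Longrightarrow>
      res (Hom D (fob G A) (fob G B)) m (fhom G A B (Suc m) h) = fhom G A B m (res (Hom C A B) m h)"
    "A \<in> Ob C \<Longrightarrow> B \<in> Ob C \<Longrightarrow> E \<in> Ob C \<Longrightarrow> g \<in> fibre (Hom C B E) m i \<Longrightarrow> f \<in> fibre (Hom C A B) m i \<Longrightarrow>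
      fhom G A E m (Comp C A B E m (g, f)) =
      Comp D (fob G A) (fob G B) (fob G E) m (fhom G B E m g, fhom G A B m f)"
    "A \<in> Ob C \<Longrightarrow> i \<in> car I m \<Longrightarrow> fhom G A A m (Id C A m i) = Id D (fob G A) m i"
proof -
  have H: "fhom G A B \<in> slice_hom (Hom C A B) (Hom D (fob G A) (fob G B))"
    if "A \<in> Ob C" "B \<in> Ob C" for A B
    using assms that by (simp add: is_efunctor_def)
  show "A \<in> Ob C \<Longrightarrow> B \<in> Ob C \<Longrightarrow> h \<in> fibre (Hom C A B) m i \<Longrightarrow>
      fhom G A B m h \<in> fibre (Hom D (fob G A) (fob G B)) m i"
    by (rule slice_hom_fibre[OF H])
  show "A \<in> Ob C \<Longrightarrow> B \<in> Ob C \<Longrightarrow> h \<in> fibre (Hom C A B) (Suc m) i \<Longrightarrow>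
      res (Hom D (fob G A) (fob G B)) m (fhom G A B (Suc m) h) = fhom G A B m (res (Hom C A B) m h)"
    by (rule slice_hom_res[OF H, symmetric]) (auto simp: fibre_def)
  show "A \<in> Ob C \<Longrightarrow> fob G A \<in> Ob D"
    using assms by (simp add: is_efunctor_def)
  show "fhom G A E m (Comp C A B E m (g, f)) =
      Comp D (fob G A) (fob G B) (fob G E) m (fhom G B E m g, fhom G A B m f)"
    if "A \<in> Ob C" "B \<in> Ob C" "E \<in> Ob C" "g \<in> fibre (Hom C B E) m i" "f \<in> fibre (Hom C A B) m i"
  proof -
    have "\<forall>(g, f)\<in>car (prod_slice (Hom C B E) (Hom C A B)) m.
        fhom G A E m (Comp C A B E m (g, f)) =
        Comp D (fob G A) (fob G B) (fob G E) m (fhom G B E m g, fhom G A B m f)"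
      using assms that(1-3) unfolding is_efunctor_def by blast
    from bspec[OF this car_prod_fibres[OF that(4,5)]] show ?thesis by simp
  qed
  show "A \<in> Ob C \<Longrightarrow> i \<in> car I m \<Longrightarrow> fhom G A A m (Id C A m i) = Id D (fob G A) m i"
    using assms unfolding is_efunctor_def by blast
qed

lemma efunctorI:
  assumes "\<And>A. A \<in> Ob C \<Longrightarrow> fob G A \<in> Ob D"
    and S: "\<And>A B. A \<in> Ob C \<Longrightarrow> B \<in> Ob C \<Longrightarrow> is_slice I (Hom C A B)"
    and E: "\<And>A B m. A \<in> Ob C \<Longrightarrow> B \<in> Ob C \<Longrightarrow> fhom G A B m \<in> extensional (car (Hom C A B) m)"
    and F: "\<And>A B m i h. A \<in> Ob C \<Longrightarrow> B \<in> Ob C \<Longrightarrow> h \<in> fibre (Hom C A B) m i \<Longrightarrow>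
      fhom G A B m h \<in> fibre (Hom D (fob G A) (fob G B)) m i"
    and R: "\<And>A B m i h. A \<in> Ob C \<Longrightarrow> B \<in> Ob C \<Longrightarrow> h \<in> fibre (Hom C A B) (Suc m) i \<Longrightarrow>
      res (Hom D (fob G A) (fob G B)) m (fhom G A B (Suc m) h) = fhom G A B m (res (Hom C A B) m h)"
    and Cm: "\<And>A B E m i f g. A \<in> Ob C \<Longrightarrow> B \<in> Ob C \<Longrightarrow> E \<in> Ob C \<Longrightarrow> g \<in> fibre (Hom C B E) m i \<Longrightarrow> f \<in> fibre
        (Hom C A B) m i \<Longrightarrow>
      fhom G A E m (Comp C A B E m (g, f)) =
      Comp D (fob G A) (fob G B) (fob G E) m (fhom G B E m g, fhom G A B m f)"
    and "\<And>A m i. A \<in> Ob C \<Longrightarrow> i \<in> car I m \<Longrightarrow> fhom G A A m (Id C A m i) = Id D (fob G A) m i"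
  shows "is_efunctor I C D G"
proof -
  have "fhom G A B \<in> slice_hom (Hom C A B) (Hom D (fob G A) (fob G B))"
    if "A \<in> Ob C" "B \<in> Ob C" for A B
    using E[OF that] F[OF that] R[OF that]
    by (auto simp: slice_hom_def tree_hom_def PiE_iff fibre_def)
  moreover have "fhom G A E m (Comp C A B E m (g, f)) =
      Comp D (fob G A) (fob G B) (fob G E) m (fhom G B E m g, fhom G A B m f)"
    if "A \<in> Ob C" "B \<in> Ob C" "E \<in> Ob C" "(g, f) \<in> car (prod_slice (Hom C B E) (Hom C A B)) m"
    for A B E m g f
    by (rule Cm[OF that(1-3), of _ _ "prj (Hom C B E) m g"]) (use that(4) in \<open>auto simp: car_prod
        fibre_def\<close>)
  ultimately show ?thesis
    using assms(1,7) unfolding is_efunctor_def by blast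
qed

section \<open>Contractive functors\<close>

lemma con_fibre:
  "(h, z) \<in> fibre (Hom (conM U I J) (p, A) (q, B)) m i \<longleftrightarrow>
    h \<in> fibre (Hom (powM U I J) p q) m i \<and> z \<in> fibre (later_slice I (Hom (mixed_ecat U I) A B)) m i"
  by (simp add: fibre_prod)

lemma con_slice: "is_tree I \<Longrightarrow> is_slice I (Hom (conM U I J) A B)"
  using powM_slice[of I] mixed_slice[of I]
  by (simp add: prod_slice_is_slice later_slice_is_slice)

type_synonym 'u con_fun = "('u tuple \<times> 'u mixed, 'u obj,
  ('u \<times> (nat \<Rightarrow> 'u el \<times> 'u el)) \<times> ('u \<times> ('u el \<times> 'u el) option), 'u el) efunctor"

text \<open>\<open>K\<close> is a factor through \<open>next\<close> as provided by local
  contractiveness. \<open>J\<close> is kept arbitrary because two such factors occur, one delayed in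
  the variable \<open>n\<close> and one in a variable \<open>k < n\<close>, with different sets of
  undelayed indices.\<close>

locale con_functor =
  fixes U :: "'u set set" and I :: "'u tree" and J :: "nat set"
    and K :: "'u con_fun"
  assumes I: "is_tree I" and K: "is_efunctor I (conM U I J) (slice_ecat U I) K"
begin

abbreviation "P \<equiv> powM U I J"
abbreviation "M \<equiv> mixed_ecat U I"
abbreviation "L \<equiv> later_ecat I M"
abbreviation "act p A q B m h z \<equiv> fhom K (p, A) (q, B) m (h, z)"
abbreviation "E \<equiv> exp_slice I"

lemma con_Ob: "p \<in> Ob P \<Longrightarrow> A \<in> Ob M \<Longrightarrow> (p, A) \<in> Ob (conM U I J)"
  by simp

lemma con_SO: "p \<in> Ob P \<Longrightarrow> A \<in> Ob M \<Longrightarrow> fob K (p, A) \<in> SO U I"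
  using efunctorD(1)[OF K con_Ob] by simp

lemma act_in:
  assumes "p \<in> Ob P" "q \<in> Ob P" "A \<in> Ob M" "B \<in> Ob M"
    and "h \<in> fibre (Hom P p q) m i" "z \<in> fibre (later_slice I (Hom M A B)) m i"
  shows "act p A q B m h z \<in> fibre (E (fob K (p, A)) (fob K (q, B))) m i"
  using efunctorD(2)[OF K con_Ob[OF assms(1,3)] con_Ob[OF assms(2,4)], of "(h, z)" m i] assms(5,6)
  unfolding con_fibre by simp

lemma act_res:
  assumes "p \<in> Ob P" "q \<in> Ob P" "A \<in> Ob M" "B \<in> Ob M"
    and "h \<in> fibre (Hom P p q) (Suc m) i" "z \<in> fibre (later_slice I (Hom M A B)) (Suc m) i"
  shows "res (E (fob K (p, A)) (fob K (q, B))) m (act p A q B (Suc m) h z) =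
    act p A q B m (res (Hom P p q) m h) (res (later_slice I (Hom M A B)) m z)"
proof -
  have c: "(h, z) \<in> fibre (Hom (conM U I J) (p, A) (q, B)) (Suc m) i"
    using assms(5,6) by (simp add: con_fibre del: pow_simps prod_simps mixed_ecat_simps)
  have "res (Hom (conM U I J) (p, A) (q, B)) m (h, z) =
      (res (Hom P p q) m h, res (later_slice I (Hom M A B)) m z)"
    using c by (simp add: res_prod_fibre del: mixed_ecat_simps pow_simps)
  then show ?thesis
    using efunctorD(3)[OF K con_Ob[OF assms(1,3)] con_Ob[OF assms(2,4)] c]
    by (simp del: mixed_ecat_simps pow_simps prod_simps)
qed

lemma act_comp:
  assumes "p \<in> Ob P" "q \<in> Ob P" "r \<in> Ob P" "A \<in> Ob M" "B \<in> Ob M" "D \<in> Ob M"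
    and "g \<in> fibre (Hom P q r) m i" "w \<in> fibre (later_slice I (Hom M B D)) m i"
    and "h \<in> fibre (Hom P p q) m i" "z \<in> fibre (later_slice I (Hom M A B)) m i"
  shows "act p A r D m (Comp P p q r m (g, h)) (Comp L A B D m (w, z)) =
    exp_comp I (fob K (p, A)) (fob K (q, B)) (fob K (r, D)) m (act q B r D m g w, act p A q B m h z)"
proof -
  have c: "(h, z) \<in> fibre (Hom (conM U I J) (p, A) (q, B)) m i"
      "(g, w) \<in> fibre (Hom (conM U I J) (q, B) (r, D)) m i"
    using assms(7-10) by (simp_all add: con_fibre del: pow_simps prod_simps mixed_ecat_simps)
  show ?thesis
    using efunctorD(4)[OF K con_Ob[OF assms(1,4)] con_Ob[OF assms(2,5)] con_Ob[OF assms(3,6)] c(2,1)]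
    unfolding prod_comp[OF c(2,1)] by simp
qed

lemma act_id:
  assumes "p \<in> Ob P" "A \<in> Ob M" "i \<in> car I m"
  shows "act p A p A m (Id P p m i) (i, next_tree (Hom M A A) m (Id M A m i)) = eid I (fob K (p, A)) m i"
proof -
  have "Id L A m i = (i, next_tree (Hom M A A) m (Id M A m i))"
    using assms(2) by (intro later_id[OF assms(3)] mixed_id_in[OF I _ assms(3)]) simp
  with efunctorD(5)[OF K con_Ob[OF assms(1,2)] assms(3)] show ?thesis
    by (simp del: mixed_ecat_simps)
qed

text \<open>The composition law at arguments of the form \<open>next\<close>, which is the form that
  \<open>contractive_system\<close> asks for.\<close>

lemma act_next_comp:
  assumes "p \<in> Ob P" "q \<in> Ob P" "r \<in> Ob P" "A \<in> Ob M" "B \<in> Ob M" "D \<in> Ob M"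
    and "g \<in> fibre (Hom P q r) m i" "w \<in> fibre (Hom M B D) m i"
    and "h \<in> fibre (Hom P p q) m i" "z \<in> fibre (Hom M A B) m i"
  shows "act p A r D m (Comp P p q r m (g, h)) (i, next_tree (Hom M A D) m (Comp M A B D m (w, z))) =
    exp_comp I (fob K (p, A)) (fob K (q, B)) (fob K (r, D)) m
      (act q B r D m g (i, next_tree (Hom M B D) m w), act p A q B m h (i, next_tree (Hom M A B) m z))"
  using act_comp[OF assms(1-7) next_in_later[OF mixed_slice[OF I] assms(8)] assms(9)
      next_in_later[OF mixed_slice[OF I] assms(10)]]
    later_comp_next[OF I assms(4-6)[unfolded mixed_ecat_simps] assms(8,10)]
  by (simp only:)

lemma act_Some_res:
  assumes "p \<in> Ob P" "q \<in> Ob P" "A \<in> Ob M" "B \<in> Ob M"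
    and "h \<in> fibre (Hom P p q) (Suc m) i" "z \<in> fibre (Hom M A B) m (res I m i)"
  shows "res (E (fob K (p, A)) (fob K (q, B))) m (act p A q B (Suc m) h (i, Some z)) =
    act p A q B m (res (Hom P p q) m h) (res I m i, next_tree (Hom M A B) m z)"
proof -
  have "i \<in> car I (Suc m)" using fibre_base[OF powM_slice[OF I] assms(5)] .
  note z = later_some_in[OF this assms(6)]
  show ?thesis using act_res[OF assms(1-5) z] res_later[OF z] by (simp only:)
qed

text \<open>The set \<open>Obs\<close> is not fixed to be the set of tuples: for uniqueness, tuples are tagged by the
  solution they refer to.\<close>

lemma fixpoint_system:
  fixes u :: "'o \<Rightarrow> 'u tuple" and X :: "'o \<Rightarrow> 'u obj"
  assumes u: "\<And>p. p \<in> Obs \<Longrightarrow> u p \<in> Ob P"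
    and s: "\<And>p. p \<in> Obs \<Longrightarrow> s p \<in> Obs" "\<And>p. p \<in> Obs \<Longrightarrow> s (s p) = p"
      "\<And>p. p \<in> Obs \<Longrightarrow> u (s p) = swp J (u p)"
    and X: "\<And>p. p \<in> Obs \<Longrightarrow> X p \<in> SO U I"
    and a: "\<And>p. p \<in> Obs \<Longrightarrow> compatible I (fob K (u p, (X (s p), X p))) (X p) (a p)"
    and a': "\<And>p. p \<in> Obs \<Longrightarrow> compatible I (X p) (fob K (u p, (X (s p), X p))) (a' p)"
    and aa': "\<And>p m i. p \<in> Obs \<Longrightarrow> i \<in> car I m \<Longrightarrow>
      exp_comp I (X p) (fob K (u p, (X (s p), X p))) (X p) m (a p m i, a' p m i) = eid I (X p) m i"
    and a'a: "\<And>p m i. p \<in> Obs \<Longrightarrow> i \<in> car I m \<Longrightarrow>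
      exp_comp I (fob K (u p, (X (s p), X p))) (X p) (fob K (u p, (X (s p), X p))) m (a' p m i, a p m i) =
        eid I (fob K (u p, (X (s p), X p))) m i"
  shows "contractive_system I Obs (\<lambda>p q. Hom P (u p) (u q)) (\<lambda>p q r. Comp P (u p) (u q) (u r))
    (\<lambda>p. Id P (u p)) s (swe J) X (\<lambda>p. fob K (u p, (X (s p), X p)))
    (\<lambda>p q m h z. act (u p) (X (s p), X p) (u q) (X (s q), X q) m h (fst h, z)) a a'"
proof -
  have XP: "(X (s p), X p) \<in> Ob M" if "p \<in> Obs" for p
    using X[OF that] X[OF s(1)[OF that]] by simp
  \<comment> \<open>Pairs of unknowns are elements of a hom-object of the mixed category, so the
    lemmas on that category apply to them.\<close>
  have PP: "prod_slice (exp_slice I (X (s q)) (X (s p))) (exp_slice I (X p) (X q)) =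
      Hom M (X (s p), X p) (X (s q), X q)" for p q
    by simp
  show ?thesis
    unfolding contractive_system_def PP
  proof (intro conjI allI impI)
    fix p q h i assume A: "p \<in> Obs" "q \<in> Obs" "h \<in> fibre (Hom P (u p) (u q)) 0 i"
    then show "act (u p) (X (s p), X p) (u q) (X (s q), X q) 0 h (fst h, None)
       \<in> fibre (exp_slice I (fob K (u p, X (s p), X p)) (fob K (u q, X (s q), X q))) 0 i"
      using act_in[OF u u XP XP A(3) later_none_in] fibre_base[OF powM_slice[OF I] A(3)]
      by (simp add: powM_fibre del: pow_simps mixed_ecat_simps)
  next
    fix p q h m i W assume A: "p \<in> Obs" "q \<in> Obs" "h \<in> fibre (Hom P (u p) (u q)) (Suc m) i"
      "W \<in> fibre (Hom M (X (s p), X p) (X (s q), X q)) m (res I m i)"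
    then show "act (u p) (X (s p), X p) (u q) (X (s q), X q) (Suc m) h (fst h, Some W)
       \<in> fibre (exp_slice I (fob K (u p, X (s p), X p)) (fob K (u q, X (s q), X q))) (Suc m) i"
      using act_in[OF u u XP XP A(3) later_some_in] fibre_base[OF powM_slice[OF I] A(3)]
      by (simp add: powM_fibre del: pow_simps mixed_ecat_simps)
    show "res (exp_slice I (fob K (u p, X (s p), X p)) (fob K (u q, X (s q), X q))) m
        (act (u p) (X (s p), X p) (u q) (X (s q), X q) (Suc m) h (fst h, Some W)) =
       act (u p) (X (s p), X p) (u q) (X (s q), X q) m (res (Hom P (u p) (u q)) m h)
        (fst (res (Hom P (u p) (u q)) m h), next_tree (Hom M (X (s p), X p) (X (s q), X q)) m W)"
      using act_Some_res[OF u[OF A(1)] u[OF A(2)] XP[OF A(1)] XP[OF A(2)] A(3,4)] A(3)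
        fibre_res[OF powM_slice[OF I] A(3)]
      by (simp add: powM_fibre del: pow_simps mixed_ecat_simps)
  next
    fix p q r g m i f g2 g1 f2 f1
    assume A: "p \<in> Obs" "q \<in> Obs" "r \<in> Obs" "g \<in> fibre (Hom P (u q) (u r)) m i"
      "f \<in> fibre (Hom P (u p) (u q)) m i"
      "(g2, g1) \<in> fibre (Hom M (X (s q), X q) (X (s r), X r)) m i"
      "(f2, f1) \<in> fibre (Hom M (X (s p), X p) (X (s q), X q)) m i"
    have 1: "fst g = i" "fst f = i" "fst (Comp P (u p) (u q) (u r) m (g, f)) = i"
      using powM_comp_in[OF I u u A(4,5)] A unfolding powM_fibre by auto
    show "act (u p) (X (s p), X p) (u r) (X (s r), X r) m (Comp P (u p) (u q) (u r) m (g, f))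
        (fst (Comp P (u p) (u q) (u r) m (g, f)), next_tree (Hom M (X (s p), X p) (X (s r), X r)) m
          (exp_comp I (X (s r)) (X (s q)) (X (s p)) m (f2, g2), exp_comp I (X p) (X q) (X r) m (g1,
              f1))) =
       exp_comp I (fob K (u p, X (s p), X p)) (fob K (u q, X (s q), X q)) (fob K (u r, X (s r), X r)) m
        (act (u q) (X (s q), X q) (u r) (X (s r), X r) m g
           (fst g, next_tree (Hom M (X (s q), X q) (X (s r), X r)) m (g2, g1)),
         act (u p) (X (s p), X p) (u q) (X (s q), X q) m f
           (fst f, next_tree (Hom M (X (s p), X p) (X (s q), X q)) m (f2, f1)))"
      using act_next_comp[OF u u u XP XP XP A(4,6,5,7)] mixed_comp[OF A(6,7)] A(1-3)
      unfolding 1 by (simp del: mixed_ecat_simps)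
  next
    fix p m i assume A: "p \<in> Obs" "i \<in> car I m"
    have 1: "fst (Id P (u p) m i) = i" using A by (simp add: pow_id)
    show "act (u p) (X (s p), X p) (u p) (X (s p), X p) m (Id P (u p) m i)
        (fst (Id P (u p) m i), next_tree (Hom M (X (s p), X p) (X (s p), X p)) m
          (eid I (X (s p)) m i, eid I (X p) m i)) = eid I (fob K (u p, X (s p), X p)) m i"
      using act_id[OF u[OF A(1)] XP[OF A(1)] A(2)] unfolding 1 by simp
  next
    fix p q h m i assume A: "p \<in> Obs" "q \<in> Obs" "h \<in> fibre (Hom P (u p) (u q)) (Suc m) i"
    then show "res (Hom P (u (s q)) (u (s p))) m (swe J h) = swe J (res (Hom P (u p) (u q)) m h)"
      using powM_swap_res[OF A(3)] s(3) by (simp del: pow_simps)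
  next
    fix p q h m i assume A: "p \<in> Obs" "q \<in> Obs" "h \<in> fibre (Hom P (u p) (u q)) m i"
    show "swe J h \<in> fibre (Hom P (u (s q)) (u (s p))) m i"
      using powM_swap(1)[OF A(3)] A s(3) by (simp del: pow_simps)
    show "swe J (swe J h) = h"
      by (rule powM_swap(2)[OF A(3)])
  next
    fix p q r g m i f
    assume A: "p \<in> Obs" "q \<in> Obs" "r \<in> Obs" "g \<in> fibre (Hom P (u q) (u r)) m i"
      "f \<in> fibre (Hom P (u p) (u q)) m i"
    show "Comp P (u p) (u q) (u r) m (g, f) \<in> fibre (Hom P (u p) (u r)) m i"
      by (rule powM_comp_in[OF I u u A(4,5)]) fact+
    show "swe J (Comp P (u p) (u q) (u r) m (g, f)) =
       Comp P (u (s r)) (u (s q)) (u (s p)) m (swe J f, swe J g)"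
      using powM_swap_comp[OF A(4,5)] A s(3) by simp
  next
    fix p m i assume A: "p \<in> Obs" "i \<in> car I m"
    show "Id P (u p) m i \<in> fibre (Hom P (u p) (u p)) m i"
      by (rule powM_id_in[OF I u A(2)]) fact
    show "swe J (Id P (u p) m i) = Id P (u (s p)) m i"
      using powM_swap_id[OF A(2)] A s(3) by simp
  qed (use assms I powM_slice[OF I] SO_slice[OF con_SO[OF u XP]] SO_slice[OF X]
        in \<open>simp_all del: mixed_ecat_simps pow_simps\<close>)
qed

end

section \<open>Construction of a fixed object\<close>

text \<open>A delayed element given by a family \<open>z\<close>, of which only the entry at the
  preceding index is read. It allows index 0 and successors to be treated by one formula.\<close>

definition lat :: "nat \<Rightarrow> (nat \<Rightarrow> 'a) \<Rightarrow> 'a option" where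
  "lat m z = (case m of 0 \<Rightarrow> None | Suc k \<Rightarrow> Some (z k))"

lemma lat_cong: "(\<And>k. m = Suc k \<Longrightarrow> z k = z' k) \<Longrightarrow> lat m z = lat m z'"
  by (simp add: lat_def split: nat.split)

context con_functor
begin

text \<open>The action of \<open>F(p, -)\<close> on delayed elements, with the parameters
  \<open>p\<close> held fixed by the identity. The construction of the fixed object uses only this
  part of the action.\<close>

definition id_act :: "'u tuple \<Rightarrow> 'u mixed \<Rightarrow> 'u mixed \<Rightarrow> nat \<Rightarrow> 'u \<Rightarrow> ('u el \<times> 'u el) option \<Rightarrow> 'u el" where
  "id_act p A B m i z = act p A p B m (Id P p m i) (i, z)"

lemma id_act_in:
  assumes "p \<in> Ob P" "A \<in> Ob M" "B \<in> Ob M" "i \<in> car I m"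
    and "\<And>k. m = Suc k \<Longrightarrow> z k \<in> fibre (Hom M A B) k (res I k i)"
  shows "id_act p A B m i (lat m z) \<in> fibre (E (fob K (p, A)) (fob K (p, B))) m i"
  unfolding id_act_def
  by (rule act_in[OF assms(1,1,2,3) powM_id_in[OF I assms(1,4)]])
    (use assms(4,5) in \<open>auto simp: fibre_later lat_def split: nat.split\<close>)

text \<open>In the parameters, the identity after itself is the identity; in the last variable,
  delayed elements compose at the preceding index.\<close>

lemma id_act_comp:
  assumes "p \<in> Ob P" "A \<in> Ob M" "B \<in> Ob M" "D \<in> Ob M" "i \<in> car I m"
    and "\<And>k. m = Suc k \<Longrightarrow> z k \<in> fibre (Hom M A B) k (res I k i)"
    and "\<And>k. m = Suc k \<Longrightarrow> w k \<in> fibre (Hom M B D) k (res I k i)"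
  shows "exp_comp I (fob K (p, A)) (fob K (p, B)) (fob K (p, D)) m
      (id_act p B D m i (lat m w), id_act p A B m i (lat m z)) =
    id_act p A D m i (lat m (\<lambda>k. Comp M A B D k (w k, z k)))"
proof -
  have 1: "(i, lat m z) \<in> fibre (later_slice I (Hom M A B)) m i" "(i, lat m w) \<in> fibre (later_slice I
      (Hom M B D)) m i"
    using assms(5-7) by (auto simp: fibre_later lat_def split: nat.split)
  have "Comp L A B D m ((i, lat m w), (i, lat m z)) = (i, lat m (\<lambda>k. Comp M A B D k (w k, z k)))"
  proof (cases m)
    case 0
    then show ?thesis using assms(5) by (simp add: lat_def later_comp_0)
  next
    case (Suc k)
    then show ?thesis
      using later_comp_Suc[of i I k "w k" M B D "z k" A] assms(5-7)
      by (simp add: lat_def del: mixed_ecat_simps)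
  qed
  then show ?thesis
    unfolding id_act_def
    using act_comp[OF assms(1,1,1,2,3,4) powM_id_in[OF I assms(1,5)] 1(2) powM_id_in[OF I assms(1,5)]
        1(1)]
      powM_comp_id(1)[OF I assms(1,1) powM_id_in[OF I assms(1,5)]]
    by (simp only:)
qed

lemma id_act_id:
  assumes "p \<in> Ob P" "A \<in> Ob M" "i \<in> car I m"
    and "\<And>k. m = Suc k \<Longrightarrow> z k = Id M A k (res I k i)"
  shows "id_act p A A m i (lat m z) = eid I (fob K (p, A)) m i"
proof -
  have A: "A \<in> SO U I \<times> SO U I" using assms(2) by simp
  have "next_tree (Hom M A A) m (Id M A m i) = lat m z"
    unfolding next_tree_eq[OF mixed_id_in[OF I A assms(3)]] lat_def
    using assms(3,4) mixed_id_res[OF I A] by (auto split: nat.split simp del: mixed_ecat_simps)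
  then show ?thesis
    unfolding id_act_def using act_id[OF assms(1-3)] by (simp only:)
qed

lemma id_act_res:
  assumes "p \<in> Ob P" "A \<in> Ob M" "B \<in> Ob M" "i \<in> car I (Suc m)"
    and "z m \<in> fibre (Hom M A B) m (res I m i)"
    and "\<And>k. m = Suc k \<Longrightarrow> res (Hom M A B) k (z m) = z' k"
  shows "res (E (fob K (p, A)) (fob K (p, B))) m (id_act p A B (Suc m) i (lat (Suc m) z)) =
    id_act p A B m (res I m i) (lat m z')"
proof -
  have "next_tree (Hom M A B) m (z m) = lat m z'"
    unfolding next_tree_eq[OF assms(5)] lat_def using assms(6) by (auto split: nat.split)
  then show ?thesis
    unfolding id_act_def
    using act_Some_res[OF assms(1,1,2,3) powM_id_in[OF I assms(1,4)] assms(5)]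
      powM_id_res[OF I assms(1,4)]
    by (simp add: lat_def)
qed

end

section \<open>The iterates and their agreement at low indices\<close>

locale con_start = con_functor U I J K for U :: "'u set set" and I J K +
  fixes T :: "'u obj"
  assumes T: "T \<in> SO U I"
begin

abbreviation "s \<equiv> swp J"

text \<open>The contravariant component is not an iteration of its own: it is the covariant one at
  the swapped tuple, so a step leads from \<open>W k\<close> to
  \<open>(Z k (s p), Z k p)\<close>.\<close>

primrec W :: "nat \<Rightarrow> 'u tuple \<Rightarrow> 'u mixed" where
  "W 0 = (\<lambda>p. (T, T))"
| "W (Suc k) = (\<lambda>p. (fob K (s p, W k (s p)), fob K (p, W k p)))"

definition Z :: "nat \<Rightarrow> 'u tuple \<Rightarrow> 'u obj" where
  "Z k p = fob K (p, W k p)"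

lemma W_Suc [simp]: "W (Suc k) p = (Z k (s p), Z k p)"
  by (simp add: Z_def)

declare W.simps(2) [simp del]

lemma W_Ob: "p \<in> Ob P \<Longrightarrow> W k p \<in> Ob M"
proof (induction k arbitrary: p)
  case 0
  then show ?case using T by simp
next
  case (Suc k)
  then show ?case
    using con_SO[OF Suc(2) Suc.IH[OF Suc(2)]] con_SO[OF swp_Ob[OF Suc(2)] Suc.IH[OF swp_Ob[OF Suc(2)]]]
    by (simp add: Z_def)
qed

lemma Z_SO: "p \<in> Ob P \<Longrightarrow> Z k p \<in> SO U I"
  unfolding Z_def by (rule con_SO[OF _ W_Ob])

lemma Z_slice: "p \<in> Ob P \<Longrightarrow> is_slice I (Z k p)"
  by (rule SO_slice[OF Z_SO])

text \<open>The objects \<open>Z k p\<close> and \<open>Z l p\<close> agree up to the index \<open>min k l\<close>: \<open>\<phi> m k l p i\<close> is the part of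
  this isomorphism below \<open>i \<in> I(m)\<close>, meaningful for \<open>m \<le> min k l\<close>.\<close>

primrec \<phi> :: "nat \<Rightarrow> nat \<Rightarrow> nat \<Rightarrow> 'u tuple \<Rightarrow> 'u \<Rightarrow> 'u el" where
  "\<phi> 0 = (\<lambda>k l p i. id_act p (W k p) (W l p) 0 i None)"
| "\<phi> (Suc m) = (\<lambda>k l p i. id_act p (W k p) (W l p) (Suc m) i
     (Some (\<phi> m (l - 1) (k - 1) (s p) (res I m i), \<phi> m (k - 1) (l - 1) p (res I m i))))"

text \<open>One formula for both recursion equations. The subtractions appear because
  \<open>W k\<close> is built from \<open>Z (k - 1)\<close>; at index 0, where \<open>k\<close> or
  \<open>l\<close> may be 0, they are not read. The first entry fills a contravariant slot and runs
  from \<open>l - 1\<close> back to \<open>k - 1\<close>.\<close>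

lemma \<phi>_eq: "\<phi> m k l p i = id_act p (W k p) (W l p) m i
    (lat m (\<lambda>m. (\<phi> m (l - 1) (k - 1) (s p) (res I m i), \<phi> m (k - 1) (l - 1) p (res I m i))))"
  by (cases m) (simp_all add: lat_def)

declare \<phi>.simps [simp del]

lemma \<phi>_pair:
  assumes "\<phi> m l k (s p) i \<in> fibre (E (Z l (s p)) (Z k (s p))) m i" "\<phi> m k l p i \<in> fibre (E (Z k p) (Z
      l p)) m i"
  shows "(\<phi> m l k (s p) i, \<phi> m k l p i) \<in> fibre (Hom M (W (Suc k) p) (W (Suc l) p)) m i"
  using assms by (simp add: fibre_prod)

lemma I_res: "i \<in> car I (Suc m) \<Longrightarrow> res I m i \<in> car I m"
  by (rule tree_res_in[OF I])

lemma \<phi>_in: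
  "p \<in> Ob P \<Longrightarrow> i \<in> car I m \<Longrightarrow> m \<le> k \<Longrightarrow> m \<le> l \<Longrightarrow> \<phi> m k l p i \<in> fibre (E (Z k p) (Z l p)) m i"
proof (induction m arbitrary: k l p i)
  case 0
  show ?case
    unfolding \<phi>_eq[of 0] Z_def by (rule id_act_in[OF 0(1) W_Ob[OF 0(1)] W_Ob[OF 0(1)] 0(2)]) simp
next
  case (Suc m)
  then obtain k' l' where kl: "k = Suc k'" "l = Suc l'" "m \<le> k'" "m \<le> l'"
    by (cases k; cases l) auto
  show ?case
    unfolding \<phi>_eq[of "Suc m"] Z_def[of k] Z_def[of l]
  proof (rule id_act_in[OF Suc(2) W_Ob[OF Suc(2)] W_Ob[OF Suc(2)] Suc(3)])
    fix j assume "Suc m = Suc j"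
    then have j: "j = m" by simp
    show "(\<phi> j (l - 1) (k - 1) (s p) (res I j i), \<phi> j (k - 1) (l - 1) p (res I j i))
          \<in> fibre (Hom M (W k p) (W l p)) j (res I j i)"
      unfolding kl(1,2) diff_Suc_1 j
      by (rule \<phi>_pair[OF Suc.IH[OF swp_Ob[OF Suc(2)] I_res[OF Suc(3)] kl(4,3)]
            Suc.IH[OF Suc(2) I_res[OF Suc(3)] kl(3,4)]])
  qed
qed

lemma \<phi>_pair_in:
  assumes "p \<in> Ob P" "i \<in> car I m" "m \<le> k" "m \<le> l"
  shows "(\<phi> m l k (s p) i, \<phi> m k l p i) \<in> fibre (Hom M (W (Suc k) p) (W (Suc l) p)) m i"
  by (rule \<phi>_pair[OF \<phi>_in[OF swp_Ob[OF assms(1)] assms(2,4,3)] \<phi>_in[OF assms]])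

lemma \<phi>_pair_in':
  assumes "p \<in> Ob P" "i \<in> car I (Suc m)" "Suc m \<le> k" "Suc m \<le> l"
  shows "(\<phi> m (l - 1) (k - 1) (s p) (res I m i), \<phi> m (k - 1) (l - 1) p (res I m i))
    \<in> fibre (Hom M (W k p) (W l p)) m (res I m i)"
proof -
  obtain k' l' where kl: "k = Suc k'" "l = Suc l'" "m \<le> k'" "m \<le> l'"
    using assms(3,4) by (cases k; cases l) auto
  show ?thesis
    unfolding kl(1,2) diff_Suc_1 by (rule \<phi>_pair_in[OF assms(1) I_res[OF assms(2)] kl(3,4)])
qed

lemma \<phi>_res:
  "p \<in> Ob P \<Longrightarrow> i \<in> car I (Suc m) \<Longrightarrow> Suc m \<le> k \<Longrightarrow> Suc m \<le> l \<Longrightarrow>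
    res (E (Z k p) (Z l p)) m (\<phi> (Suc m) k l p i) = \<phi> m k l p (res I m i)"
proof (induction m arbitrary: k l p i)
  case 0
  show ?case
    unfolding \<phi>_eq[of "Suc 0"] \<phi>_eq[of 0] Z_def[of k] Z_def[of l]
    by (rule id_act_res[OF 0(1) W_Ob[OF 0(1)] W_Ob[OF 0(1)] 0(2)]) (rule \<phi>_pair_in'[OF 0], simp)
next
  case (Suc m)
  then obtain k' l' where kl: "k = Suc k'" "l = Suc l'" "Suc m \<le> k'" "Suc m \<le> l'"
    by (cases k; cases l) auto
  show ?case
    unfolding \<phi>_eq[of "Suc (Suc m)"] \<phi>_eq[of "Suc m" k] Z_def[of k] Z_def[of l]
  proof (rule id_act_res[OF Suc(2) W_Ob[OF Suc(2)] W_Ob[OF Suc(2)] Suc(3)])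
    show "(\<phi> (Suc m) (l - 1) (k - 1) (s p) (res I (Suc m) i), \<phi> (Suc m) (k - 1) (l - 1) p (res I (Suc
        m) i))
        \<in> fibre (Hom M (W k p) (W l p)) (Suc m) (res I (Suc m) i)"
      by (rule \<phi>_pair_in'[OF Suc(2-5)])
  next
    fix j assume "Suc m = Suc j"
    then have j: "j = m" by simp
    note P = \<phi>_pair_in[OF Suc(2) I_res[OF Suc(3)] kl(3,4)]
    show "res (Hom M (W k p) (W l p)) j (\<phi> (Suc m) (l - 1) (k - 1) (s p) (res I (Suc m) i), \<phi> (Suc m)
        (k - 1) (l - 1) p (res I (Suc m) i)) =
         (\<phi> j (l - 1) (k - 1) (s p) (res I j (res I (Suc m) i)), \<phi> j (k - 1) (l - 1) p (res I j (res I
             (Suc m) i)))"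
      using Suc.IH[OF Suc(2) I_res[OF Suc(3)] kl(3,4)] Suc.IH[OF swp_Ob[OF Suc(2)] I_res[OF Suc(3)]
          kl(4,3)] P
      by (simp add: kl(1,2) j res_prod_fibre)
  qed
qed

lemma \<phi>_id:
  "p \<in> Ob P \<Longrightarrow> i \<in> car I m \<Longrightarrow> m \<le> k \<Longrightarrow> \<phi> m k k p i = eid I (Z k p) m i"
proof (induction m arbitrary: k p i)
  case 0
  show ?case
    unfolding \<phi>_eq[of 0] Z_def by (rule id_act_id[OF 0(1) W_Ob[OF 0(1)] 0(2)]) simp
next
  case (Suc m)
  then obtain k' where k: "k = Suc k'" "m \<le> k'"
    by (cases k) auto
  show ?case
    unfolding \<phi>_eq[of "Suc m"] Z_def[of k]
  proof (rule id_act_id[OF Suc(2) W_Ob[OF Suc(2)] Suc(3)])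
    fix j assume "Suc m = Suc j"
    then show "(\<phi> j (k - 1) (k - 1) (s p) (res I j i), \<phi> j (k - 1) (k - 1) p (res I j i)) = Id M (W k
        p) j (res I j i)"
      using Suc.IH[OF swp_Ob[OF Suc(2)] I_res k(2)] Suc.IH[OF Suc(2) I_res k(2)] Suc(3)
      by (simp add: k(1))
  qed
qed

text \<open>Together with \<open>\<phi>_id\<close> this shows that \<open>\<phi> m l k\<close>
  inverts \<open>\<phi> m k l\<close>. In the induction the contravariant entries compose at
  \<open>s p\<close>, with the roles of \<open>k\<close> and \<open>r\<close> exchanged.\<close>

lemma \<phi>_comp:
  "p \<in> Ob P \<Longrightarrow> i \<in> car I m \<Longrightarrow> m \<le> k \<Longrightarrow> m \<le> l \<Longrightarrow> m \<le> r \<Longrightarrow>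
    exp_comp I (Z k p) (Z l p) (Z r p) m (\<phi> m l r p i, \<phi> m k l p i) = \<phi> m k r p i"
proof (induction m arbitrary: k l r p i)
  case 0
  show ?case
    unfolding \<phi>_eq[of 0] Z_def
    by (subst id_act_comp[OF 0(1) W_Ob[OF 0(1)] W_Ob[OF 0(1)] W_Ob[OF 0(1)] 0(2)]) (simp_all add: lat_def)
next
  case (Suc m)
  then obtain k' l' r' where k: "k = Suc k'" "m \<le> k'" "l = Suc l'" "m \<le> l'" "r = Suc r'" "m \<le> r'"
    by (cases k; cases l; cases r) auto
  have C: "Comp M (W k p) (W l p) (W r p) m
      ((\<phi> m (r - 1) (l - 1) (s p) (res I m i), \<phi> m (l - 1) (r - 1) p (res I m i)),
       (\<phi> m (l - 1) (k - 1) (s p) (res I m i), \<phi> m (k - 1) (l - 1) p (res I m i))) =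
      (\<phi> m (r - 1) (k - 1) (s p) (res I m i), \<phi> m (k - 1) (r - 1) p (res I m i))"
    unfolding mixed_comp[OF \<phi>_pair_in'[OF Suc(2,3,5,6)] \<phi>_pair_in'[OF Suc(2,3,4,5)]]
    using Suc.IH[OF Suc(2) I_res[OF Suc(3)] k(2,4,6)] Suc.IH[OF swp_Ob[OF Suc(2)] I_res[OF Suc(3)]
        k(6,4,2)]
    by (simp add: k(1,3,5))
  show ?case
    unfolding \<phi>_eq[of "Suc m"] Z_def
    by (subst id_act_comp[OF Suc(2) W_Ob[OF Suc(2)] W_Ob[OF Suc(2)] W_Ob[OF Suc(2)] Suc(3)])
      (use Suc \<phi>_pair_in' C in \<open>auto simp: lat_def simp del: mixed_ecat_simps pow_simps\<close>)
qed

lemma \<phi>_rst: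
  assumes "p \<in> Ob P" "j \<le> m" "i \<in> car I m" "m \<le> k" "m \<le> l" "r \<le> j"
  shows "snd (\<phi> j k l p (rst I j m i)) r = snd (\<phi> m k l p i) r"
  using assms(2-5)
proof (induction m arbitrary: i)
  case (Suc m)
  show ?case
  proof (cases "j = Suc m")
    case False
    with Suc(2) have j: "j \<le> m" by simp
    then have "snd (\<phi> j k l p (rst I j (Suc m) i)) r = snd (\<phi> j k l p (rst I j m (res I m i))) r"
      by (simp only: rst_Suc)
    also have "\<dots> = snd (\<phi> m k l p (res I m i)) r"
      by (rule Suc.IH[OF j I_res[OF Suc(3)]]) (use Suc(4,5) in simp_all)
    also have "\<dots> = snd (\<phi> (Suc m) k l p i) r"
      by (rule exp_res_snd[OF \<phi>_in[OF assms(1) Suc(3-5)] le_trans[OF assms(6) j],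
            unfolded \<phi>_res[OF assms(1) Suc(3-5)]])
    finally show ?thesis .
  qed (simp only: rst_self)
qed (simp only: rst.simps(1) le_zero_eq)

lemma \<phi>_ap:
  "p \<in> Ob P \<Longrightarrow> i \<in> car I m \<Longrightarrow> m \<le> k \<Longrightarrow> m \<le> l \<Longrightarrow> x \<in> fibre (Z k p) m i \<Longrightarrow>
    snd (\<phi> m k l p i) m x \<in> fibre (Z l p) m i"
  using exp_ap[OF \<phi>_in, of p i m k l m x] by simp

lemma \<phi>_\<phi>:
  assumes "p \<in> Ob P" "i \<in> car I m" "m \<le> k" "m \<le> l" "m \<le> r" "x \<in> fibre (Z k p) m i"
  shows "snd (\<phi> m l r p i) m (snd (\<phi> m k l p i) m x) = snd (\<phi> m k r p i) m x"
  using exp_comp_snd[OF \<phi>_in[OF assms(1,2,4,5)] \<phi>_in[OF assms(1-4)], of m x] assms(6)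
  unfolding \<phi>_comp[OF assms(1-5)] by simp

lemma \<phi>_same: "p \<in> Ob P \<Longrightarrow> i \<in> car I m \<Longrightarrow> m \<le> k \<Longrightarrow> x \<in> fibre (Z k p) m i \<Longrightarrow> snd (\<phi> m k k p i) m x = x"
  using exp_name_snd[of i I m m x "Z k p" "hid (Z k p)"] by (simp add: \<phi>_id hid_def fibre_def del:
      pow_simps)

text \<open>Commutation with restriction is part of being an element of the exponential;
  \<open>\<phi>_rst\<close> identifies the lower component with the one of \<open>\<phi> m\<close>
  over the restricted point.\<close>

lemma \<phi>_nat:
  assumes "p \<in> Ob P" "i \<in> car I (Suc m)" "Suc m \<le> k" "Suc m \<le> l" "x \<in> fibre (Z k p) (Suc m) i"
  shows "res (Z l p) m (snd (\<phi> (Suc m) k l p i) (Suc m) x) = snd (\<phi> m k l p (res I m i)) m (res (Z k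
      p) m x)"
  using exp_comm[OF \<phi>_in[OF assms(1-4)], of m x] assms(5) \<phi>_rst[OF assms(1) _ assms(2-4), of m m]
  by simp

text \<open>Index \<open>n\<close> is taken from \<open>Z n p\<close>, the first iterate for which
  \<open>\<phi> n\<close> is available. Consecutive indices belong to different iterates, so a
  restriction inside \<open>Z (Suc n) p\<close> is followed by the transport to
  \<open>Z n p\<close>.\<close>

definition Lim :: "'u tuple \<Rightarrow> 'u obj" where
  "Lim p = \<lparr>car = (\<lambda>n. car (Z n p) n),
     res = (\<lambda>n. \<lambda>x\<in>car (Z (Suc n) p) (Suc n).
       let y = res (Z (Suc n) p) n x in snd (\<phi> n (Suc n) n p (prj (Z (Suc n) p) n y)) n y),
     prj = (\<lambda>n. prj (Z n p) n)\<rparr>"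

lemma Lim_fibre: "fibre (Lim p) n i = fibre (Z n p) n i"
  by (simp add: fibre_def Lim_def)

lemma Lim_res:
  assumes "p \<in> Ob P" "x \<in> fibre (Z (Suc n) p) (Suc n) i"
  shows "res (Lim p) n x = snd (\<phi> n (Suc n) n p (res I n i)) n (res (Z (Suc n) p) n x)"
  using assms fibre_res[OF Z_slice[OF assms(1)] assms(2)] by (simp add: Lim_def fibre_def)

lemma Lim_SO:
  assumes p: "p \<in> Ob P"
  shows "Lim p \<in> SO U I"
proof -
  have "is_slice I (Lim p)"
  proof (rule is_sliceI)
    show "res (Lim p) m \<in> extensional (car (Lim p) (Suc m))" for m
      by (simp add: Lim_def)
    show "prj (Lim p) m \<in> extensional (car (Lim p) m)" for m
      using Z_slice[OF p, of m] by (auto simp: Lim_def is_slice_def tree_hom_def PiE_iff)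
    show "prj (Lim p) m x \<in> car I m" if "x \<in> car (Lim p) m" for m x
      using that is_sliceD(2)[OF Z_slice[OF p]] by (simp add: Lim_def)
    show "res (Lim p) m x \<in> fibre (Lim p) m (res I m (prj (Lim p) (Suc m) x))"
      if "x \<in> car (Lim p) (Suc m)" for m x
    proof -
      have x: "x \<in> fibre (Z (Suc m) p) (Suc m) (prj (Lim p) (Suc m) x)"
        using that by (simp add: Lim_def fibre_def)
      show ?thesis
        unfolding Lim_fibre Lim_res[OF p x]
        by (rule \<phi>_ap[OF p I_res[OF fibre_base[OF Z_slice[OF p] x]] _ _ fibre_res[OF Z_slice[OF p]
            x]]) auto
    qed
  qed
  \<comment> \<open>Every carrier of \<open>Lim p\<close> is literally a carrier of some
    \<open>Z n p\<close>.\<close>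
  moreover have "in_universe U (Lim p)"
    using Z_SO[OF p] by (auto simp: in_universe_def Lim_def slice_objects_def)
  ultimately show ?thesis by (simp add: slice_objects_def)
qed

lemma Lim_slice: "p \<in> Ob P \<Longrightarrow> is_slice I (Lim p)"
  by (rule SO_slice[OF Lim_SO])

text \<open>The isomorphism from \<open>Z k p\<close> to \<open>Lim p\<close> up to an index
  \<open>m \<le> k\<close>. At \<open>j\<close> it lands in \<open>Z j p\<close>, the iterate that
  \<open>Lim p\<close> consists of there. Its inverse is \<open>\<kappa>'\<close>.\<close>

definition \<kappa> :: "nat \<Rightarrow> nat \<Rightarrow> 'u tuple \<Rightarrow> 'u \<Rightarrow> 'u el" where
  "\<kappa> m k p i = (i, \<lambda>j\<in>{..m}. \<lambda>x\<in>fibre (Z k p) j (rst I j m i). snd (\<phi> j k j p (rst I j m i)) j x)"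

definition \<kappa>' :: "nat \<Rightarrow> nat \<Rightarrow> 'u tuple \<Rightarrow> 'u \<Rightarrow> 'u el" where
  "\<kappa>' m k p i = (i, \<lambda>j\<in>{..m}. \<lambda>x\<in>fibre (Lim p) j (rst I j m i). snd (\<phi> j j k p (rst I j m i)) j x)"

lemma \<kappa>_in:
  assumes p: "p \<in> Ob P" and i: "i \<in> car I m" and k: "m \<le> k"
  shows "\<kappa> m k p i \<in> fibre (E (Z k p) (Lim p)) m i"
  unfolding \<kappa>_def
proof (rule expI[OF I i])
  note ri = rst_in[OF I i]
  show "snd (\<phi> j k j p (rst I j m i)) j x \<in> fibre (Lim p) j (rst I j m i)"
    if "j \<le> m" "x \<in> fibre (Z k p) j (rst I j m i)" for j x
    unfolding Lim_fibre by (rule \<phi>_ap[OF p ri]) (use that k in auto)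
  show "res (Z k p) j x \<in> fibre (Z k p) j (rst I j m i) \<and>
    snd (\<phi> j k j p (rst I j m i)) j (res (Z k p) j x) =
    res (Lim p) j (snd (\<phi> (Suc j) k (Suc j) p (rst I (Suc j) m i)) (Suc j) x)"
    if j: "j < m" "x \<in> fibre (Z k p) (Suc j) (rst I (Suc j) m i)" for j x
  proof -
    let ?i = "rst I (Suc j) m i"
    have i': "?i \<in> car I (Suc j)" "rst I j m i = res I j ?i" using ri[of "Suc j"] j(1) by (auto simp:
        res_rst)
    have y: "snd (\<phi> (Suc j) k (Suc j) p ?i) (Suc j) x \<in> fibre (Z (Suc j) p) (Suc j) ?i"
      by (rule \<phi>_ap[OF p i'(1)]) (use j k in auto)
    have rx: "res (Z k p) j x \<in> fibre (Z k p) j (res I j ?i)"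
      by (rule fibre_res[OF Z_slice[OF p] j(2)])
    \<comment> \<open>Restricting in \<open>Lim p\<close> adds a transport from
      \<open>Z (Suc j) p\<close> to \<open>Z j p\<close>; by naturality and the composition law of
      \<open>\<phi>\<close> both routes give \<open>\<phi> j k j\<close> at the restricted
      element.\<close>
    show ?thesis
      unfolding Lim_res[OF p y] i'(2)
      using rx \<phi>_nat[OF p i'(1) _ _ j(2)] \<phi>_\<phi>[OF p I_res[OF i'(1)] _ _ _ rx] k j(1)
      by (simp del: pow_simps)
  qed
qed

lemma \<kappa>'_in:
  assumes p: "p \<in> Ob P" and i: "i \<in> car I m" and k: "m \<le> k"
  shows "\<kappa>' m k p i \<in> fibre (E (Lim p) (Z k p)) m i"
  unfolding \<kappa>'_def
proof (rule expI[OF I i])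
  note ri = rst_in[OF I i]
  show "snd (\<phi> j j k p (rst I j m i)) j x \<in> fibre (Z k p) j (rst I j m i)"
    if "j \<le> m" "x \<in> fibre (Lim p) j (rst I j m i)" for j x
    by (rule \<phi>_ap[OF p ri]) (use that k in \<open>auto simp: Lim_fibre\<close>)
  show "res (Lim p) j x \<in> fibre (Lim p) j (rst I j m i) \<and>
    snd (\<phi> j j k p (rst I j m i)) j (res (Lim p) j x) =
    res (Z k p) j (snd (\<phi> (Suc j) (Suc j) k p (rst I (Suc j) m i)) (Suc j) x)"
    if j: "j < m" "x \<in> fibre (Lim p) (Suc j) (rst I (Suc j) m i)" for j x
  proof -
    let ?i = "rst I (Suc j) m i"
    have i': "?i \<in> car I (Suc j)" "rst I j m i = res I j ?i" using ri[of "Suc j"] j(1) by (auto simp: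
        res_rst)
    have x: "x \<in> fibre (Z (Suc j) p) (Suc j) ?i" using j(2) by (simp add: Lim_fibre)
    have rx: "res (Z (Suc j) p) j x \<in> fibre (Z (Suc j) p) j (res I j ?i)"
      by (rule fibre_res[OF Z_slice[OF p] x])
    show ?thesis
      unfolding i'(2)
      using fibre_res[OF Lim_slice[OF p] j(2)] \<phi>_nat[OF p i'(1) _ _ x] \<phi>_\<phi>[OF p I_res[OF i'(1)] _ _ _
          rx] k j(1)
      by (simp add: Lim_res[OF p x] del: pow_simps)
  qed
qed

lemma \<kappa>_snd: "j \<le> m \<Longrightarrow> x \<in> fibre (Z k p) j (rst I j m i) \<Longrightarrow>
    snd (\<kappa> m k p i) j x = snd (\<phi> j k j p (rst I j m i)) j x"
  and \<kappa>'_snd: "j \<le> m \<Longrightarrow> x \<in> fibre (Z j p) j (rst I j m i) \<Longrightarrow>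
    snd (\<kappa>' m k p i) j x = snd (\<phi> j j k p (rst I j m i)) j x"
  by (simp_all add: \<kappa>_def \<kappa>'_def Lim_fibre)

lemma \<kappa>_res:
  assumes "p \<in> Ob P" "i \<in> car I (Suc m)" "Suc m \<le> k"
  shows "res (E (Z k p) (Lim p)) m (\<kappa> (Suc m) k p i) = \<kappa> m k p (res I m i)"
    "res (E (Lim p) (Z k p)) m (\<kappa>' (Suc m) k p i) = \<kappa>' m k p (res I m i)"
proof -
  have k: "m \<le> k" using assms(3) by simp
  note K = \<kappa>_in[OF assms] \<kappa>'_in[OF assms] \<kappa>_in[OF assms(1) I_res[OF assms(2)] k] \<kappa>'_in[OF assms(1)
      I_res[OF assms(2)] k]
  show "res (E (Z k p) (Lim p)) m (\<kappa> (Suc m) k p i) = \<kappa> m k p (res I m i)"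
    by (rule exp_ext[OF exp_res_in[OF I K(1)] K(3)])
      (simp add: exp_res_snd[OF K(1)] \<kappa>_snd)
  show "res (E (Lim p) (Z k p)) m (\<kappa>' (Suc m) k p i) = \<kappa>' m k p (res I m i)"
    by (rule exp_ext[OF exp_res_in[OF I K(2)] K(4)])
      (simp add: exp_res_snd[OF K(2)] \<kappa>'_snd Lim_fibre)
qed

lemma \<kappa>_inv:
  assumes p: "p \<in> Ob P" and i: "i \<in> car I m" and k: "m \<le> k"
  shows "exp_comp I (Lim p) (Z k p) (Lim p) m (\<kappa> m k p i, \<kappa>' m k p i) = eid I (Lim p) m i"
    "exp_comp I (Z k p) (Lim p) (Z k p) m (\<kappa>' m k p i, \<kappa> m k p i) = eid I (Z k p) m i"
proof -
  note K = \<kappa>_in[OF assms] \<kappa>'_in[OF assms]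
  note ri = rst_in[OF I i]
  show "exp_comp I (Lim p) (Z k p) (Lim p) m (\<kappa> m k p i, \<kappa>' m k p i) = eid I (Lim p) m i"
  proof (rule exp_ext[OF exp_comp_in[OF I Lim_slice[OF p] K] eid_in[OF I Lim_slice[OF p] i]])
    fix j x assume j: "j \<le> m" "x \<in> fibre (Lim p) j (rst I j m i)"
    then have x: "x \<in> fibre (Z j p) j (rst I j m i)" by (simp add: Lim_fibre)
    show "snd (exp_comp I (Lim p) (Z k p) (Lim p) m (\<kappa> m k p i, \<kappa>' m k p i)) j x = snd (eid I (Lim p)
        m i) j x"
      using j k x p i ri[OF j(1)]
      by (simp add: exp_comp_snd[OF K] exp_name_snd \<kappa>'_snd \<kappa>_snd \<phi>_ap \<phi>_\<phi> \<phi>_same del: pow_simps)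
        (simp add: hid_def fibre_def)
  qed
  show "exp_comp I (Z k p) (Lim p) (Z k p) m (\<kappa>' m k p i, \<kappa> m k p i) = eid I (Z k p) m i"
  proof (rule exp_ext[OF exp_comp_in[OF I Z_slice[OF p] K(2,1)] eid_in[OF I Z_slice[OF p] i]])
    fix j x assume j: "j \<le> m" "x \<in> fibre (Z k p) j (rst I j m i)"
    show "snd (exp_comp I (Z k p) (Lim p) (Z k p) m (\<kappa>' m k p i, \<kappa> m k p i)) j x = snd (eid I (Z k p)
        m i) j x"
      using j k p i ri[OF j(1)]
      by (simp add: exp_comp_snd[OF K(2,1)] exp_name_snd \<kappa>'_snd \<kappa>_snd \<phi>_ap \<phi>_\<phi> \<phi>_same del: pow_simps)
        (simp add: hid_def fibre_def)
  qed
qed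

text \<open>The composition law of \<open>\<phi>\<close>, applied at each index up to
  \<open>m\<close>. It makes the choice of the iterate immaterial when \<open>Lim p\<close> is
  compared with other objects.\<close>

lemma \<kappa>_\<phi>:
  assumes p: "p \<in> Ob P" and i: "i \<in> car I m" and k: "m \<le> k" "m \<le> l"
  shows "exp_comp I (Z k p) (Z l p) (Lim p) m (\<kappa> m l p i, \<phi> m k l p i) = \<kappa> m k p i"
    "exp_comp I (Lim p) (Z k p) (Z l p) m (\<phi> m k l p i, \<kappa>' m k p i) = \<kappa>' m l p i"
proof -
  note K = \<kappa>_in[OF p i k(2)] \<phi>_in[OF p i k] \<kappa>'_in[OF p i k(1)]
  note ri = rst_in[OF I i]
  have R: "snd (\<phi> m k l p i) j = snd (\<phi> j k l p (rst I j m i)) j" if "j \<le> m" for j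
    using \<phi>_rst[OF p that i k] by simp
  show "exp_comp I (Z k p) (Z l p) (Lim p) m (\<kappa> m l p i, \<phi> m k l p i) = \<kappa> m k p i"
    by (rule exp_ext[OF exp_comp_in[OF I Z_slice[OF p] K(1,2)] \<kappa>_in[OF p i k(1)]])
      (use k p ri in \<open>simp add: exp_comp_snd[OF K(1,2)] \<kappa>_snd \<phi>_ap \<phi>_\<phi> R del: pow_simps\<close>)
  show "exp_comp I (Lim p) (Z k p) (Z l p) m (\<phi> m k l p i, \<kappa>' m k p i) = \<kappa>' m l p i"
    by (rule exp_ext[OF exp_comp_in[OF I Lim_slice[OF p] K(2,3)] \<kappa>'_in[OF p i k(2)]])
      (use k p ri in \<open>simp add: exp_comp_snd[OF K(2,3)] \<kappa>'_snd \<phi>_ap \<phi>_\<phi> R Lim_fibre del: pow_simps\<close>)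
qed

section \<open>Folding and unfolding of the fixed object\<close>

abbreviation "LP p \<equiv> (Lim (s p), Lim p)"
abbreviation "KL p \<equiv> fob K (p, LP p)"

text \<open>\<open>F(p, -)\<close> applied to \<open>\<kappa>\<close>: at index \<open>m\<close>
  only \<open>\<kappa>\<close> at \<open>m - 1\<close> is used, for the iterates
  \<open>Z (k - 1)\<close> of which \<open>W k\<close> is made. This is where contractiveness gains
  an index. The inverse is \<open>\<gamma>'\<close>.\<close>

definition \<gamma> :: "nat \<Rightarrow> nat \<Rightarrow> 'u tuple \<Rightarrow> 'u \<Rightarrow> 'u el" where
  "\<gamma> m k p i = id_act p (LP p) (W k p) m i
     (lat m (\<lambda>m. (\<kappa> m (k - 1) (s p) (res I m i), \<kappa>' m (k - 1) p (res I m i))))"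

definition \<gamma>' :: "nat \<Rightarrow> nat \<Rightarrow> 'u tuple \<Rightarrow> 'u \<Rightarrow> 'u el" where
  "\<gamma>' m k p i = id_act p (W k p) (LP p) m i
     (lat m (\<lambda>m. (\<kappa>' m (k - 1) (s p) (res I m i), \<kappa> m (k - 1) p (res I m i))))"

lemma LP_Ob: "p \<in> Ob P \<Longrightarrow> LP p \<in> Ob M"
  using Lim_SO[of p] Lim_SO[OF swp_Ob[of p]] by simp

lemma KL_SO: "p \<in> Ob P \<Longrightarrow> KL p \<in> SO U I"
  by (rule con_SO[OF _ LP_Ob])

lemma \<kappa>_pair:
  assumes "p \<in> Ob P" "i \<in> car I (Suc m)" "Suc m \<le> k"
  shows "(\<kappa> m (k - 1) (s p) (res I m i), \<kappa>' m (k - 1) p (res I m i)) \<in> fibre (Hom M (LP p) (W k p)) m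
      (res I m i)"
    "(\<kappa>' m (k - 1) (s p) (res I m i), \<kappa> m (k - 1) p (res I m i)) \<in> fibre (Hom M (W k p) (LP p)) m (res
        I m i)"
proof -
  obtain k' where k: "k = Suc k'" "m \<le> k'" using assms(3) by (cases k) auto
  show "(\<kappa> m (k - 1) (s p) (res I m i), \<kappa>' m (k - 1) p (res I m i)) \<in> fibre (Hom M (LP p) (W k p)) m
      (res I m i)"
    "(\<kappa>' m (k - 1) (s p) (res I m i), \<kappa> m (k - 1) p (res I m i)) \<in> fibre (Hom M (W k p) (LP p)) m (res
        I m i)"
    unfolding mixed_fibre
    using \<kappa>_in[OF assms(1) I_res[OF assms(2)] k(2)] \<kappa>'_in[OF assms(1) I_res[OF assms(2)] k(2)]
      \<kappa>_in[OF swp_Ob[OF assms(1)] I_res[OF assms(2)] k(2)] \<kappa>'_in[OF swp_Ob[OF assms(1)] I_res[OF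
          assms(2)] k(2)]
    by (simp_all add: k(1))
qed

lemma \<gamma>_in:
  assumes "p \<in> Ob P" "i \<in> car I m" "m \<le> k"
  shows "\<gamma> m k p i \<in> fibre (E (KL p) (Z k p)) m i" "\<gamma>' m k p i \<in> fibre (E (Z k p) (KL p)) m i"
proof -
  show "\<gamma> m k p i \<in> fibre (E (KL p) (Z k p)) m i"
    unfolding \<gamma>_def Z_def
  proof (rule id_act_in[OF assms(1) LP_Ob[OF assms(1)] W_Ob[OF assms(1)] assms(2)])
    fix j assume "m = Suc j"
    then show "(\<kappa> j (k - 1) (s p) (res I j i), \<kappa>' j (k - 1) p (res I j i)) \<in> fibre (Hom M (LP p) (W k
        p)) j (res I j i)"
      using assms by (intro \<kappa>_pair(1)) simp_all
  qed
  show "\<gamma>' m k p i \<in> fibre (E (Z k p) (KL p)) m i"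
    unfolding \<gamma>'_def Z_def
  proof (rule id_act_in[OF assms(1) W_Ob[OF assms(1)] LP_Ob[OF assms(1)] assms(2)])
    fix j assume "m = Suc j"
    then show "(\<kappa>' j (k - 1) (s p) (res I j i), \<kappa> j (k - 1) p (res I j i)) \<in> fibre (Hom M (W k p) (LP
        p)) j (res I j i)"
      using assms by (intro \<kappa>_pair(2)) simp_all
  qed
qed

lemma \<gamma>_res:
  assumes "p \<in> Ob P" "i \<in> car I (Suc m)" "Suc m \<le> k"
  shows "res (E (KL p) (Z k p)) m (\<gamma> (Suc m) k p i) = \<gamma> m k p (res I m i)"
    "res (E (Z k p) (KL p)) m (\<gamma>' (Suc m) k p i) = \<gamma>' m k p (res I m i)"
proof -
  have R: "res (Hom M (LP p) (W k p)) j (\<kappa> m (k - 1) (s p) (res I m i), \<kappa>' m (k - 1) p (res I m i)) =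
        (\<kappa> j (k - 1) (s p) (res I j (res I m i)), \<kappa>' j (k - 1) p (res I j (res I m i)))"
      "res (Hom M (W k p) (LP p)) j (\<kappa>' m (k - 1) (s p) (res I m i), \<kappa> m (k - 1) p (res I m i)) =
        (\<kappa>' j (k - 1) (s p) (res I j (res I m i)), \<kappa> j (k - 1) p (res I j (res I m i)))"
    if m: "m = Suc j" for j
  proof -
    obtain k' where k: "k = Suc k'" "Suc j \<le> k'" using assms(3) m by (cases k) auto
    show "res (Hom M (LP p) (W k p)) j (\<kappa> m (k - 1) (s p) (res I m i), \<kappa>' m (k - 1) p (res I m i)) =
        (\<kappa> j (k - 1) (s p) (res I j (res I m i)), \<kappa>' j (k - 1) p (res I j (res I m i)))"
      "res (Hom M (W k p) (LP p)) j (\<kappa>' m (k - 1) (s p) (res I m i), \<kappa> m (k - 1) p (res I m i)) =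
        (\<kappa>' j (k - 1) (s p) (res I j (res I m i)), \<kappa> j (k - 1) p (res I j (res I m i)))"
      using \<kappa>_pair[OF assms] assms(2) \<kappa>_res[OF assms(1) _ k(2)] \<kappa>_res[OF swp_Ob[OF assms(1)] _ k(2)]
      by (simp_all add: m res_prod_fibre k(1) I_res)
  qed
  show "res (E (KL p) (Z k p)) m (\<gamma> (Suc m) k p i) = \<gamma> m k p (res I m i)"
    unfolding \<gamma>_def Z_def
    by (rule id_act_res[OF assms(1) LP_Ob[OF assms(1)] W_Ob[OF assms(1)] assms(2)])
      (rule \<kappa>_pair(1)[OF assms], rule R(1))
  show "res (E (Z k p) (KL p)) m (\<gamma>' (Suc m) k p i) = \<gamma>' m k p (res I m i)"
    unfolding \<gamma>'_def Z_def
    by (rule id_act_res[OF assms(1) W_Ob[OF assms(1)] LP_Ob[OF assms(1)] assms(2)])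
      (rule \<kappa>_pair(2)[OF assms], rule R(2))
qed

text \<open>As \<open>id_act\<close> preserves composition and identities, this is
  \<open>\<kappa>_inv\<close> one index lower.\<close>

lemma \<gamma>_inv:
  assumes p: "p \<in> Ob P" and i: "i \<in> car I m" and k: "m \<le> k"
  shows "exp_comp I (KL p) (Z k p) (KL p) m (\<gamma>' m k p i, \<gamma> m k p i) = eid I (KL p) m i"
    "exp_comp I (Z k p) (KL p) (Z k p) m (\<gamma> m k p i, \<gamma>' m k p i) = eid I (Z k p) m i"
proof -
  let ?z = "\<lambda>m. (\<kappa> m (k - 1) (s p) (res I m i), \<kappa>' m (k - 1) p (res I m i))"
  let ?w = "\<lambda>m. (\<kappa>' m (k - 1) (s p) (res I m i), \<kappa> m (k - 1) p (res I m i))"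
  note LW = LP_Ob[OF p] W_Ob[OF p, of k]
  have zw: "?z j \<in> fibre (Hom M (LP p) (W k p)) j (res I j i)" "?w j \<in> fibre (Hom M (W k p) (LP p)) j
      (res I j i)"
    if "m = Suc j" for j
    using \<kappa>_pair[OF p, of i j k] i k that by simp_all
  have C: "Comp M (LP p) (W k p) (LP p) j (?w j, ?z j) = Id M (LP p) j (res I j i)"
    "Comp M (W k p) (LP p) (W k p) j (?z j, ?w j) = Id M (W k p) j (res I j i)" if m: "m = Suc j" for j
  proof -
    obtain k' where k': "k = Suc k'" "j \<le> k'" using k m by (cases k) auto
    have i': "res I j i \<in> car I j" using I_res i m by simp
    show "Comp M (LP p) (W k p) (LP p) j (?w j, ?z j) = Id M (LP p) j (res I j i)"
      "Comp M (W k p) (LP p) (W k p) j (?z j, ?w j) = Id M (W k p) j (res I j i)"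
      unfolding mixed_comp[OF zw(2,1)[OF m]] mixed_comp[OF zw[OF m]]
      using \<kappa>_inv[OF p i' k'(2)] \<kappa>_inv[OF swp_Ob[OF p] i' k'(2)] by (simp_all add: k'(1))
  qed
  show "exp_comp I (KL p) (Z k p) (KL p) m (\<gamma>' m k p i, \<gamma> m k p i) = eid I (KL p) m i"
    unfolding \<gamma>_def \<gamma>'_def Z_def
    by (rule trans[OF id_act_comp[where z="?z" and w="?w", OF p LW(1,2,1) i]])
      (erule zw(1), erule zw(2), rule id_act_id[OF p LW(1) i], erule C(1))
  show "exp_comp I (Z k p) (KL p) (Z k p) m (\<gamma> m k p i, \<gamma>' m k p i) = eid I (Z k p) m i"
    unfolding \<gamma>_def \<gamma>'_def Z_def
    by (rule trans[OF id_act_comp[where z="?w" and w="?z", OF p LW(2,1,2) i]])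
      (erule zw(2), erule zw(1), rule id_act_id[OF p LW(2) i], erule C(2))
qed

lemma \<gamma>_\<phi>:
  assumes p: "p \<in> Ob P" and i: "i \<in> car I m" and kl: "m \<le> k" "m \<le> l"
  shows "exp_comp I (KL p) (Z k p) (Z l p) m (\<phi> m k l p i, \<gamma> m k p i) = \<gamma> m l p i"
    "exp_comp I (Z k p) (Z l p) (KL p) m (\<gamma>' m l p i, \<phi> m k l p i) = \<gamma>' m k p i"
proof -
  let ?z = "\<lambda>k m. (\<kappa> m (k - 1) (s p) (res I m i), \<kappa>' m (k - 1) p (res I m i))"
  let ?w = "\<lambda>k m. (\<kappa>' m (k - 1) (s p) (res I m i), \<kappa> m (k - 1) p (res I m i))"
  let ?f = "\<lambda>m. (\<phi> m (l - 1) (k - 1) (s p) (res I m i), \<phi> m (k - 1) (l - 1) p (res I m i))"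
  note LW = LP_Ob[OF p] W_Ob[OF p, of k] W_Ob[OF p, of l]
  have z: "?z k j \<in> fibre (Hom M (LP p) (W k p)) j (res I j i)"
    and w: "?w l j \<in> fibre (Hom M (W l p) (LP p)) j (res I j i)"
    and f: "?f j \<in> fibre (Hom M (W k p) (W l p)) j (res I j i)"
    if m: "m = Suc j" for j
    using \<kappa>_pair(1)[OF p, of i j k] \<kappa>_pair(2)[OF p, of i j l] \<phi>_pair_in'[OF p, of i j k l] i kl m by
        simp_all
  have C: "Comp M (LP p) (W k p) (W l p) j (?f j, ?z k j) = ?z l j"
    "Comp M (W k p) (W l p) (LP p) j (?w l j, ?f j) = ?w k j" if m: "m = Suc j" for j
  proof -
    obtain k' l' where k': "k = Suc k'" "j \<le> k'" "l = Suc l'" "j \<le> l'" using kl m by (cases k; cases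
        l) auto
    have i': "res I j i \<in> car I j" using I_res i m by simp
    show "Comp M (LP p) (W k p) (W l p) j (?f j, ?z k j) = ?z l j"
      "Comp M (W k p) (W l p) (LP p) j (?w l j, ?f j) = ?w k j"
      unfolding mixed_comp[OF f[OF m] z[OF m]] mixed_comp[OF w[OF m] f[OF m]]
      using \<kappa>_\<phi>[OF p i' k'(2,4)] \<kappa>_\<phi>[OF swp_Ob[OF p] i' k'(4,2)] by (simp_all add: k'(1,3))
  qed
  show "exp_comp I (KL p) (Z k p) (Z l p) m (\<phi> m k l p i, \<gamma> m k p i) = \<gamma> m l p i"
    unfolding \<gamma>_def \<phi>_eq[of m k l] Z_def
    by (rule trans[OF id_act_comp[where z="?z k" and w="?f", OF p LW i]])
      (erule z, erule f, rule arg_cong[where f="id_act p (LP p) (W l p) m i"], rule lat_cong, erule C(1))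
  show "exp_comp I (Z k p) (Z l p) (KL p) m (\<gamma>' m l p i, \<phi> m k l p i) = \<gamma>' m k p i"
    unfolding \<gamma>'_def \<phi>_eq[of m k l] Z_def
    by (rule trans[OF id_act_comp[where z="?f" and w="?w l", OF p LW(2,3,1) i]])
      (erule f, erule w, rule arg_cong[where f="id_act p (W k p) (LP p) m i"], rule lat_cong, erule C(2))
qed

text \<open>At index \<open>m\<close> the passage goes through \<open>Z m p\<close>. Any
  \<open>Z k p\<close> with \<open>k \<ge> m\<close> would give the same element, by
  \<open>\<kappa>_\<phi>\<close> and \<open>\<gamma>_\<phi>\<close>; compatibility rests on
  this.\<close>

definition fold_el :: "'u tuple \<Rightarrow> nat \<Rightarrow> 'u \<Rightarrow> 'u el" where
  "fold_el p m i = exp_comp I (KL p) (Z m p) (Lim p) m (\<kappa> m m p i, \<gamma> m m p i)"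

definition unfold_el :: "'u tuple \<Rightarrow> nat \<Rightarrow> 'u \<Rightarrow> 'u el" where
  "unfold_el p m i = exp_comp I (Lim p) (Z m p) (KL p) m (\<gamma>' m m p i, \<kappa>' m m p i)"

lemma KL_slice: "p \<in> Ob P \<Longrightarrow> is_slice I (KL p)"
  by (rule SO_slice[OF KL_SO])

lemma fold_compatible:
  assumes p: "p \<in> Ob P"
  shows "compatible I (KL p) (Lim p) (fold_el p)"
  unfolding compatible_def
proof (intro conjI allI ballI)
  fix m i assume i: "i \<in> car I m"
  show "fold_el p m i \<in> fibre (E (KL p) (Lim p)) m i"
    unfolding fold_el_def by (intro exp_comp_in[OF I KL_slice[OF p]] \<kappa>_in[OF p i] \<gamma>_in[OF p i]) simp_all
next
  fix m i assume i: "i \<in> car I (Suc m)"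
  note i' = I_res[OF i]
  have le: "m \<le> m" "m \<le> Suc m" "Suc m \<le> Suc m" by simp_all
  have "res (E (KL p) (Lim p)) m (fold_el p (Suc m) i) =
      exp_comp I (KL p) (Z (Suc m) p) (Lim p) m (\<kappa> m (Suc m) p (res I m i), \<gamma> m (Suc m) p (res I m i))"
    unfolding fold_el_def
      exp_comp_res[OF I KL_slice[OF p] \<kappa>_in[OF p i le(3)] \<gamma>_in(1)[OF p i le(3)]]
      \<kappa>_res[OF p i le(3)] \<gamma>_res[OF p i le(3)] ..
  \<comment> \<open>Both sides are \<open>\<kappa> m m\<close> after
    \<open>\<phi> m (Suc m) m\<close> after \<open>\<gamma> m (Suc m)\<close>, bracketed
    differently.\<close>
  also have "\<dots> = fold_el p m (res I m i)"
    unfolding fold_el_def \<kappa>_\<phi>(1)[OF p i' le(2,1), symmetric] \<gamma>_\<phi>(1)[OF p i' le(2,1), symmetric]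
    by (rule exp_comp_assoc[OF I KL_slice[OF p] Z_slice[OF p] \<kappa>_in[OF p i' le(1)] \<phi>_in[OF p i' le(2,1)]
          \<gamma>_in(1)[OF p i' le(2)], symmetric])
  finally show "res (E (KL p) (Lim p)) m (fold_el p (Suc m) i) = fold_el p m (res I m i)" .
qed

lemma unfold_compatible:
  assumes p: "p \<in> Ob P"
  shows "compatible I (Lim p) (KL p) (unfold_el p)"
  unfolding compatible_def
proof (intro conjI allI ballI)
  fix m i assume i: "i \<in> car I m"
  show "unfold_el p m i \<in> fibre (E (Lim p) (KL p)) m i"
    unfolding unfold_el_def by (intro exp_comp_in[OF I Lim_slice[OF p]] \<kappa>'_in[OF p i] \<gamma>_in[OF p i])
        simp_all
next
  fix m i assume i: "i \<in> car I (Suc m)"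
  note i' = I_res[OF i]
  have le: "m \<le> m" "m \<le> Suc m" "Suc m \<le> Suc m" by simp_all
  have "res (E (Lim p) (KL p)) m (unfold_el p (Suc m) i) =
      exp_comp I (Lim p) (Z (Suc m) p) (KL p) m (\<gamma>' m (Suc m) p (res I m i), \<kappa>' m (Suc m) p (res I m i))"
    unfolding unfold_el_def
      exp_comp_res[OF I Lim_slice[OF p] \<gamma>_in(2)[OF p i le(3)] \<kappa>'_in[OF p i le(3)]]
      \<kappa>_res[OF p i le(3)] \<gamma>_res[OF p i le(3)] ..
  also have "\<dots> = unfold_el p m (res I m i)"
    unfolding unfold_el_def \<kappa>_\<phi>(2)[OF p i' le(1,2), symmetric] \<gamma>_\<phi>(2)[OF p i' le(1,2), symmetric]
    by (rule exp_comp_assoc[OF I Lim_slice[OF p] Z_slice[OF p] \<gamma>_in(2)[OF p i' le(2)] \<phi>_in[OF p i'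
        le(1,2)]
          \<kappa>'_in[OF p i' le(1)]])
  finally show "res (E (Lim p) (KL p)) m (unfold_el p (Suc m) i) = unfold_el p m (res I m i)" .
qed

text \<open>The inner pair of factors cancels by \<open>\<gamma>_inv\<close> or
  \<open>\<kappa>_inv\<close>, and then the outer pair by the other of the two.\<close>

lemma fold_unfold:
  assumes p: "p \<in> Ob P" and i: "i \<in> car I m"
  shows "exp_comp I (Lim p) (KL p) (Lim p) m (fold_el p m i, unfold_el p m i) = eid I (Lim p) m i"
    "exp_comp I (KL p) (Lim p) (KL p) m (unfold_el p m i, fold_el p m i) = eid I (KL p) m i"
proof -
  have le: "m \<le> m" by simp
  note in' = \<kappa>_in[OF p i le] \<kappa>'_in[OF p i le] \<gamma>_in[OF p i le]
  note S = KL_slice[OF p] Lim_slice[OF p] Z_slice[OF p, of m]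
  note C = exp_comp_in[OF I]
  have "exp_comp I (Lim p) (KL p) (Lim p) m (fold_el p m i, unfold_el p m i) =
    exp_comp I (Lim p) (Z m p) (Lim p) m (\<kappa> m m p i,
      exp_comp I (Lim p) (Z m p) (Z m p) m (exp_comp I (Z m p) (KL p) (Z m p) m (\<gamma> m m p i, \<gamma>' m m p
          i), \<kappa>' m m p i))"
    unfolding fold_el_def unfold_el_def
    using in' S by (simp add: exp_comp_assoc[OF I, symmetric, of _ _ _ _ _ m i] C del: pow_simps)
  then show "exp_comp I (Lim p) (KL p) (Lim p) m (fold_el p m i, unfold_el p m i) = eid I (Lim p) m i"
    unfolding \<gamma>_inv[OF p i le] exp_comp_id(1)[OF I S(2,3) in'(2)] \<kappa>_inv[OF p i le] .
  have "exp_comp I (KL p) (Lim p) (KL p) m (unfold_el p m i, fold_el p m i) =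
    exp_comp I (KL p) (Z m p) (KL p) m (\<gamma>' m m p i,
      exp_comp I (KL p) (Z m p) (Z m p) m (exp_comp I (Z m p) (Lim p) (Z m p) m (\<kappa>' m m p i, \<kappa> m m p
          i), \<gamma> m m p i))"
    unfolding fold_el_def unfold_el_def
    using in' S by (simp add: exp_comp_assoc[OF I, symmetric, of _ _ _ _ _ m i] C del: pow_simps)
  then show "exp_comp I (KL p) (Lim p) (KL p) m (unfold_el p m i, fold_el p m i) = eid I (KL p) m i"
    unfolding \<gamma>_inv[OF p i le] \<kappa>_inv[OF p i le] exp_comp_id(1)[OF I S(1,3) in'(3)] .
qed

end

section \<open>Ordinary morphisms and their names\<close>

lemma slice_cat_simps [simp]:
  "Obj (slice_cat U I) = SO U I" "Arr (slice_cat U I) = slice_hom"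
  "cmp (slice_cat U I) X Y Z g f = hcomp X g f" "idn (slice_cat U I) = hid"
  by (simp_all add: slice_cat_def hcomp_def hid_def fun_eq_iff)

lemma dom_cat_simps [simp]:
  "Obj (dom_cat U I N) = (\<Pi>\<^sub>E j\<in>{..<N}. SO U I \<times> SO U I)"
  "Arr (dom_cat U I N) p q =
    (\<Pi>\<^sub>E j\<in>{..<N}. slice_hom (fst (q j)) (fst (p j)) \<times> slice_hom (snd (p j)) (snd (q j)))"
  "cmp (dom_cat U I N) p q r g f =
    (\<lambda>j\<in>{..<N}. (hcomp (fst (r j)) (fst (f j)) (fst (g j)), hcomp (snd (p j)) (snd (g j)) (snd (f j))))"
  "idn (dom_cat U I N) p = (\<lambda>j\<in>{..<N}. (hid (fst (p j)), hid (snd (p j))))"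
  by (simp_all add: dom_cat_def pow_cat_def mixed_cat_def prod_cat_def op_cat_def)

abbreviation domP where "domP U I N \<equiv> powM U I {..<N}"

lemma dom_ecat_eq: "dom_ecat U I N = domP U I N"
  by (simp add: dom_ecat_def)

lemma dom_Ob: "Obj (dom_cat U I N) = Ob (domP U I N)"
  by simp

lemma dom_slices:
  "p \<in> Ob (domP U I N) \<Longrightarrow> j < N \<Longrightarrow> is_slice I (fst (p j))"
  "p \<in> Ob (domP U I N) \<Longrightarrow> j < N \<Longrightarrow> is_slice I (snd (p j))"
  using PiE_SO[where p=p and j=j and J="{..<N}" and U=U and I=I] SO_slice by (auto simp: mem_Times_iff)

lemma dom_arrows:
  assumes "f \<in> Arr (dom_cat U I N) p q" "j < N"
  shows "fst (f j) \<in> slice_hom (fst (q j)) (fst (p j))" "snd (f j) \<in> slice_hom (snd (p j)) (snd (q j))"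
  using PiE_mem[OF assms(1)[unfolded dom_cat_simps], of j] assms(2) by (auto simp: mem_Times_iff)

lemma dom_name_in:
  assumes "is_tree I" "p \<in> Ob (domP U I N)" "q \<in> Ob (domP U I N)" "f \<in> Arr (dom_cat U I N) p q" "i \<in>
      car I m"
  shows "dom_name I N p q f m i \<in> fibre (Hom (domP U I N) p q) m i"
proof -
  have "(exp_name I (fst (q j)) (fst (f j)) m i, exp_name I (snd (p j)) (snd (f j)) m i)
      \<in> fibre (Hom (mixed_ecat U I) (p j) (q j)) m i" if "j < N" for j
    using exp_name_in[OF assms(1) dom_slices(1)[OF assms(3) that] dom_arrows(1)[OF assms(4) that]
        assms(5)]
      exp_name_in[OF assms(1) dom_slices(2)[OF assms(2) that] dom_arrows(2)[OF assms(4) that] assms(5)]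
    by (simp add: fibre_prod)
  then show ?thesis
    using assms(5) by (auto simp: dom_name_def powM_fibre simp del: mixed_ecat_simps pow_simps)
qed

lemma dom_name_eq: "i \<in> car I m \<Longrightarrow> dom_name I N p q f m i =
    (i, \<lambda>j\<in>{..<N}. (exp_name I (fst (q j)) (fst (f j)) m i, exp_name I (snd (p j)) (snd (f j)) m i))"
  by (simp add: dom_name_def)

lemma dom_name_res:
  assumes "is_tree I" "p \<in> Ob (domP U I N)" "q \<in> Ob (domP U I N)" "f \<in> Arr (dom_cat U I N) p q"
    and i: "i \<in> car I (Suc m)"
  shows "res (Hom (domP U I N) p q) m (dom_name I N p q f (Suc m) i) = dom_name I N p q f m (res I m i)"
proof -
  note D = dom_name_in[OF assms]
  have "res (Hom (mixed_ecat U I) (p j) (q j)) m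
      (exp_name I (fst (q j)) (fst (f j)) (Suc m) i, exp_name I (snd (p j)) (snd (f j)) (Suc m) i) =
      (exp_name I (fst (q j)) (fst (f j)) m (res I m i), exp_name I (snd (p j)) (snd (f j)) m (res I m
          i))"
    if "j < N" for j
  proof -
    note S = dom_slices(1)[OF assms(3) that] dom_slices(2)[OF assms(2) that] dom_arrows[OF assms(4) that]
    show ?thesis
      using powM_fibre_mem[OF D, of j] that exp_name_res[OF assms(1) S(1,3) i] exp_name_res[OF
          assms(1) S(2,4) i]
      by (simp add: dom_name_eq[OF i] res_prod_fibre)
  qed
  then show ?thesis
    unfolding powM_res[OF D] dom_name_eq[OF tree_res_in[OF assms(1) i]]
    by (auto simp: dom_name_eq[OF i] simp del: mixed_ecat_simps intro!: restrict_ext)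
qed

lemma dom_name_comp:
  assumes "is_tree I" "p \<in> Ob (domP U I N)" "q \<in> Ob (domP U I N)" "r \<in> Ob (domP U I N)"
    and "f \<in> Arr (dom_cat U I N) p q" "g \<in> Arr (dom_cat U I N) q r" and i: "i \<in> car I m"
  shows "dom_name I N p r (cmp (dom_cat U I N) p q r g f) m i =
    Comp (domP U I N) p q r m (dom_name I N q r g m i, dom_name I N p q f m i)"
proof -
  note D = dom_name_in[OF assms(1,3,4,6) i] dom_name_in[OF assms(1,2,3,5) i]
  have "Comp (mixed_ecat U I) (p j) (q j) (r j) m
      (snd (dom_name I N q r g m i) j, snd (dom_name I N p q f m i) j) =
      (exp_name I (fst (r j)) (hcomp (fst (r j)) (fst (f j)) (fst (g j))) m i,
       exp_name I (snd (p j)) (hcomp (snd (p j)) (snd (g j)) (snd (f j))) m i)"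
    if "j < N" for j
  proof -
    note S = dom_slices(1)[OF assms(3) that] dom_slices(2)[OF assms(2) that] dom_slices(2)[OF assms(3)
        that]
      dom_slices(1)[OF assms(4) that] dom_arrows[OF assms(5) that] dom_arrows[OF assms(6) that]
    show ?thesis
      using that exp_name_comp[OF assms(1) S(4,1,7,5) i] exp_name_comp[OF assms(1) S(2,3,6,8) i]
        mixed_comp[OF powM_fibre_mem[OF D(1)] powM_fibre_mem[OF D(2)], of j]
      by (simp add: dom_name_eq[OF i])
  qed
  then show ?thesis
    unfolding pow_comp[OF D] by (auto simp: dom_name_eq[OF i] intro!: restrict_ext)
qed

lemma dom_name_id:
  "i \<in> car I m \<Longrightarrow> dom_name I N p p (idn (dom_cat U I N) p) m i = Id (domP U I N) p m i"
  by (auto simp: dom_name_eq pow_id intro!: restrict_ext)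

lemma dom_name_swap:
  "i \<in> car I m \<Longrightarrow> dom_name I N (swp {..<N} q) (swp {..<N} p) (swp {..<N} f) m i =
    swe {..<N} (dom_name I N p q f m i)"
  by (auto simp: dom_name_eq swp_def intro!: restrict_ext)

lemma swp_Arr: "f \<in> Arr (dom_cat U I N) p q \<Longrightarrow> swp {..<N} f \<in> Arr (dom_cat U I N) (swp {..<N} q) (swp
    {..<N} p)"
  by (auto simp: swp_def PiE_iff mem_Times_iff)

lemma dom_name_ext:
  "i \<in> car I m \<Longrightarrow> dom_name I (Suc N) (p(N := A)) (q(N := B)) (f(N := x)) m i =
    ext N (dom_name I N p q f m i) (exp_name I (fst B) (fst x) m i, exp_name I (snd A) (snd x) m i)"
  by (auto simp: dom_name_eq fun_eq_iff)

lemma ext_Arr: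
  "f \<in> Arr (dom_cat U I N) p q \<Longrightarrow> fst x \<in> slice_hom (fst B) (fst A) \<Longrightarrow> snd x \<in> slice_hom (snd A) (snd B) \<Longrightarrow>
    f(N := x) \<in> Arr (dom_cat U I (Suc N)) (p(N := A)) (q(N := B))"
  by (auto simp: PiE_iff extensional_def mem_Times_iff)

text \<open>The ordinary action of a strong functor is forced by the enriched one: its name is the
  image of the name of the argument, and \<open>mor_of\<close> recovers the morphism. So only
  \<open>X\<close> and \<open>H\<close> have to be given.\<close>

definition strong_of :: "'u tree \<Rightarrow> nat \<Rightarrow> ('u tuple \<Rightarrow> 'u obj) \<Rightarrow>
    ('u tuple \<Rightarrow> 'u tuple \<Rightarrow> nat \<Rightarrow> 'u \<times> (nat \<Rightarrow> 'u el \<times> 'u el) \<Rightarrow> 'u el) \<Rightarrow> 'u mfunctor" where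
  "strong_of I N X H = \<lparr>fob = X, fhom = H,
     fmor = (\<lambda>p q f. mor_of (X p) (\<lambda>m i. H p q m (dom_name I N p q f m i)))\<rparr>"

lemma strong_of_sel [simp]: "fob (strong_of I N X H) = X" "fhom (strong_of I N X H) = H"
  by (simp_all add: strong_of_def)

text \<open>Morphisms are determined by their names, and on names the laws of an ordinary functor
  are the enriched laws.\<close>

lemma strong_of:
  assumes I: "is_tree I" and ef: "is_efunctor I (domP U I N) (slice_ecat U I) (strong_of I N X H)"
  shows "strong_functor U I N (strong_of I N X H)"
proof -
  let ?F = "strong_of I N X H"
  note E = efunctorD[OF ef, unfolded strong_of_sel]
  have X: "X p \<in> SO U I" "is_slice I (X p)" if "p \<in> Ob (domP U I N)" for p
    using E(1)[OF that] SO_slice[of "X p" U I] by auto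
  have cp: "compatible I (X p) (X q) (\<lambda>m i. H p q m (dom_name I N p q f m i))"
    if "p \<in> Ob (domP U I N)" "q \<in> Ob (domP U I N)" "f \<in> Arr (dom_cat U I N) p q" for p q f
    unfolding compatible_def
    using E(2)[OF that(1,2) dom_name_in[OF I that]] E(3)[OF that(1,2) dom_name_in[OF I that]]
      dom_name_res[OF I that]
    by (simp del: pow_simps dom_cat_simps)
  have mor: "fmor ?F p q f \<in> slice_hom (X p) (X q)"
      "i \<in> car I m \<Longrightarrow> exp_name I (X p) (fmor ?F p q f) m i = H p q m (dom_name I N p q f m i)"
    if "p \<in> Ob (domP U I N)" "q \<in> Ob (domP U I N)" "f \<in> Arr (dom_cat U I N) p q" for p q f m i
    using mor_of[OF I X(2)[OF that(1)] cp[OF that]] by (simp_all add: strong_of_def)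
  have "is_functor (dom_cat U I N) (slice_cat U I) ?F"
    unfolding is_functor_def dom_Ob strong_of_sel slice_cat_simps
  proof (intro conjI ballI)
    fix p q r f g
    assume A: "p \<in> Ob (domP U I N)" "q \<in> Ob (domP U I N)" "r \<in> Ob (domP U I N)"
      "f \<in> Arr (dom_cat U I N) p q" "g \<in> Arr (dom_cat U I N) q r"
    have c: "cmp (dom_cat U I N) p q r g f \<in> Arr (dom_cat U I N) p r"
    proof -
      have "hcomp (fst (r j)) (fst (f j)) (fst (g j)) \<in> slice_hom (fst (r j)) (fst (p j))"
        "hcomp (snd (p j)) (snd (g j)) (snd (f j)) \<in> slice_hom (snd (p j)) (snd (r j))" if "j < N" for j
      proof -
        note S = dom_slices(1)[OF A(3) that] dom_slices(2)[OF A(1) that]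
        show "hcomp (fst (r j)) (fst (f j)) (fst (g j)) \<in> slice_hom (fst (r j)) (fst (p j))"
          "hcomp (snd (p j)) (snd (g j)) (snd (f j)) \<in> slice_hom (snd (p j)) (snd (r j))"
          using dom_arrows[OF A(4) that] dom_arrows[OF A(5) that]
          by (auto intro: hcomp_in[OF S(1)] hcomp_in[OF S(2)])
      qed
      then show ?thesis by simp
    qed
    show "fmor ?F p r (cmp (dom_cat U I N) p q r g f) = hcomp (X p) (fmor ?F q r g) (fmor ?F p q f)"
    proof (rule exp_name_inj[OF X(2)[OF A(1)] mor(1)[OF A(1,3) c]
          hcomp_in[OF X(2)[OF A(1)] mor(1)[OF A(1,2,4)] mor(1)[OF A(2,3,5)]]])
      fix m i assume i: "i \<in> car I m"
      show "exp_name I (X p) (fmor ?F p r (cmp (dom_cat U I N) p q r g f)) m i =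
          exp_name I (X p) (hcomp (X p) (fmor ?F q r g) (fmor ?F p q f)) m i"
        unfolding mor(2)[OF A(1,3) c i] dom_name_comp[OF I A i]
          exp_name_comp[OF I X(2)[OF A(1)] X(2)[OF A(2)] mor(1)[OF A(1,2,4)] mor(1)[OF A(2,3,5)] i]
          mor(2)[OF A(1,2,4) i] mor(2)[OF A(2,3,5) i]
        using E(4)[OF A(1-3) dom_name_in[OF I A(2,3,5) i] dom_name_in[OF I A(1,2,4) i]] by simp
    qed
  next
    fix p assume p: "p \<in> Ob (domP U I N)"
    have c: "idn (dom_cat U I N) p \<in> Arr (dom_cat U I N) p p"
      using dom_slices[OF p] by (auto intro!: hid_in)
    show "fmor ?F p p (idn (dom_cat U I N) p) = hid (X p)"
    proof (rule exp_name_inj[OF X(2)[OF p] mor(1)[OF p p c] hid_in[OF X(2)[OF p]]])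
      fix m i assume i: "i \<in> car I m"
      show "exp_name I (X p) (fmor ?F p p (idn (dom_cat U I N) p)) m i = eid I (X p) m i"
        unfolding mor(2)[OF p p c i] dom_name_id[OF i] using E(5)[OF p i] by simp
    qed
  qed (use E(1) mor in \<open>simp_all del: pow_simps dom_cat_simps\<close>)
  then show ?thesis
    unfolding strong_functor_def dom_ecat_eq dom_Ob strong_of_sel using ef mor(2)
    by (simp del: pow_simps dom_cat_simps)
qed

lemma mor_of_inverse:
  assumes I: "is_tree I" and X: "is_slice I X" "is_slice I Y"
    and ab: "compatible I X Y a" "compatible I Y X b"
    and inv: "\<And>m i. i \<in> car I m \<Longrightarrow> exp_comp I X Y X m (b m i, a m i) = eid I X m i"
  shows "hcomp X (mor_of Y b) (mor_of X a) = hid X"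
proof -
  note M = mor_of[OF I X(1) ab(1)] mor_of[OF I X(2) ab(2)]
  show ?thesis
    by (rule exp_name_inj[OF X(1) hcomp_in[OF X(1) M(1,3)] hid_in[OF X(1)]])
      (simp add: exp_name_comp[OF I X M(1,3)] M(2,4) inv)
qed

text \<open>The isomorphisms are given by elements, the form in which they are constructed, while
  \<open>F\<close> and \<open>G\<close> enter through their ordinary actions. This fits solutions
  with and without strength.\<close>

lemma natural_isoI:
  assumes I: "is_tree I"
    and F: "\<And>p. p \<in> Ob (domP U I N) \<Longrightarrow> is_slice I (fob F p)"
      "\<And>p q f. p \<in> Ob (domP U I N) \<Longrightarrow> q \<in> Ob (domP U I N) \<Longrightarrow> f \<in> Arr (dom_cat U I N) p q \<Longrightarrow>
        fmor F p q f \<in> slice_hom (fob F p) (fob F q)"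
    and G: "\<And>p. p \<in> Ob (domP U I N) \<Longrightarrow> is_slice I (fob G p)"
      "\<And>p q f. p \<in> Ob (domP U I N) \<Longrightarrow> q \<in> Ob (domP U I N) \<Longrightarrow> f \<in> Arr (dom_cat U I N) p q \<Longrightarrow>
        fmor G p q f \<in> slice_hom (fob G p) (fob G q)"
    and a: "\<And>p. p \<in> Ob (domP U I N) \<Longrightarrow> compatible I (fob F p) (fob G p) (a p)"
    and b: "\<And>p. p \<in> Ob (domP U I N) \<Longrightarrow> compatible I (fob G p) (fob F p) (b p)"
    and ab: "\<And>p m i. p \<in> Ob (domP U I N) \<Longrightarrow> i \<in> car I m \<Longrightarrow>
        exp_comp I (fob G p) (fob F p) (fob G p) m (a p m i, b p m i) = eid I (fob G p) m i"
    and ba: "\<And>p m i. p \<in> Ob (domP U I N) \<Longrightarrow> i \<in> car I m \<Longrightarrow>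
        exp_comp I (fob F p) (fob G p) (fob F p) m (b p m i, a p m i) = eid I (fob F p) m i"
    and nat: "\<And>p q f m i. p \<in> Ob (domP U I N) \<Longrightarrow> q \<in> Ob (domP U I N) \<Longrightarrow> f \<in> Arr (dom_cat U I N) p q \<Longrightarrow>
        i \<in> car I m \<Longrightarrow>
        exp_comp I (fob F p) (fob F q) (fob G q) m (a q m i, exp_name I (fob F p) (fmor F p q f) m i) =
        exp_comp I (fob F p) (fob G p) (fob G q) m (exp_name I (fob G p) (fmor G p q f) m i, a p m i)"
  shows "natural_iso (dom_cat U I N) (slice_cat U I) F G (\<lambda>p. mor_of (fob F p) (a p))"
  unfolding natural_iso_def dom_Ob slice_cat_simps
proof (intro conjI ballI)
  fix p assume p: "p \<in> Ob (domP U I N)"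
  show "mor_of (fob F p) (a p) \<in> slice_hom (fob F p) (fob G p)"
    by (rule mor_of(1)[OF I F(1)[OF p] a[OF p]])
  show "\<exists>\<beta>\<in>slice_hom (fob G p) (fob F p).
      hcomp (fob F p) \<beta> (mor_of (fob F p) (a p)) = hid (fob F p) \<and>
      hcomp (fob G p) (mor_of (fob F p) (a p)) \<beta> = hid (fob G p)"
  proof (intro bexI conjI)
    show "mor_of (fob G p) (b p) \<in> slice_hom (fob G p) (fob F p)"
      by (rule mor_of(1)[OF I G(1)[OF p] b[OF p]])
    show "hcomp (fob F p) (mor_of (fob G p) (b p)) (mor_of (fob F p) (a p)) = hid (fob F p)"
      by (rule mor_of_inverse[OF I F(1)[OF p] G(1)[OF p] a[OF p] b[OF p] ba[OF p]])
    show "hcomp (fob G p) (mor_of (fob F p) (a p)) (mor_of (fob G p) (b p)) = hid (fob G p)"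
      by (rule mor_of_inverse[OF I G(1)[OF p] F(1)[OF p] b[OF p] a[OF p] ab[OF p]])
  qed
next
  fix p q f assume A: "p \<in> Ob (domP U I N)" "q \<in> Ob (domP U I N)" "f \<in> Arr (dom_cat U I N) p q"
  note M = mor_of[OF I F(1)[OF A(1)] a[OF A(1)]] mor_of[OF I F(1)[OF A(2)] a[OF A(2)]]
  show "hcomp (fob F p) (mor_of (fob F q) (a q)) (fmor F p q f) =
      hcomp (fob F p) (fmor G p q f) (mor_of (fob F p) (a p))"
  proof (rule exp_name_inj[OF F(1)[OF A(1)] hcomp_in[OF F(1)[OF A(1)] F(2)[OF A] M(3)]
        hcomp_in[OF F(1)[OF A(1)] M(1) G(2)[OF A]]])
    fix m i assume i: "i \<in> car I m"
    show "exp_name I (fob F p) (hcomp (fob F p) (mor_of (fob F q) (a q)) (fmor F p q f)) m i =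
        exp_name I (fob F p) (hcomp (fob F p) (fmor G p q f) (mor_of (fob F p) (a p))) m i"
      unfolding exp_name_comp[OF I F(1)[OF A(1)] F(1)[OF A(2)] F(2)[OF A] M(3) i]
        exp_name_comp[OF I F(1)[OF A(1)] G(1)[OF A(1)] M(1) G(2)[OF A] i] M(2)[OF i] M(4)[OF i]
      by (rule nat[OF A i])
  qed
qed

lemma strong_name:
  assumes "strong_functor U I N G" "p \<in> Ob (domP U I N)" "q \<in> Ob (domP U I N)" "f \<in> Arr (dom_cat U I
      N) p q" "i \<in> car I m"
  shows "exp_name I (fob G p) (fmor G p q f) m i = fhom G p q m (dom_name I N p q f m i)"
  using assms unfolding strong_functor_def dom_Ob by (metis (no_types, lifting))

lemma functorD:
  assumes "is_functor (dom_cat U I N) (slice_cat U I) G"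
  shows "p \<in> Ob (domP U I N) \<Longrightarrow> fob G p \<in> SO U I" "p \<in> Ob (domP U I N) \<Longrightarrow> is_slice I (fob G p)"
    "p \<in> Ob (domP U I N) \<Longrightarrow> q \<in> Ob (domP U I N) \<Longrightarrow> f \<in> Arr (dom_cat U I N) p q \<Longrightarrow>
      fmor G p q f \<in> slice_hom (fob G p) (fob G q)"
  using assms SO_slice[of "fob G p" U I] unfolding is_functor_def dom_Ob by auto

lemma strong_natural_isoI:
  assumes "natural_iso (dom_cat U I N) (slice_cat U I) G G' \<alpha>"
    and "\<And>p q m i h. p \<in> Ob (domP U I N) \<Longrightarrow> q \<in> Ob (domP U I N) \<Longrightarrow> h \<in> fibre (Hom (domP U I N) p q) m i \<Longrightarrow>
      exp_comp I (fob G p) (fob G q) (fob G' q) m (exp_name I (fob G q) (\<alpha> q) m i, fhom G p q m h) =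
      exp_comp I (fob G p) (fob G' p) (fob G' q) m (fhom G' p q m h, exp_name I (fob G p) (\<alpha> p) m i)"
  shows "strong_natural_iso U I N G G' \<alpha>"
  unfolding strong_natural_iso_def dom_ecat_eq Let_def
  using assms(1) by (auto intro!: assms(2) simp: fibre_def simp del: pow_simps)

section \<open>The fixed point functor\<close>

lemma fibre_car: "x \<in> fibre Y m i \<Longrightarrow> x \<in> car Y m"
  by (simp add: fibre_def)

context con_start
begin

text \<open>The principle for \<open>Fix F\<close> itself: tuples are the index objects and
  \<open>Lim\<close> provides the unknown objects. Its \<open>fx\<close> is the action of
  \<open>Fix F\<close> on hom-objects.\<close>

sublocale fp: contractive_system I "Ob P" "Hom P" "Comp P" "Id P" s "swe J" Lim KL
  "\<lambda>p q m h z. act p (LP p) q (LP q) m h (fst h, z)" fold_el unfold_el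
  "\<lambda>p q. prod_slice (exp_slice I (Lim (s q)) (Lim (s p))) (exp_slice I (Lim p) (Lim q))"
  by (rule fixpoint_system[where u="\<lambda>p. p" and s=s and Obs="Ob P"])
    (use swp_Ob swp_Ob2 Lim_SO fold_compatible unfold_compatible fold_unfold in \<open>auto simp del:
        pow_simps\<close>)

text \<open>Restricted to the carrier, since morphisms of slices are extensional.\<close>

definition fix_hom :: "'u tuple \<Rightarrow> 'u tuple \<Rightarrow> nat \<Rightarrow> 'u \<times> (nat \<Rightarrow> 'u el \<times> 'u el) \<Rightarrow> 'u el" where
  "fix_hom p q m = (\<lambda>h\<in>car (Hom P p q) m. fp.fx m p q h)"

lemma fix_hom: "h \<in> fibre (Hom P p q) m i \<Longrightarrow> fix_hom p q m h = fp.fx m p q h"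
  unfolding fix_hom_def by (rule restrict_apply', rule fibre_car)

end

text \<open>Every tuple of the power has the form \<open>p(k := A)\<close> with \<open>p\<close> on
  the remaining indices. In these terms \<open>next_efunctor\<close> disappears and
  \<open>next\<close> is applied to the adjoined component alone.\<close>

lemma locally_contractive_witness:
  assumes "locally_contractive U I N k F" "k < N" "J = {..<N} - {k}"
  obtains G :: "'u con_fun"
  where "is_efunctor I (conM U I J) (slice_ecat U I) G"
    and "\<And>p A. p \<in> Ob (powM U I J) \<Longrightarrow> A \<in> Ob (mixed_ecat U I) \<Longrightarrow> fob F (p(k := A)) = fob G (p, A)"
    and "\<And>p q A B m i h z. p \<in> Ob (powM U I J) \<Longrightarrow> q \<in> Ob (powM U I J) \<Longrightarrow>
      A \<in> Ob (mixed_ecat U I) \<Longrightarrow> B \<in> Ob (mixed_ecat U I) \<Longrightarrow> h \<in> fibre (Hom (powM U I J) p q) m i \<Longrightarrow>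
      z \<in> fibre (Hom (mixed_ecat U I) A B) m i \<Longrightarrow>
      fhom F (p(k := A)) (q(k := B)) m (ext k h z) =
      fhom G (p, A) (q, B) m (h, (i, next_tree (Hom (mixed_ecat U I) A B) m z))"
proof -
  let ?M = "mixed_ecat U I" and ?P = "powM U I J"
  have kJ: "k \<notin> J" "insert k J = {..<N}" using assms by auto
  from assms(1) obtain G :: "'u con_fun"
    where G: "is_efunctor I (conM U I J) (slice_ecat U I) G"
      "\<And>p. p \<in> Ob (domP U I N) \<Longrightarrow> fob F p = fob G (fob (next_efunctor U I N k) p)"
      "\<And>p q m h. p \<in> Ob (domP U I N) \<Longrightarrow> q \<in> Ob (domP U I N) \<Longrightarrow> h \<in> car (Hom (domP U I N) p q) m \<Longrightarrow>
        fhom F p q m h = fhom G (fob (next_efunctor U I N k) p) (fob (next_efunctor U I N k) q) m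
               (fhom (next_efunctor U I N k) p q m h)"
    unfolding locally_contractive_def contr_ecat_def dom_ecat_eq assms(3) by blast
  have R: "restrict (x(k := y)) J = x" if "x \<in> extensional J" for x :: "nat \<Rightarrow> 'e" and y
    using that kJ(1) by (auto simp: fun_eq_iff extensional_def)
  have O: "p(k := A) \<in> Ob (domP U I N)" if "p \<in> Ob ?P" "A \<in> Ob ?M" for p A
    using ext_Ob[OF that(1), of A k] that(2) kJ(2) by simp
  have N: "fob (next_efunctor U I N k) (p(k := A)) = (p, A)" if "p \<in> Ob ?P" for p A
    using R[of p A] that by (auto simp: next_efunctor_def assms(3)[symmetric] PiE_iff)
  show ?thesis
  proof (rule that[OF G(1)])
    show "fob F (p(k := A)) = fob G (p, A)" if "p \<in> Ob ?P" "A \<in> Ob ?M" for p A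
      using G(2)[OF O[OF that]] N[OF that(1)] by simp
    fix p q A B m i h z
    assume A: "p \<in> Ob ?P" "q \<in> Ob ?P" "A \<in> Ob ?M" "B \<in> Ob ?M" "h \<in> fibre (Hom ?P p q) m i"
      "z \<in> fibre (Hom ?M A B) m i"
    have e: "ext k h z \<in> car (Hom (domP U I N) (p(k := A)) (q(k := B))) m"
      using fibre_car[OF ext_in[OF kJ(1) A(5,6)]] unfolding kJ(2) .
    have h: "snd h \<in> extensional J" "fst h = i" using A(5) by (auto simp: powM_fibre PiE_iff simp del:
        pow_simps)
    have "fhom (next_efunctor U I N k) (p(k := A)) (q(k := B)) m (ext k h z) =
        (h, (i, next_tree (Hom ?M A B) m z))"
      using e R[OF h(1), of z] next_slice_eq[OF A(6)] h(2)
      by (simp add: next_efunctor_def dom_ecat_eq assms(3)[symmetric] del: pow_simps mixed_ecat_simps)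
        (metis prod.collapse)
    then show "fhom F (p(k := A)) (q(k := B)) m (ext k h z) =
        fhom G (p, A) (q, B) m (h, (i, next_tree (Hom ?M A B) m z))"
      using G(3)[OF O[OF A(1,3)] O[OF A(2,4)] e] N[OF A(1)] N[OF A(2)] by simp
  qed
qed

locale fix_ctx = con_start U I "{..<n}" K T for U :: "'u set set" and I n K T +
  fixes F :: "'u mfunctor"
  assumes F: "strong_functor U I (Suc n) F"
    and F_ob: "\<And>p A. p \<in> Ob P \<Longrightarrow> A \<in> Ob M \<Longrightarrow> fob F (p(n := A)) = fob K (p, A)"
    and F_hom: "\<And>p q A B m i h z. p \<in> Ob P \<Longrightarrow> q \<in> Ob P \<Longrightarrow> A \<in> Ob M \<Longrightarrow> B \<in> Ob M \<Longrightarrow>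
      h \<in> fibre (Hom P p q) m i \<Longrightarrow> z \<in> fibre (Hom M A B) m i \<Longrightarrow>
      fhom F (p(n := A)) (q(n := B)) m (ext n h z) = act p A q B m h (i, next_tree (Hom M A B) m z)"
begin

abbreviation "ff G \<equiv> fix_functional n F G"
abbreviation "GP G p \<equiv> (fob G (s p), fob G p)"

lemma ff_ob:
  "p \<in> Ob P \<Longrightarrow> GP G p \<in> Ob M \<Longrightarrow> fob (ff G) p = fob K (p, GP G p)"
  using F_ob[of p "GP G p"]
  by (simp add: fix_functional_def comp_fun_def graph_functor_def symmetrization_def swap_tuple_swp
      del: pow_simps)

lemma ff_hom:
  assumes "p \<in> Ob P" "q \<in> Ob P" "GP G p \<in> Ob M" "GP G q \<in> Ob M" "h \<in> fibre (Hom P p q) m i"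
    "(fhom G (s q) (s p) m (swe {..<n} h), fhom G p q m h) \<in> fibre (Hom M (GP G p) (GP G q)) m i"
  shows "fhom (ff G) p q m h = act p (GP G p) q (GP G q) m h
    (i, next_tree (Hom M (GP G p) (GP G q)) m (fhom G (s q) (s p) m (swe {..<n} h), fhom G p q m h))"
  using F_hom[OF assms]
  by (cases h) (simp add: fix_functional_def comp_fun_def graph_functor_def symmetrization_def
      swap_tuple_swp
    del: pow_simps mixed_ecat_simps)

text \<open>\<open>G\<close> is only a functor here, so \<open>fhom G\<close> carries no meaning.
  But \<open>F\<close> is strong: the name of its value at a morphism is its enriched action at the
  names of the components, and that action factors through \<open>K\<close>. This gives access to
  the fixed point equation for a \<open>G\<close> without strength.\<close>

lemma ff_mor:
  assumes G: "is_functor (dom_cat U I n) (slice_cat U I) G"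
    and "p \<in> Ob P" "q \<in> Ob P" "f \<in> Arr (dom_cat U I n) p q"
  shows "fmor (ff G) p q f \<in> slice_hom (fob (ff G) p) (fob (ff G) q)"
    and "i \<in> car I m \<Longrightarrow> exp_name I (fob (ff G) p) (fmor (ff G) p q f) m i =
      act p (GP G p) q (GP G q) m (dom_name I n p q f m i)
        (i, next_tree (Hom M (GP G p) (GP G q)) m
          (exp_name I (fob G (s q)) (fmor G (s q) (s p) (s f)) m i, exp_name I (fob G p) (fmor G p q
              f) m i))"
proof -
  have G_SO: "fob G p \<in> SO U I" if "p \<in> Ob P" for p
    using G that unfolding is_functor_def dom_Ob by simp
  have G_mor: "fmor G p q f \<in> slice_hom (fob G p) (fob G q)"
    if "p \<in> Ob P" "q \<in> Ob P" "f \<in> Arr (dom_cat U I n) p q" for p q f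
    using G that unfolding is_functor_def dom_Ob by simp
  have GP: "GP G p \<in> Ob M" if "p \<in> Ob P" for p
    using G_SO[OF that] G_SO[OF swp_Ob[OF that]] by simp
  let ?x = "(fmor G (s q) (s p) (s f), fmor G p q f)"
  let ?p = "p(n := GP G p)" and ?q = "q(n := GP G q)" and ?f = "f(n := ?x)"
  have x: "fst ?x \<in> slice_hom (fst (GP G q)) (fst (GP G p))" "snd ?x \<in> slice_hom (snd (GP G p)) (snd
      (GP G q))"
    using G_mor[OF assms(2-4)] G_mor[OF swp_Ob[OF assms(3)] swp_Ob[OF assms(2)] swp_Arr[OF assms(4)]]
        by simp_all
  have f: "?f \<in> Arr (dom_cat U I (Suc n)) ?p ?q"
    by (rule ext_Arr[OF assms(4) x])
  have O: "?p \<in> Ob (domP U I (Suc n))" "?q \<in> Ob (domP U I (Suc n))"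
    using ext_Ob[OF assms(2), of "GP G p" n] GP[OF assms(2)] ext_Ob[OF assms(3), of "GP G q" n] GP[OF
        assms(3)]
    unfolding lessThan_Suc by simp_all
  have E: "fmor (ff G) p q f = fmor F ?p ?q ?f" "fob (ff G) p = fob F ?p" "fob (ff G) q = fob F ?q"
    by (simp_all add: fix_functional_def comp_fun_def graph_functor_def symmetrization_def swap_tuple_swp)
  show "fmor (ff G) p q f \<in> slice_hom (fob (ff G) p) (fob (ff G) q)"
    unfolding E using F O f unfolding strong_functor_def is_functor_def dom_Ob by simp
  assume i: "i \<in> car I m"
  have N: "exp_name I (fob F ?p) (fmor F ?p ?q ?f) m i = fhom F ?p ?q m (dom_name I (Suc n) ?p ?q ?f m i)"
    using F O f i unfolding strong_functor_def dom_Ob by (metis (no_types, lifting))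
  have z: "(exp_name I (fst (GP G q)) (fst ?x) m i, exp_name I (snd (GP G p)) (snd ?x) m i)
      \<in> fibre (Hom M (GP G p) (GP G q)) m i"
    using exp_name_in[OF I SO_slice[OF G_SO[OF swp_Ob[OF assms(3)]]] G_mor[OF swp_Ob[OF assms(3)]
        swp_Ob[OF assms(2)] swp_Arr[OF assms(4)]] i]
      exp_name_in[OF I SO_slice[OF G_SO[OF assms(2)]] G_mor[OF assms(2-4)] i]
    by (simp add: fibre_prod)
  show "exp_name I (fob (ff G) p) (fmor (ff G) p q f) m i =
      act p (GP G p) q (GP G q) m (dom_name I n p q f m i)
        (i, next_tree (Hom M (GP G p) (GP G q)) m
          (exp_name I (fob G (s q)) (fmor G (s q) (s p) (s f)) m i, exp_name I (fob G p) (fmor G p q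
              f) m i))"
    unfolding E N dom_name_ext[OF i]
    using F_hom[OF assms(2,3) GP[OF assms(2)] GP[OF assms(3)] dom_name_in[OF I assms(2-4) i] z] by simp
qed

section \<open>The functor \<open>Fix F\<close> and its isomorphism\<close>

definition FixF :: "'u mfunctor" where
  "FixF = strong_of I n Lim fix_hom"

lemma FixF_sel [simp]: "fob FixF = Lim" "fhom FixF = fix_hom"
  by (simp_all add: FixF_def)

lemma FixF_strong: "strong_functor U I n FixF"
  unfolding FixF_def
proof (rule strong_of[OF I], rule efunctorI; (unfold strong_of_sel slice_ecat_simps)?)
  show "Lim p \<in> SO U I" if "p \<in> Ob P" for p by (rule Lim_SO[OF that])
  show "is_slice I (Hom P p q)" for p q by (rule powM_slice[OF I])
  show "fix_hom p q m \<in> extensional (car (Hom P p q) m)" for p q m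
    unfolding fix_hom_def by (rule restrict_extensional)
  fix p q m i h assume A: "p \<in> Ob P" "q \<in> Ob P" "h \<in> fibre (Hom P p q) m i"
  show "fix_hom p q m h \<in> fibre (exp_slice I (Lim p) (Lim q)) m i"
    unfolding fix_hom[OF A(3)] by (rule fp.fx_in[OF A])
next
  fix p q m i h assume A: "p \<in> Ob P" "q \<in> Ob P" "h \<in> fibre (Hom P p q) (Suc m) i"
  show "res (exp_slice I (Lim p) (Lim q)) m (fix_hom p q (Suc m) h) = fix_hom p q m (res (Hom P p q) m h)"
    unfolding fix_hom[OF A(3)] fix_hom[OF fibre_res[OF powM_slice[OF I] A(3)]] by (rule fp.fx_res[OF A])
next
  fix p q r m i g h
  assume A: "p \<in> Ob P" "q \<in> Ob P" "r \<in> Ob P" "g \<in> fibre (Hom P q r) m i" "h \<in> fibre (Hom P p q) m i"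
  show "fix_hom p r m (Comp P p q r m (g, h)) =
      exp_comp I (Lim p) (Lim q) (Lim r) m (fix_hom q r m g, fix_hom p q m h)"
    unfolding fix_hom[OF A(4)] fix_hom[OF A(5)] fix_hom[OF powM_comp_in[OF I A(1,3,4,5)]] by (rule
        fp.fx_comp[OF A])
next
  fix p m i assume A: "p \<in> Ob P" "i \<in> car I m"
  show "fix_hom p p m (Id P p m i) = eid I (Lim p) m i"
    unfolding fix_hom[OF powM_id_in[OF I A]] by (rule fp.fx_id[OF A])
qed

lemma FixF_functor: "is_functor (dom_cat U I n) (slice_cat U I) FixF"
  using FixF_strong by (simp add: strong_functor_def)

lemma ff_Lim: "p \<in> Ob P \<Longrightarrow> fob (ff FixF) p = KL p"
  using ff_ob[of p FixF] LP_Ob[of p] by (simp del: pow_simps)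

lemma ff_fix_hom:
  assumes "p \<in> Ob P" "q \<in> Ob P" "h \<in> fibre (Hom P p q) m i"
  shows "fhom (ff FixF) p q m h = act p (LP p) q (LP q) m h
    (i, next_tree (Hom M (LP p) (LP q)) m (fp.fx m (s q) (s p) (swe {..<n} h), fp.fx m p q h))"
  using ff_hom[of p q FixF h m i] LP_Ob[OF assms(1)] LP_Ob[OF assms(2)] fp.fx_pair_in[OF assms] assms
    fix_hom[OF assms(3)] fix_hom[OF powM_swap(1)[OF assms(3)]]
  by (simp del: pow_simps)

text \<open>By \<open>cj_iff\<close>, the fixed point equation says exactly that folding is natural
  for the enriched actions.\<close>

lemma fix_natural:
  assumes "p \<in> Ob P" "q \<in> Ob P" "h \<in> fibre (Hom P p q) m i"
  shows "exp_comp I (KL p) (KL q) (Lim q) m (fold_el q m i, fhom (ff FixF) p q m h) =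
    exp_comp I (KL p) (Lim p) (Lim q) m (fix_hom p q m h, fold_el p m i)"
proof -
  have "fst h = i" using assms(3) by (simp add: powM_fibre del: pow_simps)
  then show ?thesis
    using fp.fx_natural[OF assms] unfolding ff_fix_hom[OF assms] fix_hom[OF assms(3)] by simp
qed

lemma fix_iso: "\<exists>\<alpha>. strong_natural_iso U I n (ff FixF) FixF \<alpha>"
proof -
  let ?a = "\<lambda>p. mor_of (fob (ff FixF) p) (fold_el p)"
  have a: "exp_name I (KL p) (?a p) m i = fold_el p m i" if "p \<in> Ob P" "i \<in> car I m" for p m i
    using mor_of(2)[OF I KL_slice[OF that(1)] fold_compatible[OF that(1)] that(2)] that(1) by (simp
        add: ff_Lim del: pow_simps)
  have "natural_iso (dom_cat U I n) (slice_cat U I) (ff FixF) FixF ?a"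
  proof (rule natural_isoI[OF I, where b=unfold_el])
    fix p q f assume A: "p \<in> Ob P" "q \<in> Ob P" "f \<in> Arr (dom_cat U I n) p q"
    show "fmor (ff FixF) p q f \<in> slice_hom (fob (ff FixF) p) (fob (ff FixF) q)"
      by (rule ff_mor(1)[OF FixF_functor A])
    fix m i assume i: "i \<in> car I m"
    note D = dom_name_in[OF I A i]
    \<comment> \<open>On names the ordinary actions are the enriched ones, so ordinary naturality is
      \<open>fix_natural\<close> at the name of \<open>f\<close>.\<close>
    have 1: "exp_name I (fob FixF (s q)) (fmor FixF (s q) (s p) (s f)) m i =
        fp.fx m (s q) (s p) (swe {..<n} (dom_name I n p q f m i))"
      unfolding strong_name[OF FixF_strong swp_Ob[OF A(2)] swp_Ob[OF A(1)] swp_Arr[OF A(3)] i]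
      unfolding FixF_sel dom_name_swap[OF i] by (rule fix_hom[OF powM_swap(1)[OF D]])
    have 2: "exp_name I (fob FixF p) (fmor FixF p q f) m i = fix_hom p q m (dom_name I n p q f m i)"
      unfolding strong_name[OF FixF_strong A i] unfolding FixF_sel ..
    have 3: "exp_name I (fob (ff FixF) p) (fmor (ff FixF) p q f) m i = fhom (ff FixF) p q m (dom_name
        I n p q f m i)"
      unfolding ff_mor(2)[OF FixF_functor A i] unfolding 1 2
      unfolding ff_fix_hom[OF A(1,2) D] fix_hom[OF D] FixF_sel ..
    show "exp_comp I (fob (ff FixF) p) (fob (ff FixF) q) (fob FixF q) m
        (fold_el q m i, exp_name I (fob (ff FixF) p) (fmor (ff FixF) p q f) m i) =
       exp_comp I (fob (ff FixF) p) (fob FixF p) (fob FixF q) m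
        (exp_name I (fob FixF p) (fmor FixF p q f) m i, fold_el p m i)"
      unfolding 2 3 unfolding FixF_sel ff_Lim[OF A(1)] ff_Lim[OF A(2)] by (rule fix_natural[OF A(1,2) D])
  next
    fix p q f assume A: "p \<in> Ob P" "q \<in> Ob P" "f \<in> Arr (dom_cat U I n) p q"
    show "fmor FixF p q f \<in> slice_hom (fob FixF p) (fob FixF q)"
      by (rule functorD(3)[OF FixF_functor A])
  next
    fix p assume p: "p \<in> Ob P"
    show "is_slice I (fob (ff FixF) p)" "is_slice I (fob FixF p)"
      unfolding ff_Lim[OF p] FixF_sel by (rule KL_slice[OF p] Lim_slice[OF p])+
    show "compatible I (fob (ff FixF) p) (fob FixF p) (fold_el p)"
      "compatible I (fob FixF p) (fob (ff FixF) p) (unfold_el p)"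
      unfolding ff_Lim[OF p] FixF_sel by (rule fold_compatible[OF p] unfold_compatible[OF p])+
    fix m i assume i: "i \<in> car I m"
    show "exp_comp I (fob FixF p) (fob (ff FixF) p) (fob FixF p) m (fold_el p m i, unfold_el p m i) =
        eid I (fob FixF p) m i"
      "exp_comp I (fob (ff FixF) p) (fob FixF p) (fob (ff FixF) p) m (unfold_el p m i, fold_el p m i)
          = eid I (fob (ff FixF) p) m i"
      unfolding ff_Lim[OF p] FixF_sel by (rule fold_unfold[OF p i])+
  qed
  then have "strong_natural_iso U I n (ff FixF) FixF ?a"
  proof (rule strong_natural_isoI)
    show "exp_comp I (fob (ff FixF) p) (fob (ff FixF) q) (fob FixF q) m
        (exp_name I (fob (ff FixF) q) (?a q) m i, fhom (ff FixF) p q m h) =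
      exp_comp I (fob (ff FixF) p) (fob FixF p) (fob FixF q) m
        (fhom FixF p q m h, exp_name I (fob (ff FixF) p) (?a p) m i)"
    if "p \<in> Ob P" "q \<in> Ob P" "h \<in> fibre (Hom P p q) m i" for p q m i h
    proof -
      note i = fibre_base[OF powM_slice[OF I] that(3)]
      show ?thesis
        using fix_natural[OF that]
        unfolding FixF_sel a[OF that(1) i, folded ff_Lim[OF that(1)]] a[OF that(2) i, folded ff_Lim[OF
            that(2)]]
        unfolding ff_Lim[OF that(1)] ff_Lim[OF that(2)] .
    qed
  qed
  then show ?thesis
    by (rule exI[where P="strong_natural_iso U I n (ff FixF) FixF" and x="?a"])
qed

end

section \<open>Uniqueness\<close>

text \<open>\<open>\<alpha>\<close> and its inverse \<open>\<beta>\<close> are ordinary morphisms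
  and enter through their names. Strength of \<open>G\<close> is added only in
  \<open>th_strong_natural_iso\<close>.\<close>

locale fix_compare = fix_ctx U I n K T F for U :: "'u set set" and I n K T F +
  fixes G :: "'u mfunctor" and \<alpha> \<beta> :: "'u tuple \<Rightarrow> 'u mor"
  assumes G: "is_functor (dom_cat U I n) (slice_cat U I) G"
    and alpha: "\<And>p. p \<in> Ob P \<Longrightarrow> \<alpha> p \<in> slice_hom (fob (ff G) p) (fob G p)"
    and beta: "\<And>p. p \<in> Ob P \<Longrightarrow> \<beta> p \<in> slice_hom (fob G p) (fob (ff G) p)"
    and beta_alpha: "\<And>p. p \<in> Ob P \<Longrightarrow> hcomp (fob (ff G) p) (\<beta> p) (\<alpha> p) = hid (fob (ff G) p)"
    and alpha_beta: "\<And>p. p \<in> Ob P \<Longrightarrow> hcomp (fob G p) (\<alpha> p) (\<beta> p) = hid (fob G p)"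
    and alpha_nat: "\<And>p q f. p \<in> Ob P \<Longrightarrow> q \<in> Ob P \<Longrightarrow> f \<in> Arr (dom_cat U I n) p q \<Longrightarrow>
      hcomp (fob (ff G) p) (\<alpha> q) (fmor (ff G) p q f) = hcomp (fob (ff G) p) (fmor G p q f) (\<alpha> p)"
begin

text \<open>The two solutions \<open>FixF\<close> and \<open>G\<close> are tagged by \<open>True\<close> and \<open>False\<close>; morphisms between objects with
  different tags compare them.\<close>

definition Xb :: "bool \<times> 'u tuple \<Rightarrow> 'u obj" where
  "Xb cp = (if fst cp then Lim (snd cp) else fob G (snd cp))"

definition sb :: "bool \<times> 'u tuple \<Rightarrow> bool \<times> 'u tuple" where
  "sb cp = (fst cp, s (snd cp))"

definition al :: "bool \<times> 'u tuple \<Rightarrow> nat \<Rightarrow> 'u \<Rightarrow> 'u el" where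
  "al cp = (if fst cp then fold_el (snd cp) else exp_name I (fob (ff G) (snd cp)) (\<alpha> (snd cp)))"

definition bl :: "bool \<times> 'u tuple \<Rightarrow> nat \<Rightarrow> 'u \<Rightarrow> 'u el" where
  "bl cp = (if fst cp then unfold_el (snd cp) else exp_name I (fob G (snd cp)) (\<beta> (snd cp)))"

lemma G_SO: "p \<in> Ob P \<Longrightarrow> fob G p \<in> SO U I"
  by (rule functorD(1)[OF G])

lemma G_slice: "p \<in> Ob P \<Longrightarrow> is_slice I (fob G p)"
  by (rule functorD(2)[OF G])

lemma GP_Ob: "p \<in> Ob P \<Longrightarrow> GP G p \<in> Ob M"
  using G_SO[of p] G_SO[OF swp_Ob[of p]] by simp

lemma ff_G: "p \<in> Ob P \<Longrightarrow> fob (ff G) p = fob K (p, GP G p)"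
  by (rule ff_ob[OF _ GP_Ob])

lemma ff_slice: "p \<in> Ob P \<Longrightarrow> is_slice I (fob (ff G) p)"
  unfolding ff_G by (rule SO_slice[OF con_SO[OF _ GP_Ob]])

lemma tag_simps:
  "Xb (True, p) = Lim p" "Xb (False, p) = fob G p" "sb (c, p) = (c, s p)"
  "al (True, p) = fold_el p" "al (False, p) = exp_name I (fob (ff G) p) (\<alpha> p)"
  "bl (True, p) = unfold_el p" "bl (False, p) = exp_name I (fob G p) (\<beta> p)"
  by (simp_all add: Xb_def sb_def al_def bl_def)

lemma tag_KO: "p \<in> Ob P \<Longrightarrow> fob K (p, (Xb (c, s p), Xb (c, p))) = (if c then KL p else fob (ff G) p)"
  by (cases c) (simp_all only: tag_simps ff_G if_True if_False)

lemma exp_name_inverse: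
  assumes "p \<in> Ob P" "i \<in> car I m"
  shows "exp_comp I (fob G p) (fob (ff G) p) (fob G p) m
      (exp_name I (fob (ff G) p) (\<alpha> p) m i, exp_name I (fob G p) (\<beta> p) m i) = eid I (fob G p) m i"
    "exp_comp I (fob (ff G) p) (fob G p) (fob (ff G) p) m
      (exp_name I (fob G p) (\<beta> p) m i, exp_name I (fob (ff G) p) (\<alpha> p) m i) = eid I (fob (ff G) p) m i"
  unfolding exp_name_comp[OF I G_slice[OF assms(1)] ff_slice[OF assms(1)] beta[OF assms(1)] alpha[OF
      assms(1)] assms(2), symmetric]
    exp_name_comp[OF I ff_slice[OF assms(1)] G_slice[OF assms(1)] alpha[OF assms(1)] beta[OF assms(1)]
        assms(2), symmetric]
    alpha_beta[OF assms(1)] beta_alpha[OF assms(1)] by (rule refl)+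

text \<open>Hom-objects ignore the tags, so an element from \<open>p\<close> to \<open>q\<close>
  also counts as one between differently tagged copies, and \<open>cmp.fx\<close> acts on it between
  the corresponding solutions.\<close>

sublocale cmp: contractive_system I "(UNIV :: bool set) \<times> Ob P" "\<lambda>p q. Hom P (snd p) (snd q)"
  "\<lambda>p q r. Comp P (snd p) (snd q) (snd r)" "\<lambda>p. Id P (snd p)" sb "swe {..<n}" Xb
  "\<lambda>p. fob K (snd p, (Xb (sb p), Xb p))"
  "\<lambda>p q m h z. act (snd p) (Xb (sb p), Xb p) (snd q) (Xb (sb q), Xb q) m h (fst h, z)" al bl
  "\<lambda>p q. prod_slice (exp_slice I (Xb (sb q)) (Xb (sb p))) (exp_slice I (Xb p) (Xb q))"
proof (rule fixpoint_system[where u=snd and s=sb and Obs="(UNIV :: bool set) \<times> Ob P"])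
  fix cp assume A: "cp \<in> (UNIV :: bool set) \<times> Ob P"
  then obtain c p where cp: "cp = (c, p)" "p \<in> Ob P" by blast
  show "snd cp \<in> Ob P" "sb cp \<in> (UNIV :: bool set) \<times> Ob P" "sb (sb cp) = cp" "snd (sb cp) = s (snd cp)"
    unfolding cp(1) sb_def using swp_Ob[OF cp(2)] swp_Ob2[OF cp(2)] cp(2) by (auto simp del: pow_simps)
  show "Xb cp \<in> SO U I"
    unfolding cp(1) using Lim_SO[OF cp(2)] G_SO[OF cp(2)] by (cases c) (simp_all only: tag_simps)
  show "compatible I (fob K (snd cp, Xb (sb cp), Xb cp)) (Xb cp) (al cp)"
    unfolding cp(1) tag_simps(3) snd_conv tag_KO[OF cp(2)]
    using fold_compatible[OF cp(2)] compatible_name[OF I ff_slice[OF cp(2)] alpha[OF cp(2)]]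
    by (cases c) (simp_all only: tag_simps if_True if_False)
  show "compatible I (Xb cp) (fob K (snd cp, Xb (sb cp), Xb cp)) (bl cp)"
    unfolding cp(1) tag_simps(3) snd_conv tag_KO[OF cp(2)]
    using unfold_compatible[OF cp(2)] compatible_name[OF I G_slice[OF cp(2)] beta[OF cp(2)]]
    by (cases c) (simp_all only: tag_simps if_True if_False)
  fix m i assume i: "i \<in> car I m"
  show "exp_comp I (Xb cp) (fob K (snd cp, Xb (sb cp), Xb cp)) (Xb cp) m (al cp m i, bl cp m i) = eid
      I (Xb cp) m i"
    unfolding cp(1) tag_simps(3) snd_conv tag_KO[OF cp(2)]
    using fold_unfold[OF cp(2) i] exp_name_inverse[OF cp(2) i]
    by (cases c) (simp_all only: tag_simps if_True if_False)
  show "exp_comp I (fob K (snd cp, Xb (sb cp), Xb cp)) (Xb cp) (fob K (snd cp, Xb (sb cp), Xb cp)) m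
      (bl cp m i, al cp m i) =
      eid I (fob K (snd cp, Xb (sb cp), Xb cp)) m i"
    unfolding cp(1) tag_simps(3) snd_conv tag_KO[OF cp(2)]
    using fold_unfold[OF cp(2) i] exp_name_inverse[OF cp(2) i]
    by (cases c) (simp_all only: tag_simps if_True if_False)
qed

lemma tag_mem: "p \<in> Ob P \<Longrightarrow> (c, p) \<in> (UNIV :: bool set) \<times> Ob P"
  by blast

text \<open>Between copies tagged \<open>True\<close> the equation is the one that defines
  \<open>Fix F\<close>, so uniqueness identifies the two actions.\<close>

lemma cmp_fx_True:
  assumes "p \<in> Ob P" "q \<in> Ob P" "h \<in> fibre (Hom P p q) m i"
  shows "cmp.fx m (True, p) (True, q) h = fp.fx m p q h"
proof (rule cmp.fx_unique[symmetric])
  note sh = powM_swap(1)[OF assms(3)] and sp = swp_Ob[OF assms(1)] swp_Ob[OF assms(2)]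
  show "(True, p) \<in> (UNIV :: bool set) \<times> Ob P" "(True, q) \<in> (UNIV :: bool set) \<times> Ob P" using
      assms(1,2) by blast+
  show "h \<in> fibre (Hom P (snd (True, p)) (snd (True, q))) m i"
    using assms(3) by (simp only: snd_conv)
  show "fp.fx m (s q) (s p) (swe {..<n} h) \<in> fibre (exp_slice I (Xb (sb (True, q))) (Xb (sb (True,
      p)))) m i"
    unfolding tag_simps by (rule fp.fx_in[OF sp(2,1) sh])
  show "fp.fx m p q h \<in> fibre (exp_slice I (Xb (True, p)) (Xb (True, q))) m i"
    unfolding tag_simps by (rule fp.fx_in[OF assms])
  show "fp.fx m p q h = cmp.cj (True, p) (True, q) m i
      (act (snd (True, p)) (Xb (sb (True, p)), Xb (True, p)) (snd (True, q)) (Xb (sb (True, q)), Xb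
          (True, q)) m h
        (fst h, next_tree (prod_slice (exp_slice I (Xb (sb (True, q))) (Xb (sb (True, p)))) (exp_slice
            I (Xb (True, p)) (Xb (True, q)))) m
          (fp.fx m (s q) (s p) (swe {..<n} h), fp.fx m p q h)))"
    unfolding cmp.cj_def tag_simps snd_conv by (rule fp.fx_eq[OF assms, unfolded fp.cj_def])
  show "fp.fx m (s q) (s p) (swe {..<n} h) = cmp.cj (sb (True, q)) (sb (True, p)) m i
      (act (snd (sb (True, q))) (Xb (sb (sb (True, q))), Xb (sb (True, q))) (snd (sb (True, p))) (Xb
          (sb (sb (True, p))), Xb (sb (True, p))) m (swe {..<n} h)
        (fst (swe {..<n} h), next_tree (prod_slice (exp_slice I (Xb (sb (sb (True, p)))) (Xb (sb (sb
            (True, q))))) (exp_slice I (Xb (sb (True, q))) (Xb (sb (True, p))))) m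
          (fp.fx m p q h, fp.fx m (s q) (s p) (swe {..<n} h))))"
    using fp.fx_eq[OF sp(2,1) sh, unfolded fp.cj_def]
    unfolding cmp.cj_def tag_simps snd_conv fst_conv powM_swap(2)[OF assms(3), unfolded fst_conv
        snd_conv] swp_Ob2[OF assms(1)] swp_Ob2[OF assms(2)] .
qed

text \<open>Uniqueness between copies tagged \<open>False\<close>, with the equations put as
  naturality squares for \<open>\<alpha>\<close> by \<open>cj_iff\<close>. The solution
  \<open>e\<close> and its partner \<open>e'\<close> are left open: they will be names of morphisms
  for a plain functor \<open>G\<close>, and values of \<open>fhom G\<close> for a strong
  one.\<close>

lemma cmp_fx_False:
  assumes p: "p \<in> Ob P" and q: "q \<in> Ob P" and h: "h \<in> fibre (Hom P p q) m i"
    and e': "e' \<in> fibre (exp_slice I (fob G (s q)) (fob G (s p))) m i"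
    and e: "e \<in> fibre (exp_slice I (fob G p) (fob G q)) m i"
    and eq: "exp_comp I (fob (ff G) p) (fob (ff G) q) (fob G q) m (exp_name I (fob (ff G) q) (\<alpha> q) m i,
        act p (GP G p) q (GP G q) m h (i, next_tree (Hom M (GP G p) (GP G q)) m (e', e))) =
      exp_comp I (fob (ff G) p) (fob G p) (fob G q) m (e, exp_name I (fob (ff G) p) (\<alpha> p) m i)"
    and eq': "exp_comp I (fob (ff G) (s q)) (fob (ff G) (s p)) (fob G (s p)) m (exp_name I (fob (ff G)
        (s p)) (\<alpha> (s p)) m i,
        act (s q) (GP G (s q)) (s p) (GP G (s p)) m (swe {..<n} h)
          (i, next_tree (Hom M (GP G (s q)) (GP G (s p))) m (e, e'))) =
      exp_comp I (fob (ff G) (s q)) (fob G (s q)) (fob G (s p)) m (e', exp_name I (fob (ff G) (s q))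
          (\<alpha> (s q)) m i)"
  shows "cmp.fx m (False, p) (False, q) h = e"
proof (rule cmp.fx_unique[symmetric])
  note sh = powM_swap(1)[OF h] and sp = swp_Ob[OF p] swp_Ob[OF q]
  note ss = swp_Ob2[OF p] swp_Ob2[OF q]
  have fst: "fst h = i" using h by (simp add: powM_fibre del: pow_simps)
  show m: "(False, p) \<in> (UNIV :: bool set) \<times> Ob P" "(False, q) \<in> (UNIV :: bool set) \<times> Ob P" using p q
      by blast+
  have sm: "(False, s q) \<in> (UNIV :: bool set) \<times> Ob P" "(False, s p) \<in> (UNIV :: bool set) \<times> Ob P" using
      sp by blast+
  show hh: "h \<in> fibre (Hom P (snd (False, p)) (snd (False, q))) m i"
    using h by (simp only: snd_conv)
  have sh': "swe {..<n} h \<in> fibre (Hom P (snd (False, s q)) (snd (False, s p))) m i"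
    using sh by (simp only: snd_conv)
  show "e' \<in> fibre (exp_slice I (Xb (sb (False, q))) (Xb (sb (False, p)))) m i"
    unfolding tag_simps by (rule e')
  show ee: "e \<in> fibre (exp_slice I (Xb (False, p)) (Xb (False, q))) m i"
    unfolding tag_simps by (rule e)
  have ee': "e' \<in> fibre (exp_slice I (Xb (False, s q)) (Xb (False, s p))) m i"
    unfolding tag_simps by (rule e')
  have P1: "(e', e) \<in> fibre (prod_slice (exp_slice I (Xb (sb (False, q))) (Xb (sb (False, p))))
      (exp_slice I (Xb (False, p)) (Xb (False, q)))) m i"
    unfolding tag_simps fibre_prod using e e' by simp
  have P2: "(e, e') \<in> fibre (prod_slice (exp_slice I (Xb (sb (False, s p))) (Xb (sb (False, s q))))
      (exp_slice I (Xb (False, s q)) (Xb (False, s p)))) m i"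
    unfolding tag_simps fibre_prod ss using e e' by simp
  show "e = cmp.cj (False, p) (False, q) m i
      (act (snd (False, p)) (Xb (sb (False, p)), Xb (False, p)) (snd (False, q)) (Xb (sb (False, q)),
          Xb (False, q)) m h
        (fst h, next_tree (prod_slice (exp_slice I (Xb (sb (False, q))) (Xb (sb (False, p))))
            (exp_slice I (Xb (False, p)) (Xb (False, q)))) m
          (e', e)))"
    unfolding cmp.cj_iff[OF m cmp.KP_in[OF m hh P1] ee]
    using eq unfolding tag_simps snd_conv fst_conv fst ff_G[OF p] ff_G[OF q] mixed_ecat_simps(2) .
  show "e' = cmp.cj (sb (False, q)) (sb (False, p)) m i
      (act (snd (sb (False, q))) (Xb (sb (sb (False, q))), Xb (sb (False, q))) (snd (sb (False, p)))
          (Xb (sb (sb (False, p))), Xb (sb (False, p))) m (swe {..<n} h)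
        (fst (swe {..<n} h), next_tree (prod_slice (exp_slice I (Xb (sb (sb (False, p)))) (Xb (sb (sb
            (False, q))))) (exp_slice I (Xb (sb (False, q))) (Xb (sb (False, p))))) m
          (e, e')))"
    unfolding tag_simps(3) cmp.cj_iff[OF sm cmp.KP_in[OF sm sh' P2] ee', unfolded tag_simps(3)]
    using eq' unfolding tag_simps snd_conv fst_conv fst ff_G[OF sp(1)] ff_G[OF sp(2)] ss
        mixed_ecat_simps(2) .
qed

text \<open>The identity of \<open>p\<close> joins the two copies of \<open>p\<close>; its image is
  the comparison of the two solutions at \<open>p\<close>, and \<open>th'\<close> is the one in the
  other direction.\<close>

definition th :: "'u tuple \<Rightarrow> nat \<Rightarrow> 'u \<Rightarrow> 'u el" where
  "th p m i = cmp.fx m (True, p) (False, p) (Id P p m i)"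

definition th' :: "'u tuple \<Rightarrow> nat \<Rightarrow> 'u \<Rightarrow> 'u el" where
  "th' p m i = cmp.fx m (False, p) (True, p) (Id P p m i)"

lemma th_compatible:
  assumes p: "p \<in> Ob P"
  shows "compatible I (Lim p) (fob G p) (th p)" "compatible I (fob G p) (Lim p) (th' p)"
proof -
  have "compatible I (Xb (c, p)) (Xb (d, p)) (\<lambda>m i. cmp.fx m (c, p) (d, p) (Id P p m i))" for c d
    unfolding compatible_def
  proof (intro conjI allI ballI)
    fix m i assume i: "i \<in> car I m"
    show "cmp.fx m (c, p) (d, p) (Id P p m i) \<in> fibre (exp_slice I (Xb (c, p)) (Xb (d, p))) m i"
      by (rule cmp.fx_in[OF tag_mem[OF p] tag_mem[OF p]]) (unfold snd_conv, rule powM_id_in[OF I p i])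
  next
    fix m i assume i: "i \<in> car I (Suc m)"
    have "Id P p (Suc m) i \<in> fibre (Hom P (snd (c, p)) (snd (d, p))) (Suc m) i"
      unfolding snd_conv by (rule powM_id_in[OF I p i])
    from cmp.fx_res[OF tag_mem[OF p] tag_mem[OF p] this]
    show "res (exp_slice I (Xb (c, p)) (Xb (d, p))) m (cmp.fx (Suc m) (c, p) (d, p) (Id P p (Suc m) i)) =
        cmp.fx m (c, p) (d, p) (Id P p m (res I m i))"
      unfolding snd_conv powM_id_res[OF I p i] .
  qed
  from this[of True False] this[of False True]
  show "compatible I (Lim p) (fob G p) (th p)" "compatible I (fob G p) (Lim p) (th' p)"
    unfolding tag_simps th_def[abs_def] th'_def[abs_def] .
qed

text \<open>The identity after itself is the identity, so functoriality of \<open>cmp.fx\<close>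
  makes the two comparisons inverse to each other.\<close>

lemma cmp_id_id:
  assumes p: "p \<in> Ob P" and i: "i \<in> car I m"
  shows "exp_comp I (Xb (c, p)) (Xb (d, p)) (Xb (c, p)) m
      (cmp.fx m (d, p) (c, p) (Id P p m i), cmp.fx m (c, p) (d, p) (Id P p m i)) = eid I (Xb (c, p)) m i"
  using cmp.fx_comp[OF tag_mem[OF p] tag_mem[OF p] tag_mem[OF p], unfolded snd_conv, OF powM_id_in[OF
      I p i] powM_id_in[OF I p i], of c c d]
    cmp.fx_id[OF tag_mem[OF p] i, unfolded snd_conv, of c]
  unfolding powM_comp_id(1)[OF I p p powM_id_in[OF I p i]] by (simp only:)

lemma th_inverse:
  assumes p: "p \<in> Ob P" and i: "i \<in> car I m"
  shows "exp_comp I (Lim p) (fob G p) (Lim p) m (th' p m i, th p m i) = eid I (Lim p) m i"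
    "exp_comp I (fob G p) (Lim p) (fob G p) m (th p m i, th' p m i) = eid I (fob G p) m i"
  using cmp_id_id[OF assms, of True False] cmp_id_id[OF assms, of False True]
  unfolding tag_simps th_def th'_def .

text \<open>Both sides are the image of \<open>h\<close> from \<open>(True, p)\<close> to
  \<open>(False, q)\<close>: \<open>h\<close> is the identity after \<open>h\<close> and also
  \<open>h\<close> after the identity, and in each case the identity carries the change of
  tag.\<close>

lemma th_natural:
  assumes "p \<in> Ob P" "q \<in> Ob P" "h \<in> fibre (Hom P p q) m i"
  shows "exp_comp I (Lim p) (Lim q) (fob G q) m (th q m i, fix_hom p q m h) =
    exp_comp I (Lim p) (fob G p) (fob G q) m (cmp.fx m (False, p) (False, q) h, th p m i)"
proof -
  have i: "i \<in> car I m" by (rule fibre_base[OF powM_slice[OF I] assms(3)])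
  note ids = powM_id_in[OF I assms(1) i] powM_id_in[OF I assms(2) i]
  note m = tag_mem[OF assms(1)] tag_mem[OF assms(2)]
  note 1 = cmp.fx_comp[OF m(1) m(2) m(2), unfolded snd_conv, OF ids(2) assms(3), of True False True]
  note 2 = cmp.fx_comp[OF m(1) m(1) m(2), unfolded snd_conv, OF assms(3) ids(1), of True False False]
  show ?thesis
    using 1 2
    unfolding powM_comp_id[OF I assms] tag_simps th_def fix_hom[OF assms(3)] cmp_fx_True[OF assms] by
        (simp only:)
qed

text \<open>Naturality of \<open>\<alpha>\<close> at \<open>f\<close>, and at \<open>s f\<close> for
  the partner, gives the squares required by \<open>cmp_fx_False\<close>. Ordinary naturality
  suffices, because only names of morphisms occur.\<close>

lemma cmp_fx_mor:
  assumes A: "p \<in> Ob P" "q \<in> Ob P" "f \<in> Arr (dom_cat U I n) p q" and i: "i \<in> car I m"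
  shows "cmp.fx m (False, p) (False, q) (dom_name I n p q f m i) = exp_name I (fob G p) (fmor G p q f)
      m i"
proof -
  have N: "exp_comp I (fob (ff G) p) (fob (ff G) q) (fob G q) m (exp_name I (fob (ff G) q) (\<alpha> q) m i,
        act p (GP G p) q (GP G q) m (dom_name I n p q f m i) (i, next_tree (Hom M (GP G p) (GP G q)) m
          (exp_name I (fob G (s q)) (fmor G (s q) (s p) (s f)) m i, exp_name I (fob G p) (fmor G p q
              f) m i))) =
      exp_comp I (fob (ff G) p) (fob G p) (fob G q) m
        (exp_name I (fob G p) (fmor G p q f) m i, exp_name I (fob (ff G) p) (\<alpha> p) m i)"
    if A: "p \<in> Ob P" "q \<in> Ob P" "f \<in> Arr (dom_cat U I n) p q" for p q f
    unfolding ff_mor(2)[OF G A i, symmetric]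
      exp_name_comp[OF I ff_slice[OF A(1)] ff_slice[OF A(2)] ff_mor(1)[OF G A] alpha[OF A(2)] i,
          symmetric]
      exp_name_comp[OF I ff_slice[OF A(1)] G_slice[OF A(1)] alpha[OF A(1)] functorD(3)[OF G A] i,
          symmetric]
      alpha_nat[OF A] ..
  note sA = swp_Ob[OF A(2)] swp_Ob[OF A(1)] swp_Arr[OF A(3)]
  have "f \<in> extensional {..<n}" using A(3) by (auto simp: PiE_iff)
  then have sf: "s (s f) = f" by (rule swp_swp)
  note in' = exp_name_in[OF I G_slice[OF sA(1)] functorD(3)[OF G sA] i]
    exp_name_in[OF I G_slice[OF A(1)] functorD(3)[OF G A] i]
  show ?thesis
    using N[OF sA]
    unfolding dom_name_swap[OF i] swp_Ob2[OF A(1)] swp_Ob2[OF A(2)] sf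
    by (rule cmp_fx_False[OF A(1,2) dom_name_in[OF I A i] in' N[OF A], unfolded swp_Ob2[OF A(1)]
        swp_Ob2[OF A(2)]])
qed

lemma th_natural_iso:
  "natural_iso (dom_cat U I n) (slice_cat U I) FixF G (\<lambda>p. mor_of (fob FixF p) (th p))"
proof (rule natural_isoI[OF I, where b=th'])
  fix p assume p: "p \<in> Ob P"
  show "is_slice I (fob FixF p)" "is_slice I (fob G p)"
    unfolding FixF_sel by (rule Lim_slice[OF p] G_slice[OF p])+
  show "compatible I (fob FixF p) (fob G p) (th p)" "compatible I (fob G p) (fob FixF p) (th' p)"
    unfolding FixF_sel by (rule th_compatible[OF p])+
  fix m i assume i: "i \<in> car I m"
  show "exp_comp I (fob G p) (fob FixF p) (fob G p) m (th p m i, th' p m i) = eid I (fob G p) m i"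
    "exp_comp I (fob FixF p) (fob G p) (fob FixF p) m (th' p m i, th p m i) = eid I (fob FixF p) m i"
    unfolding FixF_sel by (rule th_inverse[OF p i])+
next
  fix p q f assume A: "p \<in> Ob P" "q \<in> Ob P" "f \<in> Arr (dom_cat U I n) p q"
  show "fmor FixF p q f \<in> slice_hom (fob FixF p) (fob FixF q)"
    by (rule functorD(3)[OF FixF_functor A])
  show "fmor G p q f \<in> slice_hom (fob G p) (fob G q)"
    by (rule functorD(3)[OF G A])
  fix m i assume i: "i \<in> car I m"
  show "exp_comp I (fob FixF p) (fob FixF q) (fob G q) m (th q m i, exp_name I (fob FixF p) (fmor FixF
      p q f) m i) =
      exp_comp I (fob FixF p) (fob G p) (fob G q) m (exp_name I (fob G p) (fmor G p q f) m i, th p m i)"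
    unfolding strong_name[OF FixF_strong A i] cmp_fx_mor[OF A i, symmetric]
    unfolding FixF_sel by (rule th_natural[OF A(1,2) dom_name_in[OF I A i]])
qed

text \<open>Enriched naturality of \<open>\<alpha>\<close> shows that \<open>fhom G\<close> solves
  the equation at every element, not only at names. Then \<open>th_natural\<close> is the enriched
  naturality of the comparison.\<close>

lemma th_strong_natural_iso:
  assumes strong: "strong_functor U I n G" and iso: "strong_natural_iso U I n (ff G) G \<alpha>"
  shows "strong_natural_iso U I n FixF G (\<lambda>p. mor_of (fob FixF p) (th p))"
proof (rule strong_natural_isoI[OF th_natural_iso])
  fix p q m i h assume A: "p \<in> Ob P" "q \<in> Ob P" "h \<in> fibre (Hom P p q) m i"
  have i: "i \<in> car I m" by (rule fibre_base[OF powM_slice[OF I] A(3)])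
  have Ghom: "fhom G p q m h \<in> fibre (exp_slice I (fob G p) (fob G q)) m i"
    if "p \<in> Ob P" "q \<in> Ob P" "h \<in> fibre (Hom P p q) m i" for p q h
    using efunctorD(2)[of I P "slice_ecat U I" G] that strong unfolding strong_functor_def dom_ecat_eq
    by (metis slice_ecat_simps(2))
  have N: "exp_comp I (fob (ff G) p) (fob (ff G) q) (fob G q) m (exp_name I (fob (ff G) q) (\<alpha> q) m i,
        act p (GP G p) q (GP G q) m h (i, next_tree (Hom M (GP G p) (GP G q)) m
          (fhom G (s q) (s p) m (swe {..<n} h), fhom G p q m h))) =
      exp_comp I (fob (ff G) p) (fob G p) (fob G q) m
        (fhom G p q m h, exp_name I (fob (ff G) p) (\<alpha> p) m i)"
    if A: "p \<in> Ob P" "q \<in> Ob P" "h \<in> fibre (Hom P p q) m i" for p q h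
  proof -
    have z: "(fhom G (s q) (s p) m (swe {..<n} h), fhom G p q m h) \<in> fibre (Hom M (GP G p) (GP G q)) m i"
      unfolding mixed_fibre fst_conv snd_conv
      using Ghom[OF swp_Ob[OF A(2)] swp_Ob[OF A(1)] powM_swap(1)[OF A(3)]] Ghom[OF A] by blast
    have "prj (Hom P p q) m h = i" "h \<in> car (Hom P p q) m" using A(3) by (simp_all add: fibre_def del:
        pow_simps)
    then have "exp_comp I (fob (ff G) p) (fob (ff G) q) (fob G q) m
        (exp_name I (fob (ff G) q) (\<alpha> q) m i, fhom (ff G) p q m h) =
      exp_comp I (fob (ff G) p) (fob G p) (fob G q) m (fhom G p q m h, exp_name I (fob (ff G) p) (\<alpha> p)
          m i)"
      using iso A(1,2) unfolding strong_natural_iso_def dom_ecat_eq Let_def by metis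
    then show ?thesis
      unfolding ff_hom[OF A(1,2) GP_Ob[OF A(1)] GP_Ob[OF A(2)] A(3) z] .
  qed
  note sA = swp_Ob[OF A(2)] swp_Ob[OF A(1)] powM_swap(1)[OF A(3)]
  have fx: "cmp.fx m (False, p) (False, q) h = fhom G p q m h"
    using N[OF sA]
    unfolding swp_Ob2[OF A(1)] swp_Ob2[OF A(2)] snd_conv fst_conv powM_swap(2)[OF A(3), unfolded
        fst_conv snd_conv]
    by (rule cmp_fx_False[OF A Ghom[OF sA] Ghom[OF A] N[OF A], unfolded swp_Ob2[OF A(1)] swp_Ob2[OF
        A(2)]])
  have th: "exp_name I (fob FixF p) (mor_of (fob FixF p) (th p)) m i = th p m i" if "p \<in> Ob P" for p
    unfolding FixF_sel by (rule mor_of(2)[OF I Lim_slice[OF that] th_compatible(1)[OF that] i])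
  show "exp_comp I (fob FixF p) (fob FixF q) (fob G q) m
        (exp_name I (fob FixF q) (mor_of (fob FixF q) (th q)) m i, fhom FixF p q m h) =
      exp_comp I (fob FixF p) (fob G p) (fob G q) m
        (fhom G p q m h, exp_name I (fob FixF p) (mor_of (fob FixF p) (th p)) m i)"
    unfolding th[OF A(1)] th[OF A(2)] unfolding FixF_sel fx[symmetric] by (rule th_natural[OF A])
qed

end

context fix_ctx
begin

text \<open>One comparison serves both readings: it is built from the underlying functor of
  \<open>G\<close>, and strength only improves its naturality.\<close>

lemma fix_unique:
  assumes G: "is_functor (dom_cat U I n) (slice_cat U I) G"
    and iso: "natural_iso (dom_cat U I n) (slice_cat U I) (ff G) G \<alpha>"
  shows "\<exists>\<theta>. natural_iso (dom_cat U I n) (slice_cat U I) FixF G \<theta> \<and>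
    (strong_functor U I n G \<and> strong_natural_iso U I n (ff G) G \<alpha> \<longrightarrow> strong_natural_iso U I n FixF G \<theta>)"
proof -
  have "\<forall>p\<in>Ob P. \<exists>\<beta>. \<beta> \<in> slice_hom (fob G p) (fob (ff G) p) \<and>
      hcomp (fob (ff G) p) \<beta> (\<alpha> p) = hid (fob (ff G) p) \<and> hcomp (fob G p) (\<alpha> p) \<beta> = hid (fob G p)"
    using iso unfolding natural_iso_def dom_Ob slice_cat_simps by blast
  then obtain \<beta> where \<beta>: "\<And>p. p \<in> Ob P \<Longrightarrow> \<beta> p \<in> slice_hom (fob G p) (fob (ff G) p) \<and>
      hcomp (fob (ff G) p) (\<beta> p) (\<alpha> p) = hid (fob (ff G) p) \<and> hcomp (fob G p) (\<alpha> p) (\<beta> p) = hid (fob G p)"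
    by metis
  interpret fix_compare U I n K T F G \<alpha> \<beta>
  proof (unfold_locales, rule G)
    show "\<alpha> p \<in> slice_hom (fob (ff G) p) (fob G p)" if "p \<in> Ob P" for p
      using iso that unfolding natural_iso_def dom_Ob slice_cat_simps by blast
    show "hcomp (fob (ff G) p) (\<alpha> q) (fmor (ff G) p q f) = hcomp (fob (ff G) p) (fmor G p q f) (\<alpha> p)"
      if "p \<in> Ob P" "q \<in> Ob P" "f \<in> Arr (dom_cat U I n) p q" for p q f
      using iso that unfolding natural_iso_def dom_Ob slice_cat_simps by blast
  qed (use \<beta> in blast)+
  show ?thesis
  proof (rule exI[where x="\<lambda>p. mor_of (fob FixF p) (th p)"], intro conjI impI, rule th_natural_iso)
    assume "strong_functor U I n G \<and> strong_natural_iso U I n (ff G) G \<alpha>"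
    then show "strong_natural_iso U I n FixF G (\<lambda>p. mor_of (fob FixF p) (th p))"
      by (elim conjE) (rule th_strong_natural_iso)
  qed
qed

end

section \<open>Local contractiveness of the fixed point\<close>

abbreviation laterM where "laterM U I \<equiv> later_ecat I (mixed_ecat U I)"

lemma laterM_Hom: "Hom (laterM U I) A B = later_slice I (Hom (mixed_ecat U I) A B)"
  by (rule later_simps(2))

lemma laterM_comp_in:
  assumes "is_tree I" "A \<in> SO U I \<times> SO U I" "D \<in> SO U I \<times> SO U I"
    and g: "g \<in> fibre (Hom (laterM U I) B D) m i" and f: "f \<in> fibre (Hom (laterM U I) A B) m i"
  shows "Comp (laterM U I) A B D m (g, f) \<in> fibre (Hom (laterM U I) A D) m i"
proof -
  have i: "i \<in> car I m"
    by (rule fibre_base[OF later_slice_is_slice[OF assms(1) mixed_slice[OF assms(1)]] g[unfolded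
        laterM_Hom]])
  from g[unfolded laterM_Hom] show ?thesis
  proof (cases rule: later_cases)
    case 1
    have "f = (i, None)" using f[unfolded laterM_Hom] by (cases rule: later_cases) (use 1 in auto)
    then show ?thesis using i 1 by (simp add: later_comp_0 fibre_later del: mixed_ecat_simps)
  next
    case (2 k y)
    obtain x where x: "f = (i, Some x)" "x \<in> fibre (Hom (mixed_ecat U I) A B) k (res I k i)"
      using f[unfolded laterM_Hom] by (cases rule: later_cases) (use 2 in auto)
    show ?thesis
      unfolding laterM_Hom x(1) 2(1,2) later_comp_Suc[OF i[unfolded 2(1)] 2(3) x(2)]
      by (rule later_some_in[OF i[unfolded 2(1)] mixed_comp_in[OF assms(1-3) 2(3) x(2)]])
  qed
qed

lemma laterM_id:
  assumes "is_tree I" "A \<in> SO U I \<times> SO U I" "i \<in> car I m"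
  shows "Id (laterM U I) A m i = (i, next_tree (Hom (mixed_ecat U I) A A) m (Id (mixed_ecat U I) A m i))"
    "Id (laterM U I) A m i \<in> fibre (Hom (laterM U I) A A) m i"
proof -
  note D = mixed_id_in[OF assms]
  show E: "Id (laterM U I) A m i = (i, next_tree (Hom (mixed_ecat U I) A A) m (Id (mixed_ecat U I) A m
      i))"
    by (rule later_id[OF assms(3) D])
  show "Id (laterM U I) A m i \<in> fibre (Hom (laterM U I) A A) m i"
    unfolding E laterM_Hom by (rule next_in_later[OF mixed_slice[OF assms(1)] D])
qed

lemma laterM_comp_id:
  assumes "is_tree I" "A \<in> SO U I \<times> SO U I" "B \<in> SO U I \<times> SO U I"
    and f: "f \<in> fibre (Hom (laterM U I) A B) m i"
  shows "Comp (laterM U I) A B B m (Id (laterM U I) B m i, f) = f"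
proof -
  have i: "i \<in> car I m"
    by (rule fibre_base[OF later_slice_is_slice[OF assms(1) mixed_slice[OF assms(1)]] f[unfolded
        laterM_Hom]])
  note D = laterM_id(1)[OF assms(1,3) i]
  note N = next_tree_eq[OF mixed_id_in[OF assms(1,3) i]]
  from f[unfolded laterM_Hom] show ?thesis
  proof (cases rule: later_cases)
    case 1
    then show ?thesis
      unfolding D N using later_comp_0[OF i[unfolded 1(1)]] by (simp del: mixed_ecat_simps)
  next
    case (2 k y)
    have i': "res I k i \<in> car I k" using i 2(1) tree_res_in[OF assms(1)] by simp
    have E: "Id (laterM U I) B m i = (i, Some (Id (mixed_ecat U I) B k (res I k i)))"
      unfolding D N using mixed_id_res[OF assms(1,3) i[unfolded 2(1)]] 2(1) by (simp del:
          mixed_ecat_simps)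
    show ?thesis
      unfolding E unfolding 2(1,2) later_comp_Suc[OF i[unfolded 2(1)] mixed_id_in[OF assms(1,3) i'] 2(3)]
        mixed_comp_id(1)[OF assms(1-3) 2(3)] ..
  qed
qed

definition swl :: "'i \<times> ('a \<times> 'b) option \<Rightarrow> 'i \<times> ('b \<times> 'a) option" where
  "swl z = (fst z, map_option prod.swap (snd z))"

lemma swl_next:
  assumes "y \<in> fibre (Hom (mixed_ecat U I) A B) m i"
  shows "swl (i, next_tree (Hom (mixed_ecat U I) A B) m y) =
    (i, next_tree (Hom (mixed_ecat U I) (prod.swap B) (prod.swap A)) m (prod.swap y))"
  unfolding swl_def next_tree_eq[OF assms] next_tree_eq[OF mixed_swap_in[OF assms]]
  using mixed_swap_res[of y U I A B] assms by (auto split: nat.split simp del: mixed_ecat_simps)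

lemma laterM_swap:
  assumes "is_tree I" and f: "f \<in> fibre (Hom (laterM U I) A B) m i"
  shows "swl f \<in> fibre (Hom (laterM U I) (prod.swap B) (prod.swap A)) m i" "swl (swl f) = f"
proof -
  have i: "i \<in> car I m"
    by (rule fibre_base[OF later_slice_is_slice[OF assms(1) mixed_slice[OF assms(1)]] f[unfolded
        laterM_Hom]])
  from f[unfolded laterM_Hom] show "swl f \<in> fibre (Hom (laterM U I) (prod.swap B) (prod.swap A)) m i"
    unfolding laterM_Hom
  proof (cases rule: later_cases)
    case 1
    then show "swl f \<in> fibre (later_slice I (Hom (mixed_ecat U I) (prod.swap B) (prod.swap A))) m i"
      using i by (simp add: swl_def fibre_later)
  next
    case (2 k y)
    have "swl f = (i, Some (prod.swap y))" by (simp add: 2(2) swl_def)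
    then show "swl f \<in> fibre (later_slice I (Hom (mixed_ecat U I) (prod.swap B) (prod.swap A))) m i"
      using later_some_in[OF i[unfolded 2(1)] mixed_swap_in[OF 2(3)]] by (simp only: 2(1))
  qed
  show "swl (swl f) = f"
    by (cases f; cases "snd f") (auto simp: swl_def)
qed

lemma laterM_swap_res:
  assumes "is_tree I" and f: "f \<in> fibre (Hom (laterM U I) A B) (Suc m) i"
  shows "res (Hom (laterM U I) (prod.swap B) (prod.swap A)) m (swl f) = swl (res (Hom (laterM U I) A
      B) m f)"
proof -
  have i: "i \<in> car I (Suc m)"
    by (rule fibre_base[OF later_slice_is_slice[OF assms(1) mixed_slice[OF assms(1)]] f[unfolded
        laterM_Hom]])
  obtain y where y: "f = (i, Some y)" "y \<in> fibre (Hom (mixed_ecat U I) A B) m (res I m i)"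
    using f[unfolded laterM_Hom] by (cases rule: later_cases) auto
  have "swl f = (i, Some (prod.swap y))" by (simp add: y(1) swl_def)
  then show ?thesis
    using res_later[OF later_some_in[OF i y(2)]] res_later[OF later_some_in[OF i mixed_swap_in[OF y(2)]]]
    unfolding laterM_Hom y(1) swl_next[OF y(2)] by (simp only: swl_next[OF y(2)])
qed

lemma laterM_swap_comp:
  assumes I: "is_tree I"
    and g: "g \<in> fibre (Hom (laterM U I) B D) m i" and f: "f \<in> fibre (Hom (laterM U I) A B) m i"
  shows "swl (Comp (laterM U I) A B D m (g, f)) =
    Comp (laterM U I) (prod.swap D) (prod.swap B) (prod.swap A) m (swl f, swl g)"
proof -
  have i: "i \<in> car I m"
    by (rule fibre_base[OF later_slice_is_slice[OF I mixed_slice[OF I]] g[unfolded laterM_Hom]])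
  from g[unfolded laterM_Hom] show ?thesis
  proof (cases rule: later_cases)
    case 1
    have "f = (i, None)" using f[unfolded laterM_Hom] by (cases rule: later_cases) (use 1 in auto)
    then show ?thesis using i 1 by (simp add: later_comp_0 swl_def)
  next
    case (2 k y)
    obtain x where x: "f = (i, Some x)" "x \<in> fibre (Hom (mixed_ecat U I) A B) k (res I k i)"
      using f[unfolded laterM_Hom] by (cases rule: later_cases) (use 2 in auto)
    show ?thesis
      using mixed_swap_comp[OF 2(3) x(2)]
        later_comp_Suc[OF i[unfolded 2(1)] mixed_swap_in[OF x(2)] mixed_swap_in[OF 2(3)]]
      unfolding x(1) 2(1,2) later_comp_Suc[OF i[unfolded 2(1)] 2(3) x(2)]
      by (simp add: swl_def del: mixed_ecat_simps)
  qed
qed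

lemma conM_fibre:
  "z \<in> fibre (Hom (conM U I J) A B) m i \<longleftrightarrow>
    fst z \<in> fibre (Hom (powM U I J) (fst A) (fst B)) m i \<and> snd z \<in> fibre (Hom (laterM U I) (snd A)
        (snd B)) m i"
  unfolding prod_simps(2) by (rule fibre_prod)

lemma conM_res:
  "z \<in> fibre (Hom (conM U I J) A B) (Suc m) i \<Longrightarrow> res (Hom (conM U I J) A B) m z =
    (res (Hom (powM U I J) (fst A) (fst B)) m (fst z), res (Hom (laterM U I) (snd A) (snd B)) m (snd z))"
  unfolding prod_simps(2) by (rule res_prod_fibre)

text \<open>A second factor \<open>Kk\<close> of the same \<open>F\<close>, delayed in the variable
  \<open>k\<close>. Its undelayed indices are \<open>J'\<close> and \<open>n\<close>, and
  \<open>J'\<close> are the indices that remain when \<open>k\<close> is split off from the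
  parameters of \<open>Fix F\<close>.\<close>

locale fix_contr = fix_ctx U I n K T F for U :: "'u set set" and I n K T F +
  fixes k :: nat and Kk :: "'u con_fun"
    and J' :: "nat set"
  assumes k: "k < n" and J': "J' = {..<n} - {k}"
    and Kk: "is_efunctor I (conM U I (insert n J')) (slice_ecat U I) Kk"
    and Kk_ob: "\<And>p A. p \<in> Ob (powM U I (insert n J')) \<Longrightarrow> A \<in> Ob M \<Longrightarrow> fob F (p(k := A)) = fob Kk (p, A)"
    and Kk_hom: "\<And>p q A B m i h z. p \<in> Ob (powM U I (insert n J')) \<Longrightarrow> q \<in> Ob (powM U I (insert n J')) \<Longrightarrow>
      A \<in> Ob M \<Longrightarrow> B \<in> Ob M \<Longrightarrow> h \<in> fibre (Hom (powM U I (insert n J')) p q) m i \<Longrightarrow>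
      z \<in> fibre (Hom M A B) m i \<Longrightarrow>
      fhom F (p(k := A)) (q(k := B)) m (ext k h z) = fhom Kk (p, A) (q, B) m (h, (i, next_tree (Hom M
          A B) m z))"
begin

lemma index_facts: "n \<notin> J'" "k \<notin> J'" "k \<noteq> n" "insert k J' = {..<n}"
  using k J' by auto

sublocale ck: con_functor U I "insert n J'" Kk
  by unfold_locales (rule I, rule Kk)

abbreviation "P' \<equiv> powM U I J'"
abbreviation "C' \<equiv> conM U I J'"
abbreviation "Q \<equiv> powM U I (insert n J')"

text \<open>Objects of the delayed category keep the \<open>k\<close>th pair apart;
  \<open>rc\<close> puts it back. \<open>Lim\<close> and \<open>KL\<close> are taken at the
  resulting tuple, so the fixed objects stay the same and only the hom-objects change.\<close>

definition rc :: "'u tuple \<times> 'u mixed \<Rightarrow> 'u tuple" where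
  "rc A = (fst A)(k := snd A)"

definition s2 :: "'u tuple \<times> 'u mixed \<Rightarrow> 'u tuple \<times> 'u mixed" where
  "s2 A = (swp J' (fst A), prod.swap (snd A))"

definition \<sigma>2 :: "('u \<times> (nat \<Rightarrow> 'u el \<times> 'u el)) \<times> ('u \<times> ('u el \<times> 'u el) option) \<Rightarrow>
    ('u \<times> (nat \<Rightarrow> 'u el \<times> 'u el)) \<times> ('u \<times> ('u el \<times> 'u el) option)" where
  "\<sigma>2 z = (swe J' (fst z), swl (snd z))"

abbreviation "LA A \<equiv> LP (rc A)"
abbreviation "up A \<equiv> (fst A)(n := LA A)"

lemma con_ObD: "A \<in> Ob C' \<Longrightarrow> fst A \<in> Ob P'" "A \<in> Ob C' \<Longrightarrow> snd A \<in> Ob M"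
  by (auto simp: prod_simps(1) simp del: pow_simps mixed_ecat_simps)

lemma M_SO: "B \<in> Ob M \<Longrightarrow> B \<in> SO U I \<times> SO U I"
  by simp

lemma mix_Ob: "r \<in> Ob P' \<Longrightarrow> b \<in> Ob M \<Longrightarrow> r(k := b) \<in> Ob P"
  using ext_Ob[where J=J' and k=k and p=r and A=b] M_SO[of b] unfolding index_facts(4) by blast

lemma rc_Ob: "A \<in> Ob C' \<Longrightarrow> rc A \<in> Ob P"
  unfolding rc_def by (rule mix_Ob[OF con_ObD])

lemma up_Ob: "A \<in> Ob C' \<Longrightarrow> up A \<in> Ob Q"
  by (rule ext_Ob[OF con_ObD(1) M_SO[OF LP_Ob[OF rc_Ob]]])

lemma s2_Ob: "A \<in> Ob C' \<Longrightarrow> s2 A \<in> Ob C'"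
  using swp_Ob[OF con_ObD(1), of A] con_ObD(2)[of A] by (auto simp: s2_def simp del: pow_simps)

lemma s2_s2: "A \<in> Ob C' \<Longrightarrow> s2 (s2 A) = A"
  using swp_Ob2[OF con_ObD(1), of A] by (simp add: s2_def del: pow_simps)

lemma swp_upd: "swp {..<n} (r(k := b)) = (swp J' r)(k := prod.swap b)"
  using index_facts by (auto simp: swp_def fun_eq_iff)

lemma rc_s2: "rc (s2 A) = s (rc A)"
  unfolding rc_def s2_def swp_upd by simp

text \<open>Both are values of \<open>F\<close> at one tuple, with the entries \<open>k\<close> and
  \<open>n\<close> filled in opposite orders.\<close>

lemma mid_ob: "r \<in> Ob P' \<Longrightarrow> b \<in> Ob M \<Longrightarrow> D \<in> Ob M \<Longrightarrow> fob K (r(k := b), D) = fob Kk (r(n := D), b)"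
  using F_ob[OF mix_Ob, of r b D] Kk_ob[OF ext_Ob[OF _ M_SO], of r D b] fun_upd_twist[OF
      index_facts(3), of r b D]
  by (simp only:)

lemma KL_up: "A \<in> Ob C' \<Longrightarrow> KL (rc A) = fob Kk (up A, snd A)"
  using mid_ob[OF con_ObD LP_Ob[OF rc_Ob], of A A] by (simp add: rc_def)

text \<open>On undelayed elements both factors give the action of \<open>F\<close> on one and the
  same element. This is the only link between \<open>K\<close> and \<open>Kk\<close>, whose domains
  delay different variables.\<close>

lemma F_Kk:
  assumes r: "r \<in> Ob P'" "t \<in> Ob P'" and ab: "a \<in> Ob M" "b \<in> Ob M" and D: "D \<in> Ob M" "D' \<in> Ob M"
    and h: "h \<in> fibre (Hom P' r t) m i" and y: "y \<in> fibre (Hom M a b) m i" and w: "w \<in> fibre (Hom M D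
        D') m i"
  shows "act (r(k := a)) D (t(k := b)) D' m (ext k h y) (i, next_tree (Hom M D D') m w) =
    ck.act (r(n := D)) a (t(n := D')) b m (ext n h w) (i, next_tree (Hom M a b) m y)"
proof -
  have e: "ext k h y \<in> fibre (Hom P (r(k := a)) (t(k := b))) m i"
    using ext_in[OF index_facts(2) h y] unfolding index_facts(4) .
  have "fhom F (r(k := a, n := D)) (t(k := b, n := D')) m (ext n (ext k h y) w) =
      fhom F (r(n := D, k := a)) (t(n := D', k := b)) m (ext k (ext n h w) y)"
    using index_facts(3) by (simp add: fun_upd_twist)
  then show ?thesis
    unfolding F_hom[OF mix_Ob[OF r(1) ab(1)] mix_Ob[OF r(2) ab(2)] D e w]
      Kk_hom[OF ext_Ob[OF r(1) M_SO[OF D(1)]] ext_Ob[OF r(2) M_SO[OF D(2)]] ab ext_in[OF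
          index_facts(1) h w] y] .
qed

text \<open>The action of \<open>F\<close> delayed in both of the variables \<open>k\<close> and \<open>n\<close>, composed of one that is
  delayed in \<open>k\<close> only and the identity in the others, and one that is delayed in \<open>n\<close> only and the
  identity in \<open>k\<close>. It need not be functorial on all delayed elements.\<close>

definition KP2 where
  "KP2 A B m z w = (let i = fst (fst z) in
     exp_comp I (KL (rc A)) (fob Kk (up A, snd B)) (KL (rc B)) m
       (act ((fst A)(k := snd B)) (LA A) (rc B) (LA B) m (ext k (fst z) (Id M (snd B) m i)) (i, w),
        ck.act (up A) (snd A) (up A) (snd B) m (Id Q (up A) m i) (snd z)))"

lemma fst_base: "z \<in> fibre (Hom C' A B) m i \<Longrightarrow> fst (fst z) = i"
  unfolding conM_fibre powM_fibre by blast

lemma con_base: "z \<in> fibre (Hom C' A B) m i \<Longrightarrow> i \<in> car I m"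
  unfolding conM_fibre powM_fibre by blast

text \<open>The two factors of \<open>KP2\<close> meet at the value of \<open>F\<close> with the
  \<open>k\<close>th pair from \<open>B\<close> and everything else from \<open>A\<close>;
  \<open>mid_ob\<close> relates its descriptions by \<open>K\<close> and by
  \<open>Kk\<close>.\<close>

lemma KP2_left_in:
  assumes A: "A \<in> Ob C'" "B \<in> Ob C'" and z: "z \<in> fibre (Hom C' A B) m i"
    and w: "(i, w) \<in> fibre (later_slice I (Hom M (LA A) (LA B))) m i"
  shows "act ((fst A)(k := snd B)) (LA A) (rc B) (LA B) m (ext k (fst z) (Id M (snd B) m i)) (i, w)
    \<in> fibre (E (fob Kk (up A, snd B)) (KL (rc B))) m i"
proof -
  note z1 = z[unfolded conM_fibre, THEN conjunct1]
  have e: "ext k (fst z) (Id M (snd B) m i) \<in> fibre (Hom P ((fst A)(k := snd B)) (rc B)) m i"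
    using ext_in[OF index_facts(2) z1 mixed_id_in[OF I M_SO[OF con_ObD(2)[OF A(2)]] con_base[OF z]]]
    unfolding index_facts(4) rc_def .
  show ?thesis
    unfolding mid_ob[OF con_ObD(1)[OF A(1)] con_ObD(2)[OF A(2)] LP_Ob[OF rc_Ob[OF A(1)]], symmetric]
    by (rule act_in[OF mix_Ob[OF con_ObD(1)[OF A(1)] con_ObD(2)[OF A(2)]] rc_Ob[OF A(2)]
          LP_Ob[OF rc_Ob[OF A(1)]] LP_Ob[OF rc_Ob[OF A(2)]] e w])
qed

lemma KP2_right_in:
  assumes A: "A \<in> Ob C'" "B \<in> Ob C'" and z: "z \<in> fibre (Hom C' A B) m i"
  shows "ck.act (up A) (snd A) (up A) (snd B) m (Id Q (up A) m i) (snd z)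
    \<in> fibre (E (KL (rc A)) (fob Kk (up A, snd B))) m i"
  unfolding KL_up[OF A(1)]
  by (rule ck.act_in[OF up_Ob[OF A(1)] up_Ob[OF A(1)] con_ObD(2)[OF A(1)] con_ObD(2)[OF A(2)]
        powM_id_in[OF I up_Ob[OF A(1)] con_base[OF z]] z[unfolded conM_fibre laterM_Hom, THEN conjunct2]])

lemma KP2_eq:
  assumes z: "z \<in> fibre (Hom C' A B) m i"
  shows "KP2 A B m z w = exp_comp I (KL (rc A)) (fob Kk (up A, snd B)) (KL (rc B)) m
       (act ((fst A)(k := snd B)) (LA A) (rc B) (LA B) m (ext k (fst z) (Id M (snd B) m i)) (i, w),
        ck.act (up A) (snd A) (up A) (snd B) m (Id Q (up A) m i) (snd z))"
  unfolding KP2_def Let_def fst_base[OF z] ..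

lemma KP2_in:
  assumes A: "A \<in> Ob C'" "B \<in> Ob C'" and z: "z \<in> fibre (Hom C' A B) m i"
    and w: "(i, w) \<in> fibre (later_slice I (Hom M (LA A) (LA B))) m i"
  shows "KP2 A B m z w \<in> fibre (E (KL (rc A)) (KL (rc B))) m i"
  unfolding KP2_eq[OF z]
  by (rule exp_comp_in[OF I KL_slice[OF rc_Ob[OF A(1)]] KP2_left_in[OF assms] KP2_right_in[OF A z]])

text \<open>Each of the two factors commutes with restriction, and so does composition; the
  identities that fill the other variables restrict to identities.\<close>

lemma KP2_res:
  assumes A: "A \<in> Ob C'" "B \<in> Ob C'" and z: "z \<in> fibre (Hom C' A B) (Suc m) i"
    and w: "w \<in> fibre (Hom M (LA A) (LA B)) m (res I m i)"
  shows "res (E (KL (rc A)) (KL (rc B))) m (KP2 A B (Suc m) z (Some w)) =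
    KP2 A B m (res (Hom C' A B) m z) (next_tree (Hom M (LA A) (LA B)) m w)"
proof -
  note z1 = z[unfolded conM_fibre, THEN conjunct1] and z2 = z[unfolded conM_fibre laterM_Hom, THEN
      conjunct2]
  note i = con_base[OF z]
  note bM = con_ObD(2)[OF A(2)]
  note mO = mix_Ob[OF con_ObD(1)[OF A(1)] bM]
  note rz = fibre_res[OF con_slice[OF I] z]
  note idM = mixed_id_in[OF I M_SO[OF bM] i]
  have e: "ext k (fst z) (Id M (snd B) (Suc m) i) \<in> fibre (Hom P ((fst A)(k := snd B)) (rc B)) (Suc m) i"
    using ext_in[OF index_facts(2) z1 idM] unfolding index_facts(4) rc_def .
  have er: "res (Hom P ((fst A)(k := snd B)) (rc B)) m (ext k (fst z) (Id M (snd B) (Suc m) i)) =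
      ext k (res (Hom P' (fst A) (fst B)) m (fst z)) (Id M (snd B) m (res I m i))"
    using ext_res[OF index_facts(2) z1 idM] unfolding index_facts(4) rc_def mixed_id_res[OF I M_SO[OF
        bM] i] .
  have L: "res (E (fob Kk (up A, snd B)) (KL (rc B))) m
      (act ((fst A)(k := snd B)) (LA A) (rc B) (LA B) (Suc m) (ext k (fst z) (Id M (snd B) (Suc m) i))
          (i, Some w)) =
      act ((fst A)(k := snd B)) (LA A) (rc B) (LA B) m
        (ext k (res (Hom P' (fst A) (fst B)) m (fst z)) (Id M (snd B) m (res I m i)))
        (res I m i, next_tree (Hom M (LA A) (LA B)) m w)"
    using act_Some_res[OF mO rc_Ob[OF A(2)] LP_Ob[OF rc_Ob[OF A(1)]] LP_Ob[OF rc_Ob[OF A(2)]] e w]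
    unfolding er mid_ob[OF con_ObD(1)[OF A(1)] bM LP_Ob[OF rc_Ob[OF A(1)]]] .
  have R: "res (E (KL (rc A)) (fob Kk (up A, snd B))) m
      (ck.act (up A) (snd A) (up A) (snd B) (Suc m) (Id Q (up A) (Suc m) i) (snd z)) =
      ck.act (up A) (snd A) (up A) (snd B) m (Id Q (up A) m (res I m i))
        (res (Hom (laterM U I) (snd A) (snd B)) m (snd z))"
    using ck.act_res[OF up_Ob[OF A(1)] up_Ob[OF A(1)] con_ObD(2)[OF A(1)] bM powM_id_in[OF I up_Ob[OF
        A(1)] i] z2]
    unfolding powM_id_res[OF I up_Ob[OF A(1)] i] KL_up[OF A(1), symmetric] laterM_Hom .
  show ?thesis
    unfolding KP2_eq[OF z] KP2_eq[OF rz] unfolding conM_res[OF z] fst_conv snd_conv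
    unfolding exp_comp_res[OF I KL_slice[OF rc_Ob[OF A(1)]] KP2_left_in[OF A z later_some_in[OF i w]]
        KP2_right_in[OF A z]]
      L R ..
qed

text \<open>When the last argument comes from an undelayed \<open>w\<close>, the composite is a
  single application of \<open>Kk\<close>, whose laws are then available. A contractive system tests
  composition and identities only at such arguments.\<close>

lemma KP2_next:
  assumes A: "A \<in> Ob C'" "B \<in> Ob C'" and z: "z \<in> fibre (Hom C' A B) m i"
    and w: "w \<in> fibre (Hom M (LA A) (LA B)) m i"
  shows "KP2 A B m z (next_tree (Hom M (LA A) (LA B)) m w) =
    ck.act (up A) (snd A) (up B) (snd B) m (ext n (fst z) w) (snd z)"
proof -
  note z1 = z[unfolded conM_fibre, THEN conjunct1] and z2 = z[unfolded conM_fibre, THEN conjunct2]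
  note i = con_base[OF z]
  note aM = con_ObD(2)[OF A(1)] and bM = con_ObD(2)[OF A(2)]
  note LM = LP_Ob[OF rc_Ob[OF A(1)]] LP_Ob[OF rc_Ob[OF A(2)]]
  note idb = mixed_id_in[OF I M_SO[OF bM] i]
  note e = ext_in[OF index_facts(1) z1 w]
  \<comment> \<open>The left factor has an undelayed identity in the variable \<open>k\<close>, and
    \<open>w\<close> is undelayed too, so \<open>F_Kk\<close> rewrites it from \<open>K\<close> to
    \<open>Kk\<close>. The two factors then merge by the composition law of
    \<open>Kk\<close>.\<close>
  have "act ((fst A)(k := snd B)) (LA A) (rc B) (LA B) m (ext k (fst z) (Id M (snd B) m i))
      (i, next_tree (Hom M (LA A) (LA B)) m w) =
      ck.act (up A) (snd B) (up B) (snd B) m (ext n (fst z) w) (Id (laterM U I) (snd B) m i)"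
    using F_Kk[OF con_ObD(1)[OF A(1)] con_ObD(1)[OF A(2)] bM bM LM z1 idb w]
    unfolding rc_def[of B, symmetric] laterM_id(1)[OF I M_SO[OF bM] i] .
  then show ?thesis
    unfolding KP2_eq[OF z]
    using ck.act_comp[OF up_Ob[OF A(1)] up_Ob[OF A(1)] up_Ob[OF A(2)] aM bM bM e
        laterM_id(2)[OF I M_SO[OF bM] i, unfolded laterM_Hom] powM_id_in[OF I up_Ob[OF A(1)] i]
            z2[unfolded laterM_Hom]]
    unfolding laterM_comp_id[OF I M_SO[OF aM] M_SO[OF bM] z2] powM_comp_id(2)[OF I up_Ob[OF A(1)]
        up_Ob[OF A(2)] e]
      KL_up[OF A(1)] KL_up[OF A(2)] by simp
qed

lemma con_comp:
  assumes "A \<in> Ob C'" "B \<in> Ob C'" "D \<in> Ob C'" "g \<in> fibre (Hom C' B D) m i" "f \<in> fibre (Hom C' A B) m i"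
  shows "Comp C' A B D m (g, f) \<in> fibre (Hom C' A D) m i"
    "\<sigma>2 (Comp C' A B D m (g, f)) = Comp C' (s2 D) (s2 B) (s2 A) m (\<sigma>2 f, \<sigma>2 g)"
proof -
  note g = assms(4)[unfolded conM_fibre, THEN conjunct1] assms(4)[unfolded conM_fibre, THEN conjunct2]
  note f = assms(5)[unfolded conM_fibre, THEN conjunct1] assms(5)[unfolded conM_fibre, THEN conjunct2]
  have sf: "\<sigma>2 f \<in> fibre (Hom C' (s2 B) (s2 A)) m i" "\<sigma>2 g \<in> fibre (Hom C' (s2 D) (s2 B)) m i"
    unfolding conM_fibre \<sigma>2_def s2_def fst_conv snd_conv
    using powM_swap(1)[OF f(1)] laterM_swap(1)[OF I f(2)] powM_swap(1)[OF g(1)] laterM_swap(1)[OF I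
        g(2)] by blast+
  show "Comp C' A B D m (g, f) \<in> fibre (Hom C' A D) m i"
    unfolding conM_fibre prod_comp[OF assms(4,5)] fst_conv snd_conv
    using powM_comp_in[OF I con_ObD(1)[OF assms(1)] con_ObD(1)[OF assms(3)] g(1) f(1)]
      laterM_comp_in[OF I M_SO[OF con_ObD(2)[OF assms(1)]] M_SO[OF con_ObD(2)[OF assms(3)]] g(2) f(2)]
          by blast
  show "\<sigma>2 (Comp C' A B D m (g, f)) = Comp C' (s2 D) (s2 B) (s2 A) m (\<sigma>2 f, \<sigma>2 g)"
    unfolding prod_comp[OF assms(4,5)] prod_comp[OF sf]
    unfolding \<sigma>2_def s2_def fst_conv snd_conv
      powM_swap_comp[OF g(1) f(1), unfolded fst_conv snd_conv] laterM_swap_comp[OF I g(2) f(2)] ..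
qed

lemma con_id:
  assumes "A \<in> Ob C'" "i \<in> car I m"
  shows "Id C' A m i \<in> fibre (Hom C' A A) m i" "\<sigma>2 (Id C' A m i) = Id C' (s2 A) m i"
proof -
  note aM = M_SO[OF con_ObD(2)[OF assms(1)]]
  show "Id C' A m i \<in> fibre (Hom C' A A) m i"
    unfolding conM_fibre prod_simps(3) fst_conv snd_conv
    using powM_id_in[OF I con_ObD(1)[OF assms(1)] assms(2)] laterM_id(2)[OF I aM assms(2)] by blast
  have "swl (Id (laterM U I) (snd A) m i) = Id (laterM U I) (prod.swap (snd A)) m i"
  proof -
    have sM: "prod.swap (snd A) \<in> SO U I \<times> SO U I" using aM by auto
    have "prod.swap (Id M (snd A) m i) = Id M (prod.swap (snd A)) m i" by simp
    then show ?thesis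
      unfolding laterM_id(1)[OF I aM assms(2)] laterM_id(1)[OF I sM assms(2)] swl_next[OF
          mixed_id_in[OF I aM assms(2)]]
      by (simp only:)
  qed
  then show "\<sigma>2 (Id C' A m i) = Id C' (s2 A) m i"
    unfolding \<sigma>2_def s2_def prod_simps(3) fst_conv snd_conv
      powM_swap_id[OF assms(2), unfolded fst_conv snd_conv] by simp
qed

text \<open>Fixed objects and isomorphisms are those of \<open>Fix F\<close>; the elements acted
  upon are now delayed in the variable \<open>k\<close>.\<close>

sublocale cc: contractive_system I "Ob C'" "Hom C'" "Comp C'" "Id C'" s2 \<sigma>2 "\<lambda>A. Lim (rc A)" "\<lambda>A. KL
    (rc A)"
  KP2 "\<lambda>A. fold_el (rc A)" "\<lambda>A. unfold_el (rc A)"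
  "\<lambda>A B. prod_slice (exp_slice I (Lim (rc (s2 B))) (Lim (rc (s2 A)))) (exp_slice I (Lim (rc A)) (Lim
      (rc B)))"
proof -
  have PP: "prod_slice (exp_slice I (Lim (rc (s2 B))) (Lim (rc (s2 A)))) (exp_slice I (Lim (rc A))
      (Lim (rc B))) =
      Hom M (LA A) (LA B)" for A B
    unfolding mixed_ecat_simps(2) fst_conv snd_conv rc_s2 ..
  show "contractive_system I (Ob C') (Hom C') (Comp C') (Id C') s2 \<sigma>2 (\<lambda>A. Lim (rc A)) (\<lambda>A. KL (rc A))
    KP2 (\<lambda>A. fold_el (rc A)) (\<lambda>A. unfold_el (rc A))"
    unfolding contractive_system_def PP
  proof (intro conjI allI impI)
    show "is_tree I" by (rule I)
  next
    fix A assume A: "A \<in> Ob C'"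
    show "s2 A \<in> Ob C'" "s2 (s2 A) = A" by (rule s2_Ob[OF A] s2_s2[OF A])+
    show "is_slice I (Lim (rc A))" "is_slice I (KL (rc A))"
      by (rule Lim_slice[OF rc_Ob[OF A]] KL_slice[OF rc_Ob[OF A]])+
    show "compatible I (KL (rc A)) (Lim (rc A)) (fold_el (rc A))" "compatible I (Lim (rc A)) (KL (rc
        A)) (unfold_el (rc A))"
      by (rule fold_compatible[OF rc_Ob[OF A]] unfold_compatible[OF rc_Ob[OF A]])+
  next
    fix A i m assume A: "A \<in> Ob C'" "i \<in> car I m"
    show "exp_comp I (Lim (rc A)) (KL (rc A)) (Lim (rc A)) m (fold_el (rc A) m i, unfold_el (rc A) m
        i) = eid I (Lim (rc A)) m i"
      "exp_comp I (KL (rc A)) (Lim (rc A)) (KL (rc A)) m (unfold_el (rc A) m i, fold_el (rc A) m i) =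
          eid I (KL (rc A)) m i"
      by (rule fold_unfold[OF rc_Ob[OF A(1)] A(2)])+
    show "Id C' A m i \<in> fibre (Hom C' A A) m i" "\<sigma>2 (Id C' A m i) = Id C' (s2 A) m i"
      by (rule con_id[OF A])+
    note LM = LP_Ob[OF rc_Ob[OF A(1)]]
    note w = mixed_id_in[OF I M_SO[OF LM] A(2)]
    have E: "(eid I (Lim (rc (s2 A))) m i, eid I (Lim (rc A)) m i) = Id M (LA A) m i"
      unfolding mixed_ecat_simps(3) fst_conv snd_conv rc_s2 ..
    show "KP2 A A m (Id C' A m i) (next_tree (Hom M (LA A) (LA A)) m (eid I (Lim (rc (s2 A))) m i, eid
        I (Lim (rc A)) m i)) =
        eid I (KL (rc A)) m i"
      unfolding E KP2_next[OF A(1,1) con_id(1)[OF A] w]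
      unfolding prod_simps(3) fst_conv snd_conv ext_id[OF index_facts(1) A(2), unfolded fst_conv
          snd_conv, symmetric]
        laterM_id(1)[OF I M_SO[OF con_ObD(2)[OF A(1)]] A(2)] KL_up[OF A(1)]
      by (rule ck.act_id[OF up_Ob[OF A(1)] con_ObD(2)[OF A(1)] A(2)])
  next
    fix A B assume "A \<in> Ob C'" "B \<in> Ob C'"
    show "is_slice I (Hom C' A B)" by (rule con_slice[OF I])
  next
    fix A B D g m i f assume A: "A \<in> Ob C'" "B \<in> Ob C'" "D \<in> Ob C'" "g \<in> fibre (Hom C' B D) m i" "f \<in>
        fibre (Hom C' A B) m i"
    show "Comp C' A B D m (g, f) \<in> fibre (Hom C' A D) m i"
      "\<sigma>2 (Comp C' A B D m (g, f)) = Comp C' (s2 D) (s2 B) (s2 A) m (\<sigma>2 f, \<sigma>2 g)"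
      by (rule con_comp[OF A])+
  next
    fix A B h m i assume A: "A \<in> Ob C'" "B \<in> Ob C'" "h \<in> fibre (Hom C' A B) m i"
    note h = A(3)[unfolded conM_fibre, THEN conjunct1] A(3)[unfolded conM_fibre, THEN conjunct2]
    show "\<sigma>2 h \<in> fibre (Hom C' (s2 B) (s2 A)) m i"
      unfolding conM_fibre \<sigma>2_def s2_def fst_conv snd_conv
      using powM_swap(1)[OF h(1)] laterM_swap(1)[OF I h(2)] by blast
    show "\<sigma>2 (\<sigma>2 h) = h"
      unfolding \<sigma>2_def fst_conv snd_conv powM_swap(2)[OF h(1), unfolded fst_conv snd_conv]
          laterM_swap(2)[OF I h(2)]
      by simp
  next
    fix A B h m i assume A: "A \<in> Ob C'" "B \<in> Ob C'" "h \<in> fibre (Hom C' A B) (Suc m) i"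
    note h = A(3)[unfolded conM_fibre, THEN conjunct1] A(3)[unfolded conM_fibre, THEN conjunct2]
    have sh: "\<sigma>2 h \<in> fibre (Hom C' (s2 B) (s2 A)) (Suc m) i"
      unfolding conM_fibre \<sigma>2_def s2_def fst_conv snd_conv
      using powM_swap(1)[OF h(1)] laterM_swap(1)[OF I h(2)] by blast
    show "res (Hom C' (s2 B) (s2 A)) m (\<sigma>2 h) = \<sigma>2 (res (Hom C' A B) m h)"
      unfolding conM_res[OF A(3)] conM_res[OF sh]
      unfolding \<sigma>2_def s2_def fst_conv snd_conv powM_swap_res[OF h(1)] laterM_swap_res[OF I h(2)] ..
  next
    fix A B h i assume A: "A \<in> Ob C'" "B \<in> Ob C'" "h \<in> fibre (Hom C' A B) 0 i"
    show "KP2 A B 0 h None \<in> fibre (exp_slice I (KL (rc A)) (KL (rc B))) 0 i"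
      by (rule KP2_in[OF A later_none_in[OF con_base[OF A(3)]]])
  next
    fix A B h m i w assume A: "A \<in> Ob C'" "B \<in> Ob C'" "h \<in> fibre (Hom C' A B) (Suc m) i"
      "w \<in> fibre (Hom M (LA A) (LA B)) m (res I m i)"
    show "KP2 A B (Suc m) h (Some w) \<in> fibre (exp_slice I (KL (rc A)) (KL (rc B))) (Suc m) i"
      by (rule KP2_in[OF A(1-3) later_some_in[OF con_base[OF A(3)] A(4)]])
    show "res (exp_slice I (KL (rc A)) (KL (rc B))) m (KP2 A B (Suc m) h (Some w)) =
        KP2 A B m (res (Hom C' A B) m h) (next_tree (Hom M (LA A) (LA B)) m w)"
      by (rule KP2_res[OF A])
  next
    fix A B D g m i f g2 g1 f2 f1
    assume A: "A \<in> Ob C'" "B \<in> Ob C'" "D \<in> Ob C'" "g \<in> fibre (Hom C' B D) m i" "f \<in> fibre (Hom C' A B)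
        m i"
      "(g2, g1) \<in> fibre (Hom M (LA B) (LA D)) m i" "(f2, f1) \<in> fibre (Hom M (LA A) (LA B)) m i"
    note g = A(4)[unfolded conM_fibre, THEN conjunct1] A(4)[unfolded conM_fibre laterM_Hom, THEN
        conjunct2]
    note f = A(5)[unfolded conM_fibre, THEN conjunct1] A(5)[unfolded conM_fibre laterM_Hom, THEN
        conjunct2]
    note LM = LP_Ob[OF rc_Ob[OF A(1)]] LP_Ob[OF rc_Ob[OF A(2)]] LP_Ob[OF rc_Ob[OF A(3)]]
    have C: "(exp_comp I (Lim (rc (s2 D))) (Lim (rc (s2 B))) (Lim (rc (s2 A))) m (f2, g2),
        exp_comp I (Lim (rc A)) (Lim (rc B)) (Lim (rc D)) m (g1, f1)) =
        Comp M (LA A) (LA B) (LA D) m ((g2, g1), (f2, f1))"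
      unfolding mixed_comp[OF A(6,7)] fst_conv snd_conv rc_s2 ..
    note w = mixed_comp_in[OF I M_SO[OF LM(1)] M_SO[OF LM(3)] A(6,7)]
    show "KP2 A D m (Comp C' A B D m (g, f)) (next_tree (Hom M (LA A) (LA D)) m
          (exp_comp I (Lim (rc (s2 D))) (Lim (rc (s2 B))) (Lim (rc (s2 A))) m (f2, g2),
           exp_comp I (Lim (rc A)) (Lim (rc B)) (Lim (rc D)) m (g1, f1))) =
        exp_comp I (KL (rc A)) (KL (rc B)) (KL (rc D)) m
          (KP2 B D m g (next_tree (Hom M (LA B) (LA D)) m (g2, g1)),
           KP2 A B m f (next_tree (Hom M (LA A) (LA B)) m (f2, f1)))"
      unfolding C KP2_next[OF A(1,3) con_comp(1)[OF A(1-5)] w] KP2_next[OF A(1,2,5,7)] KP2_next[OF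
          A(2,3,4,6)]
      unfolding prod_comp[OF A(4,5)] fst_conv snd_conv
        ext_comp[OF index_facts(1) g(1) A(6) f(1) A(7), unfolded fst_conv snd_conv, symmetric]
        KL_up[OF A(1)] KL_up[OF A(2)] KL_up[OF A(3)]
      by (rule ck.act_comp[OF up_Ob[OF A(1)] up_Ob[OF A(2)] up_Ob[OF A(3)] con_ObD(2)[OF A(1)]
          con_ObD(2)[OF A(2)]
          con_ObD(2)[OF A(3)] ext_in[OF index_facts(1) g(1) A(6), unfolded fst_conv snd_conv] g(2)
          ext_in[OF index_facts(1) f(1) A(7), unfolded fst_conv snd_conv] f(2)])
  qed
qed

end

section \<open>The factor of \<open>Fix F\<close> through \<open>next\<close>\<close>

context fix_contr
begin

text \<open>At \<open>next\<close> of an undelayed \<open>y\<close> the delayed equation is the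
  original one, by \<open>KP2_next\<close> and \<open>F_Kk\<close>. So the original solution solves
  it, and uniqueness applies.\<close>

lemma cc_fx_next:
  assumes A: "A \<in> Ob C'" "B \<in> Ob C'" and h: "h \<in> fibre (Hom P' (fst A) (fst B)) m i"
    and y: "y \<in> fibre (Hom M (snd A) (snd B)) m i"
  shows "cc.fx m A B (h, (i, next_tree (Hom M (snd A) (snd B)) m y)) = fp.fx m (rc A) (rc B) (ext k h y)"
proof -
  have next_in: "(h, (i, next_tree (Hom M (snd A) (snd B)) m y)) \<in> fibre (Hom C' A B) m i"
    if "h \<in> fibre (Hom P' (fst A) (fst B)) m i" "y \<in> fibre (Hom M (snd A) (snd B)) m i" for A B h y
    unfolding conM_fibre fst_conv snd_conv laterM_Hom
    using that next_in_later[OF mixed_slice[OF I] that(2)] by blast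
  have ext_in': "ext k h y \<in> fibre (Hom P (rc A) (rc B)) m i"
    if "h \<in> fibre (Hom P' (fst A) (fst B)) m i" "y \<in> fibre (Hom M (snd A) (snd B)) m i" for A B h y
    using ext_in[OF index_facts(2) that] unfolding index_facts(4) rc_def .
  have KP: "KP2 A B m (h, (i, next_tree (Hom M (snd A) (snd B)) m y)) (next_tree (Hom M (LA A) (LA B))
      m w) =
      act (rc A) (LA A) (rc B) (LA B) m (ext k h y) (fst (ext k h y), next_tree (Hom M (LA A) (LA B))
          m w)"
    if A: "A \<in> Ob C'" "B \<in> Ob C'" and h: "h \<in> fibre (Hom P' (fst A) (fst B)) m i"
      and y: "y \<in> fibre (Hom M (snd A) (snd B)) m i" and w: "w \<in> fibre (Hom M (LA A) (LA B)) m i" for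
          A B h y w
  proof -
    have f: "fst (ext k h y) = i" using h unfolding powM_fibre by simp
    show ?thesis
      unfolding KP2_next[OF A next_in[OF h y] w] f
      unfolding fst_conv snd_conv rc_def[of A] rc_def[of B]
      using F_Kk[OF con_ObD(1)[OF A(1)] con_ObD(1)[OF A(2)] con_ObD(2)[OF A(1)] con_ObD(2)[OF A(2)]
          LP_Ob[OF rc_Ob[OF A(1)]] LP_Ob[OF rc_Ob[OF A(2)]] h y w]
      unfolding fst_conv snd_conv rc_def[of A] rc_def[of B] by (rule sym)
  qed
  have eq: "fp.fx m (rc A) (rc B) (ext k h y) = cc.cj A B m i
      (KP2 A B m (h, (i, next_tree (Hom M (snd A) (snd B)) m y))
        (next_tree (Hom M (LA A) (LA B)) m
          (fp.fx m (s (rc B)) (s (rc A)) (swe {..<n} (ext k h y)), fp.fx m (rc A) (rc B) (ext k h y))))"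
    if A: "A \<in> Ob C'" "B \<in> Ob C'" and h: "h \<in> fibre (Hom P' (fst A) (fst B)) m i"
      and y: "y \<in> fibre (Hom M (snd A) (snd B)) m i" for A B h y
  proof -
    note e = ext_in'[OF h y] and rr = rc_Ob[OF A(1)] rc_Ob[OF A(2)]
    have w: "(fp.fx m (s (rc B)) (s (rc A)) (swe {..<n} (ext k h y)), fp.fx m (rc A) (rc B) (ext k h y))
        \<in> fibre (Hom M (LA A) (LA B)) m i"
      using fp.fx_pair_in[OF rr e] unfolding mixed_ecat_simps(2) fst_conv snd_conv .
    show ?thesis
      unfolding KP[OF A h y w] using fp.fx_eq[OF rr e]
      unfolding fp.cj_def cc.cj_def mixed_ecat_simps(2) fst_conv snd_conv .
  qed
  have sh: "swe J' h \<in> fibre (Hom P' (fst (s2 B)) (fst (s2 A))) m i"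
    unfolding s2_def fst_conv by (rule powM_swap(1)[OF h])
  have sy: "prod.swap y \<in> fibre (Hom M (snd (s2 B)) (snd (s2 A))) m i"
    unfolding s2_def snd_conv by (rule mixed_swap_in[OF y])
  have swe_ext: "swe {..<n} (ext k h y) = ext k (swe J' h) (prod.swap y)" for h y
    unfolding fst_conv snd_conv swp_upd ..
  have s2z: "\<sigma>2 (h, (i, next_tree (Hom M (snd A) (snd B)) m y)) =
      (swe J' h, (i, next_tree (Hom M (snd (s2 B)) (snd (s2 A))) m (prod.swap y)))"
    unfolding \<sigma>2_def fst_conv snd_conv swl_next[OF y] s2_def ..
  have ss: "swe {..<n} (ext k (swe J' h) (prod.swap y)) = ext k h y"
    unfolding swe_ext using powM_swap(2)[OF h] by (simp add: prod_eq_iff)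
  show ?thesis
  proof (rule cc.fx_unique[OF A next_in[OF h y], symmetric])
    show "fp.fx m (rc (s2 B)) (rc (s2 A)) (ext k (swe J' h) (prod.swap y)) \<in>
        fibre (exp_slice I (Lim (rc (s2 B))) (Lim (rc (s2 A)))) m i"
      by (rule fp.fx_in[OF rc_Ob[OF s2_Ob[OF A(2)]] rc_Ob[OF s2_Ob[OF A(1)]] ext_in'[OF sh sy]])
    show "fp.fx m (rc A) (rc B) (ext k h y) \<in> fibre (exp_slice I (Lim (rc A)) (Lim (rc B))) m i"
      by (rule fp.fx_in[OF rc_Ob[OF A(1)] rc_Ob[OF A(2)] ext_in'[OF h y]])
    show "fp.fx m (rc A) (rc B) (ext k h y) = cc.cj A B m i
      (KP2 A B m (h, (i, next_tree (Hom M (snd A) (snd B)) m y))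
        (next_tree (prod_slice (exp_slice I (Lim (rc (s2 B))) (Lim (rc (s2 A)))) (exp_slice I (Lim (rc
            A)) (Lim (rc B)))) m
          (fp.fx m (rc (s2 B)) (rc (s2 A)) (ext k (swe J' h) (prod.swap y)), fp.fx m (rc A) (rc B)
              (ext k h y))))"
      using eq[OF A h y] unfolding rc_s2 mixed_ecat_simps(2) fst_conv snd_conv swp_upd .
    \<comment> \<open>The partner equation is the same statement for the swapped element, as the
      swap commutes with \<open>next\<close> and with adjoining a coordinate.\<close>
    have swap_eq: "fp.fx m (rc (s2 B)) (rc (s2 A)) (ext k (swe J' h) (prod.swap y)) = cc.cj (s2 B) (s2
        A) m i
      (KP2 (s2 B) (s2 A) m (swe J' h, (i, next_tree (Hom M (snd (s2 B)) (snd (s2 A))) m (prod.swap y)))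
        (next_tree (Hom M (LA (s2 B)) (LA (s2 A))) m
          (fp.fx m (s (rc (s2 A))) (s (rc (s2 B))) (ext k h y),
           fp.fx m (rc (s2 B)) (rc (s2 A)) (ext k (swe J' h) (prod.swap y)))))"
      using eq[OF s2_Ob[OF A(2)] s2_Ob[OF A(1)] sh sy] unfolding ss .
    show "fp.fx m (rc (s2 B)) (rc (s2 A)) (ext k (swe J' h) (prod.swap y)) =
      cc.cj (s2 B) (s2 A) m i (KP2 (s2 B) (s2 A) m (\<sigma>2 (h, (i, next_tree (Hom M (snd A) (snd B)) m y)))
        (next_tree (prod_slice (exp_slice I (Lim (rc (s2 (s2 A)))) (Lim (rc (s2 (s2 B)))))
            (exp_slice I (Lim (rc (s2 B))) (Lim (rc (s2 A))))) m
          (fp.fx m (rc A) (rc B) (ext k h y), fp.fx m (rc (s2 B)) (rc (s2 A)) (ext k (swe J' h)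
              (prod.swap y)))))"
      using swap_eq
      unfolding s2z mixed_ecat_simps(2)[of U I "LA (s2 B)"] fst_conv snd_conv
      unfolding rc_s2[of "s2 A", symmetric] rc_s2[of "s2 B", symmetric] s2_s2[OF A(1)] s2_s2[OF A(2)] .
  qed
qed

text \<open>The witness for local contractiveness of \<open>FixF\<close> in the variable
  \<open>k\<close>.\<close>

definition con_fix where
  "con_fix = \<lparr>fob = (\<lambda>A. Lim (rc A)), fhom = (\<lambda>A B m. \<lambda>z\<in>car (Hom C' A B) m. cc.fx m A B z)\<rparr>"

lemma con_fix_sel:
  "fob con_fix A = Lim (rc A)" "z \<in> fibre (Hom C' A B) m i \<Longrightarrow> fhom con_fix A B m z = cc.fx m A B z"
  unfolding con_fix_def by (simp, simp only: efunctor.simps, rule restrict_apply', rule fibre_car)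

lemma con_fix_efunctor: "is_efunctor I C' (slice_ecat U I) con_fix"
proof (rule efunctorI; (unfold slice_ecat_simps con_fix_sel(1))?)
  show "Lim (rc A) \<in> SO U I" if "A \<in> Ob C'" for A by (rule Lim_SO[OF rc_Ob[OF that]])
  show "is_slice I (Hom C' A B)" for A B by (rule con_slice[OF I])
  show "fhom con_fix A B m \<in> extensional (car (Hom C' A B) m)" for A B m
    unfolding con_fix_def by (simp only: efunctor.simps restrict_extensional)
  fix A B m i h assume A: "A \<in> Ob C'" "B \<in> Ob C'" "h \<in> fibre (Hom C' A B) m i"
  show "fhom con_fix A B m h \<in> fibre (exp_slice I (Lim (rc A)) (Lim (rc B))) m i"
    unfolding con_fix_sel(2)[OF A(3)] by (rule cc.fx_in[OF A])
next
  fix A B m i h assume A: "A \<in> Ob C'" "B \<in> Ob C'" "h \<in> fibre (Hom C' A B) (Suc m) i"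
  show "res (exp_slice I (Lim (rc A)) (Lim (rc B))) m (fhom con_fix A B (Suc m) h) = fhom con_fix A B
      m (res (Hom C' A B) m h)"
    unfolding con_fix_sel(2)[OF A(3)] con_fix_sel(2)[OF fibre_res[OF con_slice[OF I] A(3)]] by (rule
        cc.fx_res[OF A])
next
  fix A B D m i g h
  assume A: "A \<in> Ob C'" "B \<in> Ob C'" "D \<in> Ob C'" "g \<in> fibre (Hom C' B D) m i" "h \<in> fibre (Hom C' A B) m i"
  show "fhom con_fix A D m (Comp C' A B D m (g, h)) =
      exp_comp I (Lim (rc A)) (Lim (rc B)) (Lim (rc D)) m (fhom con_fix B D m g, fhom con_fix A B m h)"
    unfolding con_fix_sel(2)[OF A(4)] con_fix_sel(2)[OF A(5)] con_fix_sel(2)[OF con_comp(1)[OF A]] by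
        (rule cc.fx_comp[OF A])
next
  fix A m i assume A: "A \<in> Ob C'" "i \<in> car I m"
  show "fhom con_fix A A m (Id C' A m i) = eid I (Lim (rc A)) m i"
    unfolding con_fix_sel(2)[OF con_id(1)[OF A]] by (rule cc.fx_id[OF A])
qed

lemma FixF_contractive: "locally_contractive U I n k FixF"
  unfolding locally_contractive_def dom_ecat_eq contr_ecat_def J'[symmetric]
proof (intro exI[where x=con_fix] conjI ballI allI)
  show "is_efunctor I C' (slice_ecat U I) con_fix" by (rule con_fix_efunctor)
  \<comment> \<open>This undoes the splitting of a tuple by \<open>next_efunctor\<close>.\<close>
  have split: "p = (restrict p J')(k := p k)" if "p \<in> extensional {..<n}" for p :: "nat \<Rightarrow> 'e"
    using that index_facts(4) J' by (auto simp: fun_eq_iff extensional_def)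
  have nf: "fob (next_efunctor U I n k) p = (restrict p J', p k)" for p
    by (simp add: next_efunctor_def J')
  have ext: "p \<in> extensional {..<n}" if "p \<in> Ob P" for p using that by (auto simp: PiE_iff)
  have rcn: "rc (fob (next_efunctor U I n k) p) = p" if "p \<in> Ob P" for p
    unfolding nf rc_def fst_conv snd_conv using split[OF ext[OF that]] by simp
  have nC: "fob (next_efunctor U I n k) p \<in> Ob C'" if "p \<in> Ob P" for p
    unfolding nf using that k J' by (auto simp: PiE_iff)
  fix p assume p: "p \<in> Ob P"
  show "fob FixF p = fob con_fix (fob (next_efunctor U I n k) p)"
    unfolding con_fix_sel rcn[OF p] FixF_sel ..
  fix q m h assume q: "q \<in> Ob P" and hc: "h \<in> car (Hom P p q) m"
  define i where "i = fst h"
  have h: "h \<in> fibre (Hom P p q) m i"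
    using hc by (auto simp: i_def fibre_def prod_family_def Let_def)
  let ?A = "fob (next_efunctor U I n k) p" and ?B = "fob (next_efunctor U I n k) q"
  let ?h = "(i, restrict (snd h) J')"
  have h': "?h \<in> fibre (Hom P' (fst ?A) (fst ?B)) m i"
    using h unfolding powM_fibre nf J' by (auto simp: PiE_iff simp del: mixed_ecat_simps)
  have y: "snd h k \<in> fibre (Hom M (snd ?A) (snd ?B)) m i"
    unfolding nf snd_conv by (rule powM_fibre_mem[OF h]) (simp add: k)
  have e: "ext k ?h (snd h k) = h"
    using split[of "snd h"] h unfolding powM_fibre by (auto simp: prod_eq_iff PiE_iff)
  have N: "fhom (next_efunctor U I n k) p q m h = (?h, (i, next_tree (Hom M (snd ?A) (snd ?B)) m (snd
      h k)))"
    using hc next_slice_eq[OF y] unfolding nf i_def J'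
    by (cases h) (simp add: next_efunctor_def dom_ecat_eq del: pow_simps mixed_ecat_simps)
  have z: "(?h, (i, next_tree (Hom M (snd ?A) (snd ?B)) m (snd h k))) \<in> fibre (Hom C' ?A ?B) m i"
    unfolding conM_fibre laterM_Hom using h' next_in_later[OF mixed_slice[OF I] y] by simp
  show "fhom FixF p q m h = fhom con_fix ?A ?B m (fhom (next_efunctor U I n k) p q m h)"
    unfolding N con_fix_sel(2)[OF z] cc_fx_next[OF nC[OF p] nC[OF q] h' y] e rcn[OF p] rcn[OF q]
    unfolding FixF_sel by (rule fix_hom[OF h])
qed

end

text \<open>The iteration in \<open>con_start\<close> needs some object of the universe to begin
  with; the terminal one is available because the carriers of \<open>I\<close> lie in
  \<open>U\<close>.\<close>

lemma terminal_slice: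
  assumes "is_tree I" "in_universe U I"
  shows "\<lparr>car = car I, res = res I, prj = (\<lambda>n. \<lambda>i\<in>car I n. i)\<rparr> \<in> slice_objects U I"
  using assms by (auto simp: slice_objects_def in_universe_def is_slice_def is_tree_def tree_hom_def)

text \<open>Uniqueness is stated in two forms, as neither contains the other: the first compares
  enriched actions, while the second admits solutions without strength.\<close>

theorem theorem4p5:
  fixes U :: "'u set set" and I :: "'u tree" and n :: nat and F :: "'u mfunctor"
  assumes "set_universe U"
    and "is_tree I" and "in_universe U I"
    and "strong_functor U I (Suc n) F"
    and "locally_contractive U I (Suc n) n F"
  shows "\<exists>FixF :: 'u mfunctor.
    strong_functor U I n FixF \<and>
    (\<exists>\<alpha>. strong_natural_iso U I n (fix_functional n F FixF) FixF \<alpha>) \<and>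
    (\<forall>G. strong_functor U I n G \<and> (\<exists>\<alpha>. strong_natural_iso U I n (fix_functional n F G) G \<alpha>)
       \<longrightarrow> (\<exists>\<theta>. strong_natural_iso U I n FixF G \<theta>)) \<and>
    (\<forall>G. is_functor (dom_cat U I n) (slice_cat U I) G \<and>
         (\<exists>\<alpha>. natural_iso (dom_cat U I n) (slice_cat U I) (fix_functional n F G) G \<alpha>)
       \<longrightarrow> (\<exists>\<theta>. natural_iso (dom_cat U I n) (slice_cat U I) FixF G \<theta>)) \<and>
    ((\<forall>k<Suc n. locally_contractive U I (Suc n) k F) \<longrightarrow>
       (\<forall>k<n. locally_contractive U I n k FixF))"
proof -
  have J0: "{..<n} = {..<Suc n} - {n}" by auto
  obtain K :: "'u con_fun"
    where K: "is_efunctor I (conM U I {..<n}) (slice_ecat U I) K"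
    and Ko: "\<And>p A. p \<in> Ob (domP U I n) \<Longrightarrow> A \<in> Ob (mixed_ecat U I) \<Longrightarrow> fob F (p(n := A)) = fob K (p, A)"
    and Kh: "\<And>p q A B m i h z. p \<in> Ob (domP U I n) \<Longrightarrow> q \<in> Ob (domP U I n) \<Longrightarrow>
      A \<in> Ob (mixed_ecat U I) \<Longrightarrow> B \<in> Ob (mixed_ecat U I) \<Longrightarrow> h \<in> fibre (Hom (domP U I n) p q) m i \<Longrightarrow>
      z \<in> fibre (Hom (mixed_ecat U I) A B) m i \<Longrightarrow>
      fhom F (p(n := A)) (q(n := B)) m (ext n h z) =
      fhom K (p, A) (q, B) m (h, (i, next_tree (Hom (mixed_ecat U I) A B) m z))"
    using locally_contractive_witness[OF assms(5) lessI J0] by metis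
  interpret fix_ctx U I n K "\<lparr>car = car I, res = res I, prj = (\<lambda>n. \<lambda>i\<in>car I n. i)\<rparr>" F
    by unfold_locales (fact assms(2) K terminal_slice[OF assms(2,3)] assms(4) Ko Kh)+
  show ?thesis
  proof (intro exI[where x=FixF] conjI allI impI; (elim conjE exE)?)
    show "strong_functor U I n FixF" by (rule FixF_strong)
    show "\<exists>\<alpha>. strong_natural_iso U I n (ff FixF) FixF \<alpha>" by (rule fix_iso)
  next
    fix G \<alpha> assume G: "strong_functor U I n G" "strong_natural_iso U I n (ff G) G \<alpha>"
    then have "is_functor (dom_cat U I n) (slice_cat U I) G" "natural_iso (dom_cat U I n) (slice_cat U
        I) (ff G) G \<alpha>"
      unfolding strong_functor_def strong_natural_iso_def by blast+
    from fix_unique[OF this] obtain \<theta> where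
      "strong_functor U I n G \<and> strong_natural_iso U I n (ff G) G \<alpha> \<longrightarrow> strong_natural_iso U I n FixF G \<theta>"
      by (elim exE conjE)
    from mp[OF this conjI[OF G]] show "\<exists>\<theta>. strong_natural_iso U I n FixF G \<theta>"
      by (rule exI[where P="strong_natural_iso U I n FixF G"])
  next
    fix G \<alpha> assume "is_functor (dom_cat U I n) (slice_cat U I) G"
      "natural_iso (dom_cat U I n) (slice_cat U I) (ff G) G \<alpha>"
    from fix_unique[OF this] obtain \<theta> where "natural_iso (dom_cat U I n) (slice_cat U I) FixF G \<theta>"
      by (elim exE conjE)
    then show "\<exists>\<theta>. natural_iso (dom_cat U I n) (slice_cat U I) FixF G \<theta>"
      by (rule exI[where P="natural_iso (dom_cat U I n) (slice_cat U I) FixF G"])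
  next
    fix k assume all: "\<forall>k<Suc n. locally_contractive U I (Suc n) k F" and k: "k < n"
    \<comment> \<open>Delaying the variable \<open>k\<close> of \<open>F\<close> leaves the last
      variable \<open>n\<close> among the undelayed ones; \<open>fix_contr\<close> expects it to be
      set apart by \<open>insert\<close>.\<close>
    have J: "insert n ({..<n} - {k}) = {..<Suc n} - {k}" using k by auto
    have lc: "locally_contractive U I (Suc n) k F" "k < Suc n" using all k by simp_all
    obtain Kk :: "'u con_fun"
      where Kk: "is_efunctor I (conM U I (insert n ({..<n} - {k}))) (slice_ecat U I) Kk"
      and Kko: "\<And>p A. p \<in> Ob (powM U I (insert n ({..<n} - {k}))) \<Longrightarrow> A \<in> Ob (mixed_ecat U I) \<Longrightarrow>
        fob F (p(k := A)) = fob Kk (p, A)"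
      and Kkh: "\<And>p q A B m i h z. p \<in> Ob (powM U I (insert n ({..<n} - {k}))) \<Longrightarrow>
        q \<in> Ob (powM U I (insert n ({..<n} - {k}))) \<Longrightarrow>
        A \<in> Ob (mixed_ecat U I) \<Longrightarrow> B \<in> Ob (mixed_ecat U I) \<Longrightarrow>
        h \<in> fibre (Hom (powM U I (insert n ({..<n} - {k}))) p q) m i \<Longrightarrow>
        z \<in> fibre (Hom (mixed_ecat U I) A B) m i \<Longrightarrow>
        fhom F (p(k := A)) (q(k := B)) m (ext k h z) =
        fhom Kk (p, A) (q, B) m (h, (i, next_tree (Hom (mixed_ecat U I) A B) m z))"
      using locally_contractive_witness[OF lc J] by metis
    interpret fix_contr U I n K "\<lparr>car = car I, res = res I, prj = (\<lambda>n. \<lambda>i\<in>car I n. i)\<rparr>" F k Kk "{..<n}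
        - {k}"
      by unfold_locales (fact k refl Kk Kko Kkh)+
    show "locally_contractive U I n k FixF" by (rule FixF_contractive)
  qed
qed

end
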